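(* Let $n \ge 0$ be an integer and let $k$ be a field. The affine variety $\mathfrak{B}_{n,k}^{\mathrm{et}}$ is irreducible and of dimension $n^2$.
   Context: All rings and algebras are commutative, associative, and with $1$. $\mathfrak{B}_n$ is the affine finite-type $\mathbb{Z}$-scheme representing the functor that sends a scheme $S$ to the set of isomorphism classes of pairs $(\mathcal{A},\phi)$ with $\mathcal{A}$ an $\mathcal{O}_S$-algebra and $\phi\colon \mathcal{A} \to \mathcal{O}_S^{\oplus n}$ an $\mathcal{O}_S$-module isomorphism (two pairs $(\mathcal{A},\phi)$, $(\mathcal{A}',\phi')$ are identified if there is an $\mathcal{O}_S$-algebra isomorphism $\alpha\colon\mathcal{A}\to\mathcal{A}'$ with $\phi'\circ\alpha=\phi$), and sends a morphism to pullback along it. Given $(\mathcal{A},\phi)\in\mathfrak{B}_n(S)$, let $\mathrm{Tr}\colon\mathcal{A}\to\mathcal{O}_S$ be the trace, let $e_1,\dots,e_n$ be the standard basis of $\mathcal{O}_S^{\oplus n}$ and $b_i=\phi^{-1}(e_i)$. Define the regular function $\Delta\colon\mathfrak{B}_n\to\mathbb{A}^1$ by $\Delta(\mathcal{A},\phi)=\det(\mathrm{Tr}(b_ib_j))_{i,j}\in H^0(S,\mathcal{O}_S)$. The étale locus $\mathfrak{B}_n^{\mathrm{et}}$ is the open affine subscheme of $\mathfrak{B}_n$ that is the complement of $\{\Delta=0\}$. For a $\mathbb{Z}$-scheme $V$, $V_k = V\times_{\mathrm{Spec}\,\mathbb{Z}}\mathrm{Spec}\,k$; in particular $\mathfrak{B}_{n,k}^{\mathrm{et}}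 = (\mathfrak{B}_n^{\mathrm{et}})_k$. *)

theory Defs
  imports
    "HOL-Algebra.QuotRing"
    "HOL-Algebra.Algebraic_Closure_Type"
    "HOL-Analysis.Abstract_Topology"
    "HOL-Library.Poly_Mapping"
    "HOL-Library.Extended_Real"
    "Jordan_Normal_Form.Determinant"
begin

section \<open>The Zariski topology, irreducibility and Krull dimension\<close>

definition spectrum :: "('a, 'b) ring_scheme \<Rightarrow> 'a set set" where
  "spectrum R = {p. primeideal p R}"

definition zariski :: "('a, 'b) ring_scheme \<Rightarrow> 'a set topology" where
  "zariski R =
     topology (\<lambda>U. \<exists>E. E \<subseteq> carrier R \<and> U = {p \<in> spectrum R. \<not> E \<subseteq> p})"

definition irreducible_space :: "'a topology \<Rightarrow> bool" where
  "irreducible_space T \<longleftrightarrow>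
     topspace T \<noteq> {} \<and>
     (\<forall>C D. closedin T C \<and> closedin T D \<and> C \<union> D = topspace T \<longrightarrow>
        C = topspace T \<or> D = topspace T)"

text \<open>The supremum is taken in the extended reals, so that the empty space gets
  dimension \<open>-\<infinity>\<close>.\<close>

definition krull_dim :: "'a topology \<Rightarrow> ereal" where
  "krull_dim T = Sup {ereal (real m) | m. \<exists>Z :: nat \<Rightarrow> 'a set.
     (\<forall>i\<le>m. closedin T (Z i) \<and> irreducible_space (subtopology T (Z i))) \<and>
     (\<forall>i<m. Z i \<subset> Z (Suc i))}"

lemma istopology_zariski:
  "istopology (\<lambda>U. \<exists>E. E \<subseteq> carrier R \<and> U = {p \<in> spectrum R. \<not> E \<subseteq> p})"
  (is "istopology ?P")
proof (cases "cring R")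
  case False
  hence "spectrum R = {}"
    unfolding spectrum_def using primeideal.axioms(2) by blast
  thus ?thesis by (auto simp: istopology_def)
next
  case True
  then interpret cring R .
  have inter: "?P (S \<inter> T)" if S: "?P S" and T: "?P T" for S T
  proof -
    obtain E where E: "E \<subseteq> carrier R" "S = {p \<in> spectrum R. \<not> E \<subseteq> p}" using S by blast
    obtain F where F: "F \<subseteq> carrier R" "T = {p \<in> spectrum R. \<not> F \<subseteq> p}" using T by blast
    let ?G = "{e \<otimes>\<^bsub>R\<^esub> f | e f. e \<in> E \<and> f \<in> F}"
    have G: "?G \<subseteq> carrier R" using E(1) F(1) by blast
    have "\<not> ?G \<subseteq> p \<longleftrightarrow> \<not> E \<subseteq> p \<and> \<not> F \<subseteq> p" if p: "p \<in> spectrum R" for p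
    proof -
      interpret p: primeideal p R using p by (simp add: spectrum_def)
      show ?thesis
      proof
        assume "\<not> ?G \<subseteq> p"
        then obtain e f where ef: "e \<in> E" "f \<in> F" "e \<otimes>\<^bsub>R\<^esub> f \<notin> p" by blast
        thus "\<not> E \<subseteq> p \<and> \<not> F \<subseteq> p"
          using p.I_l_closed p.I_r_closed E(1) F(1) by blast
      next
        assume "\<not> E \<subseteq> p \<and> \<not> F \<subseteq> p"
        then obtain e f where ef: "e \<in> E" "f \<in> F" "e \<notin> p" "f \<notin> p" by blast
        hence "e \<otimes>\<^bsub>R\<^esub> f \<notin> p" using p.I_prime E(1) F(1) by blast
        thus "\<not> ?G \<subseteq> p" using ef by blast
      qed
    qed
    hence "S \<inter> T = {p \<in> spectrum R. \<not> ?G \<subseteq> p}" using E F by blast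
    thus ?thesis using G by blast
  qed
  have union: "?P (\<Union>\<K>)" if K: "\<forall>K\<in>\<K>. ?P K" for \<K>
  proof -
    obtain E where E: "\<And>K. K \<in> \<K> \<Longrightarrow> E K \<subseteq> carrier R \<and> K = {p \<in> spectrum R. \<not> E K \<subseteq> p}"
      using K by metis
    have "\<Union>\<K> = {p \<in> spectrum R. \<not> (\<Union>K\<in>\<K>. E K) \<subseteq> p}"
    proof (intro equalityI subsetI)
      fix p assume "p \<in> \<Union>\<K>"
      then obtain K where K: "K \<in> \<K>" "p \<in> K" by blast
      hence "p \<in> spectrum R \<and> \<not> E K \<subseteq> p" using E[OF K(1)] by auto
      thus "p \<in> {p \<in> spectrum R. \<not> (\<Union>K\<in>\<K>. E K) \<subseteq> p}" using K(1) by blast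
    next
      fix p assume p: "p \<in> {p \<in> spectrum R. \<not> (\<Union>K\<in>\<K>. E K) \<subseteq> p}"
      then obtain K where K: "K \<in> \<K>" "\<not> E K \<subseteq> p" by blast
      hence "p \<in> K" using E[OF K(1)] p by auto
      thus "p \<in> \<Union>\<K>" using K by blast
    qed
    moreover have "(\<Union>K\<in>\<K>. E K) \<subseteq> carrier R" using E by (intro UN_least) simp
    ultimately show ?thesis by blast
  qed
  show ?thesis unfolding istopology_def
    by (intro conjI allI impI, rule inter, assumption, assumption, rule union)
qed

lemma openin_zariski:
  "openin (zariski R) U \<longleftrightarrow> (\<exists>E. E \<subseteq> carrier R \<and> U = {p \<in> spectrum R. \<not> E \<subseteq> p})"
  unfolding zariski_def topology_inverse'[OF istopology_zariski] ..

lemma topspace_zariski: "topspace (zariski R) = spectrum R"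
proof -
  have "spectrum R = {p \<in> spectrum R. \<not> carrier R \<subseteq> p}"
  proof -
    have "\<not> carrier R \<subseteq> p" if "p \<in> spectrum R" for p
    proof
      assume c: "carrier R \<subseteq> p"
      interpret p: primeideal p R using that by (simp add: spectrum_def)
      show False using c p.I_notcarr p.a_subset by blast
    qed
    thus ?thesis by blast
  qed
  hence "openin (zariski R) (spectrum R)"
    unfolding openin_zariski by (intro exI[of _ "carrier R"] conjI subset_refl)
  hence "spectrum R \<subseteq> topspace (zariski R)" by (rule openin_subset)
  moreover from openin_topspace[of "zariski R"] have "topspace (zariski R) \<subseteq> spectrum R"
    unfolding openin_zariski by (elim exE conjE) (simp only: Collect_restrict)
  ultimately show ?thesis by (intro equalityI)
qed

lemma closedin_zariski:
  "closedin (zariski R) C \<longleftrightarrow> (\<exists>E. E \<subseteq> carrier R \<and> C = {p \<in> spectrum R. E \<subseteq> p})"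
proof
  assume "closedin (zariski R) C"
  hence C: "C \<subseteq> spectrum R" and o: "openin (zariski R) (spectrum R - C)"
    unfolding closedin_def topspace_zariski by simp_all
  from o obtain E where E: "E \<subseteq> carrier R" "spectrum R - C = {p \<in> spectrum R. \<not> E \<subseteq> p}"
    unfolding openin_zariski by (elim exE conjE)
  have "C = spectrum R - (spectrum R - C)" using C by blast
  also have "\<dots> = {p \<in> spectrum R. E \<subseteq> p}" unfolding E(2) by blast
  finally show "\<exists>E. E \<subseteq> carrier R \<and> C = {p \<in> spectrum R. E \<subseteq> p}"
    using E(1) by (intro exI[of _ E] conjI)
next
  assume "\<exists>E. E \<subseteq> carrier R \<and> C = {p \<in> spectrum R. E \<subseteq> p}"
  then obtain E where E: "E \<subseteq> carrier R" "C = {p \<in> spectrum R. E \<subseteq> p}" by blast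
  have "spectrum R - C = {p \<in> spectrum R. \<not> E \<subseteq> p}" unfolding E(2) by blast
  hence "openin (zariski R) (spectrum R - C)"
    unfolding openin_zariski using E(1) by (intro exI[of _ E] conjI)
  moreover have "C \<subseteq> spectrum R" unfolding E(2) by blast
  ultimately show "closedin (zariski R) C" unfolding closedin_def topspace_zariski by simp
qed


section \<open>Based algebras\<close>

text \<open>
  A pair \<open>(A, \<phi>)\<close> over a commutative ring \<open>'r\<close>. The elements of \<open>'r\<^sup>n\<close> are the vectors in
  \<^term>\<open>carrier_vec n\<close>, whose standard basis is \<^term>\<open>unit_vec n i\<close> for \<open>i < n\<close>.
\<close>

locale based_algebra =
  Module.algebra "ring_of_type_algebra :: 'r::comm_ring_1 ring" A
  for n :: nat and A :: "('r::comm_ring_1, 'a) module" and \<phi> :: "'a \<Rightarrow> 'r::comm_ring_1 vec" +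
  assumes bij: "bij_betw \<phi> (carrier A) (carrier_vec n)"
    and phi_add: "\<lbrakk>x \<in> carrier A; y \<in> carrier A\<rbrakk> \<Longrightarrow> \<phi> (x \<oplus>\<^bsub>A\<^esub> y) = \<phi> x + \<phi> y"
    and phi_smult: "x \<in> carrier A \<Longrightarrow> \<phi> (r \<odot>\<^bsub>A\<^esub> x) = r \<cdot>\<^sub>v \<phi> x"

definition based_iso ::
  "('r::comm_ring_1, 'a) module \<Rightarrow> ('a \<Rightarrow> 'r vec) \<Rightarrow> ('r, 'b) module \<Rightarrow> ('b \<Rightarrow> 'r vec) \<Rightarrow> bool" where
  "based_iso A \<phi> A' \<phi>' \<longleftrightarrow> (\<exists>\<alpha> \<in> ring_iso A A'.
     (\<forall>r. \<forall>x\<in>carrier A. \<alpha> (r \<odot>\<^bsub>A\<^esub> x) = r \<odot>\<^bsub>A'\<^esub> \<alpha> x) \<and>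
     (\<forall>x\<in>carrier A. \<phi>' (\<alpha> x) = \<phi> x))"

definition basis_elem ::
  "nat \<Rightarrow> ('r::comm_ring_1, 'a) module \<Rightarrow> ('a \<Rightarrow> 'r vec) \<Rightarrow> nat \<Rightarrow> 'a" where
  "basis_elem n A \<phi> i = inv_into (carrier A) \<phi> (unit_vec n i)"

definition alg_trace ::
  "nat \<Rightarrow> ('r::comm_ring_1, 'a) module \<Rightarrow> ('a \<Rightarrow> 'r vec) \<Rightarrow> 'a \<Rightarrow> 'r" where
  "alg_trace n A \<phi> a = (\<Sum>i<n. \<phi> (a \<otimes>\<^bsub>A\<^esub> basis_elem n A \<phi> i) $ i)"

definition alg_disc ::
  "nat \<Rightarrow> ('r::comm_ring_1, 'a) module \<Rightarrow> ('a \<Rightarrow> 'r vec) \<Rightarrow> 'r" where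
  "alg_disc n A \<phi> = det (mat n n (\<lambda>(i, j).
     alg_trace n A \<phi> (basis_elem n A \<phi> i \<otimes>\<^bsub>A\<^esub> basis_elem n A \<phi> j)))"

definition str_const ::
  "nat \<Rightarrow> ('r::comm_ring_1, 'a) module \<Rightarrow> ('a \<Rightarrow> 'r vec) \<Rightarrow> nat \<Rightarrow> nat \<Rightarrow> nat \<Rightarrow> 'r" where
  "str_const n A \<phi> i j l = \<phi> (basis_elem n A \<phi> i \<otimes>\<^bsub>A\<^esub> basis_elem n A \<phi> j) $ l"

definition unit_const :: "('r, 'a) module \<Rightarrow> ('a \<Rightarrow> 'r vec) \<Rightarrow> nat \<Rightarrow> 'r" where
  "unit_const A \<phi> i = \<phi> \<one>\<^bsub>A\<^esub> $ i"


section \<open>The moduli scheme of based algebras\<close>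

text \<open>
  The quantities whose vanishing says that the multiplication
  \<open>e\<^sub>i e\<^sub>j = (\<Sum>l<n. c i j l e\<^sub>l)\<close> on \<open>'r\<^sup>n\<close> is commutative and associative and that
  \<open>(\<Sum>i<n. u i e\<^sub>i)\<close> is its unit element.
\<close>

definition alg_relations ::
  "nat \<Rightarrow> (nat \<Rightarrow> nat \<Rightarrow> nat \<Rightarrow> 'r) \<Rightarrow> (nat \<Rightarrow> 'r) \<Rightarrow> 'r::comm_ring_1 set" where
  "alg_relations n c u =
     {c i j l - c j i l | i j l. i < n \<and> j < n \<and> l < n} \<union>
     {(\<Sum>m<n. c i j m * c m k l) - (\<Sum>m<n. c j k m * c i m l)
        | i j k l. i < n \<and> j < n \<and> k < n \<and> l < n} \<union>
     {(\<Sum>i<n. u i * c i j l) - (if j = l then 1 else 0) | j l. j < n \<and> l < n}"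

text \<open>
  \<open>\<Delta>\<close> in terms of structure constants: \<open>e\<^sub>i e\<^sub>j = (\<Sum>l<n. c i j l e\<^sub>l)\<close>, and
  multiplication by \<open>e\<^sub>l\<close> has trace \<open>(\<Sum>m<n. c l m m)\<close>.
\<close>

definition disc :: "nat \<Rightarrow> (nat \<Rightarrow> nat \<Rightarrow> nat \<Rightarrow> 'r) \<Rightarrow> 'r::comm_ring_1" where
  "disc n c = det (mat n n (\<lambda>(i, j). \<Sum>l<n. c i j l * (\<Sum>m<n. c l m m)))"

text \<open>
  \<open>SC i j l\<close> stands for the structure constant \<open>c i j l\<close>, and \<open>UC i\<close> for the coordinate
  \<open>u i\<close> of the unit element.
\<close>

datatype coord = SC nat nat nat | UC nat

definition coords :: "nat \<Rightarrow> coord set" where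
  "coords n = {SC i j l | i j l. i < n \<and> j < n \<and> l < n} \<union> {UC i | i. i < n}"

type_synonym 'k coord_poly = "(coord \<Rightarrow>\<^sub>0 nat) \<Rightarrow>\<^sub>0 'k"

definition Var :: "coord \<Rightarrow> 'k::comm_ring_1 coord_poly" where
  "Var v = Poly_Mapping.single (Poly_Mapping.single v 1) 1"

definition Const :: "'k::comm_ring_1 \<Rightarrow> 'k coord_poly" where
  "Const a = Poly_Mapping.single 0 a"

definition poly_ring :: "coord set \<Rightarrow> 'k::comm_ring_1 coord_poly ring" where
  "poly_ring V = ring_of_type_algebra
     \<lparr>carrier := {p. \<forall>m \<in> Poly_Mapping.keys p. Poly_Mapping.keys m \<subseteq> V}\<rparr>"

definition rel_ideal :: "nat \<Rightarrow> 'k::comm_ring_1 coord_poly set" where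
  "rel_ideal n = Idl\<^bsub>poly_ring (coords n)\<^esub>
     (alg_relations n (\<lambda>i j l. Var (SC i j l)) (\<lambda>i. Var (UC i)))"

text \<open>
  The coordinate ring of \<open>\<BB>\<^sub>n\<close> over the base ring \<open>'k\<close>: the scheme \<open>\<BB>\<^sub>n\<close> itself
  is the case \<open>'k = int\<close>, and extending the coefficients of the polynomials gives the base
  changes. The theorems \<open>represents\<close> and \<open>base_change\<close> below show that these rings have
  the defining universal properties.
\<close>

definition B_ring :: "nat \<Rightarrow> 'k::comm_ring_1 coord_poly set ring" where
  "B_ring n = poly_ring (coords n) Quot rel_ideal n"

definition B_class :: "nat \<Rightarrow> 'k::comm_ring_1 coord_poly \<Rightarrow> 'k coord_poly set" where
  "B_class n p = rel_ideal n +>\<^bsub>poly_ring (coords n)\<^esub> p"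

definition B_Delta :: "nat \<Rightarrow> 'k::comm_ring_1 coord_poly set" where
  "B_Delta n = B_class n (disc n (\<lambda>i j l. Var (SC i j l)))"

text \<open>The underlying topological spaces of \<open>\<BB>\<^sub>n\<close> and of its open subscheme \<open>\<Delta> \<noteq> 0\<close>.\<close>

definition B_space :: "'k::comm_ring_1 itself \<Rightarrow> nat \<Rightarrow> 'k coord_poly set set topology" where
  "B_space _ n = zariski (B_ring n)"

definition B_et_space :: "'k::comm_ring_1 itself \<Rightarrow> nat \<Rightarrow> 'k coord_poly set set topology" where
  "B_et_space k n = subtopology (B_space k n) {p. B_Delta n \<notin> p}"


section \<open>Structure constants determine based algebras\<close>

lemma ring_of_type_simps [simp]:
  "carrier (ring_of_type_algebra :: 'r::comm_ring_1 ring) = UNIV"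
  "x \<otimes>\<^bsub>ring_of_type_algebra\<^esub> y = x * (y :: 'r)"
  "x \<oplus>\<^bsub>ring_of_type_algebra\<^esub> y = x + (y :: 'r)"
  "\<one>\<^bsub>ring_of_type_algebra\<^esub> = (1 :: 'r)"
  "\<zero>\<^bsub>ring_of_type_algebra\<^esub> = (0 :: 'r)"
  by (simp_all add: ring_of_type_algebra_def)

lemma linear_vec_expand:
  fixes g :: "'r::comm_ring_1 vec \<Rightarrow> 'r"
  assumes add: "\<And>v w. v \<in> carrier_vec n \<Longrightarrow> w \<in> carrier_vec n \<Longrightarrow> g (v + w) = g v + g w"
    and smult: "\<And>r v. v \<in> carrier_vec n \<Longrightarrow> g (r \<cdot>\<^sub>v v) = r * g v"
    and v: "v \<in> carrier_vec n"
  shows "g v = (\<Sum>i<n. v $ i * g (unit_vec n i))"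
proof -
  define t where "t m = vec n (\<lambda>i. if i < m then v $ i else 0)" for m
  have tc: "t m \<in> carrier_vec n" for m by (simp add: t_def)
  have "m \<le> n \<Longrightarrow> g (t m) = (\<Sum>i<m. v $ i * g (unit_vec n i))" for m
  proof (induction m)
    case 0
    have "t 0 = 0 \<cdot>\<^sub>v t 0" by (auto simp: t_def)
    hence "g (t 0) = 0 * g (t 0)" using smult[OF tc, of 0 0] by simp
    thus ?case by simp
  next
    case (Suc m)
    have "t (Suc m) = t m + v $ m \<cdot>\<^sub>v unit_vec n m"
      using Suc.prems by (auto simp: t_def less_Suc_eq)
    thus ?case using Suc add[OF tc, of "v $ m \<cdot>\<^sub>v unit_vec n m"] smult[of "unit_vec n m" "v $ m"]
      by simp
  qed
  moreover have "t n = v" using v by (auto simp: t_def)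
  ultimately show ?thesis by auto
qed

context based_algebra
begin

abbreviation "b \<equiv> basis_elem n A \<phi>"
abbreviation "c \<equiv> str_const n A \<phi>"
abbreviation "u \<equiv> unit_const A \<phi>"

lemmas A_rules = cring.cring_simprules[OF M_cring]

lemma A_closed: "\<lbrakk>x \<in> carrier A; y \<in> carrier A\<rbrakk> \<Longrightarrow> x \<otimes>\<^bsub>A\<^esub> y \<in> carrier A"
  and A_comm: "\<lbrakk>x \<in> carrier A; y \<in> carrier A\<rbrakk> \<Longrightarrow> x \<otimes>\<^bsub>A\<^esub> y = y \<otimes>\<^bsub>A\<^esub> x"
  and A_assoc: "\<lbrakk>x \<in> carrier A; y \<in> carrier A; z \<in> carrier A\<rbrakk> \<Longrightarrow>
     (x \<otimes>\<^bsub>A\<^esub> y) \<otimes>\<^bsub>A\<^esub> z = x \<otimes>\<^bsub>A\<^esub> (y \<otimes>\<^bsub>A\<^esub> z)"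
  and A_l_distr: "\<lbrakk>x \<in> carrier A; y \<in> carrier A; z \<in> carrier A\<rbrakk> \<Longrightarrow>
     (x \<oplus>\<^bsub>A\<^esub> y) \<otimes>\<^bsub>A\<^esub> z = x \<otimes>\<^bsub>A\<^esub> z \<oplus>\<^bsub>A\<^esub> y \<otimes>\<^bsub>A\<^esub> z"
  and A_r_distr: "\<lbrakk>x \<in> carrier A; y \<in> carrier A; z \<in> carrier A\<rbrakk> \<Longrightarrow>
     z \<otimes>\<^bsub>A\<^esub> (x \<oplus>\<^bsub>A\<^esub> y) = z \<otimes>\<^bsub>A\<^esub> x \<oplus>\<^bsub>A\<^esub> z \<otimes>\<^bsub>A\<^esub> y"
  and A_one: "\<one>\<^bsub>A\<^esub> \<in> carrier A"
  and A_l_one: "x \<in> carrier A \<Longrightarrow> \<one>\<^bsub>A\<^esub> \<otimes>\<^bsub>A\<^esub> x = x"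
  and A_add: "\<lbrakk>x \<in> carrier A; y \<in> carrier A\<rbrakk> \<Longrightarrow> x \<oplus>\<^bsub>A\<^esub> y \<in> carrier A"
  by (fact A_rules)+

lemma A_smult_closed: "x \<in> carrier A \<Longrightarrow> r \<odot>\<^bsub>A\<^esub> x \<in> carrier A"
  using smult_closed[of r x] by simp

lemma phi_closed: "x \<in> carrier A \<Longrightarrow> \<phi> x \<in> carrier_vec n"
  using bij by (auto dest: bij_betwE)

lemma phi_inj: "\<lbrakk>\<phi> x = \<phi> y; x \<in> carrier A; y \<in> carrier A\<rbrakk> \<Longrightarrow> x = y"
  using bij by (auto simp: bij_betw_def inj_on_def)

lemma phi_inv: "v \<in> carrier_vec n \<Longrightarrow> \<phi> (inv_into (carrier A) \<phi> v) = v"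
  using bij by (metis bij_betw_inv_into_right)

lemma inv_closed: "v \<in> carrier_vec n \<Longrightarrow> inv_into (carrier A) \<phi> v \<in> carrier A"
  using bij by (metis bij_betw_def inv_into_into)

lemma b_closed: "b i \<in> carrier A"
  unfolding basis_elem_def by (rule inv_closed) simp

lemma expand:
  assumes add: "\<And>x y. x \<in> carrier A \<Longrightarrow> y \<in> carrier A \<Longrightarrow> f (x \<oplus>\<^bsub>A\<^esub> y) = f x + f y"
    and smult: "\<And>r x. x \<in> carrier A \<Longrightarrow> f (r \<odot>\<^bsub>A\<^esub> x) = r * f x"
    and x: "x \<in> carrier A"
  shows "f x = (\<Sum>i<n. \<phi> x $ i * f (b i))"
proof -
  let ?\<psi> = "inv_into (carrier A) \<phi>"
  have "(f \<circ> ?\<psi>) (\<phi> x) = (\<Sum>i<n. \<phi> x $ i * (f \<circ> ?\<psi>) (unit_vec n i))"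
  proof (rule linear_vec_expand)
    fix v w :: "'r vec" assume v: "v \<in> carrier_vec n" and w: "w \<in> carrier_vec n"
    have "?\<psi> (v + w) = ?\<psi> v \<oplus>\<^bsub>A\<^esub> ?\<psi> w"
      by (rule phi_inj) (use v w in \<open>auto simp: phi_inv phi_add inv_closed\<close>)
    thus "(f \<circ> ?\<psi>) (v + w) = (f \<circ> ?\<psi>) v + (f \<circ> ?\<psi>) w"
      using v w by (simp add: add inv_closed)
  next
    fix r and v :: "'r vec" assume v: "v \<in> carrier_vec n"
    have "?\<psi> (r \<cdot>\<^sub>v v) = r \<odot>\<^bsub>A\<^esub> ?\<psi> v"
      by (rule phi_inj) (use v in \<open>auto simp: phi_inv phi_smult inv_closed A_smult_closed\<close>)
    thus "(f \<circ> ?\<psi>) (r \<cdot>\<^sub>v v) = r * (f \<circ> ?\<psi>) v"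
      using v by (simp add: smult inv_closed)
  qed (rule phi_closed[OF x])
  moreover have "?\<psi> (\<phi> x) = x" using bij x by (simp add: bij_betw_inv_into_left)
  ultimately show ?thesis by (simp add: basis_elem_def)
qed

lemma phi_mult:
  assumes x: "x \<in> carrier A" and y: "y \<in> carrier A" and l: "l < n"
  shows "\<phi> (x \<otimes>\<^bsub>A\<^esub> y) $ l = (\<Sum>i<n. \<Sum>j<n. \<phi> x $ i * \<phi> y $ j * c i j l)"
proof -
  have L: "\<phi> (x \<otimes>\<^bsub>A\<^esub> y) $ l = (\<Sum>i<n. \<phi> x $ i * \<phi> (b i \<otimes>\<^bsub>A\<^esub> y) $ l)"
    if y: "y \<in> carrier A" for y
    by (rule expand[of "\<lambda>x. \<phi> (x \<otimes>\<^bsub>A\<^esub> y) $ l"])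
      (use x y l in \<open>auto simp: A_l_distr phi_add smult_assoc2 phi_smult
         carrier_vecD[OF phi_closed]\<close>)
  have "\<phi> (b i \<otimes>\<^bsub>A\<^esub> y) $ l = (\<Sum>j<n. \<phi> y $ j * c i j l)" for i
    unfolding str_const_def
  proof (rule expand[of "\<lambda>y. \<phi> (b i \<otimes>\<^bsub>A\<^esub> y) $ l"])
    fix r z assume z: "z \<in> carrier A"
    have "b i \<otimes>\<^bsub>A\<^esub> (r \<odot>\<^bsub>A\<^esub> z) = r \<odot>\<^bsub>A\<^esub> (b i \<otimes>\<^bsub>A\<^esub> z)"
      using smult_assoc2[of r z "b i"] z b_closed
      by (simp add: A_comm A_smult_closed)
    thus "\<phi> (b i \<otimes>\<^bsub>A\<^esub> (r \<odot>\<^bsub>A\<^esub> z)) $ l = r * \<phi> (b i \<otimes>\<^bsub>A\<^esub> z) $ l"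
      using z l b_closed by (simp add: phi_smult carrier_vecD[OF phi_closed])
  qed (use y l b_closed in \<open>auto simp: A_r_distr phi_add carrier_vecD[OF phi_closed]\<close>)
  thus ?thesis unfolding L[OF y] by (simp add: sum_distrib_left mult.assoc)
qed

lemma phi_b: "i < n \<Longrightarrow> j < n \<Longrightarrow> \<phi> (b i) $ j = (if i = j then 1 else 0)"
  unfolding basis_elem_def by (simp add: phi_inv)

lemma relations_hold: "alg_relations n c u \<subseteq> {0}"
proof -
  have comm: "c i j l = c j i l" for i j l
    unfolding str_const_def using A_comm[OF b_closed b_closed] by metis
  have m1: "\<phi> (x \<otimes>\<^bsub>A\<^esub> b k) $ l = (\<Sum>m<n. \<phi> x $ m * c m k l)"
    if "x \<in> carrier A" "k < n" "l < n" for x k l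
    using that by (simp add: phi_mult[OF _ b_closed] phi_b if_distrib if_distribR sum.delta cong: if_cong)
  have assoc: "(\<Sum>m<n. c i j m * c m k l) = (\<Sum>m<n. c j k m * c i m l)"
    if "i < n" "j < n" "k < n" "l < n" for i j k l
  proof -
    have "(\<Sum>m<n. c i j m * c m k l) = \<phi> ((b i \<otimes>\<^bsub>A\<^esub> b j) \<otimes>\<^bsub>A\<^esub> b k) $ l"
      using that b_closed by (simp add: m1 str_const_def)
    also have "(b i \<otimes>\<^bsub>A\<^esub> b j) \<otimes>\<^bsub>A\<^esub> b k = (b j \<otimes>\<^bsub>A\<^esub> b k) \<otimes>\<^bsub>A\<^esub> b i"
      using b_closed by (metis A_assoc A_comm A_closed)
    also have "\<phi> \<dots> $ l = (\<Sum>m<n. c j k m * c m i l)"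
      using that b_closed by (simp add: m1 str_const_def)
    finally show ?thesis by (simp add: comm[of _ i])
  qed
  have unit: "(\<Sum>i<n. u i * c i j l) = (if j = l then 1 else 0)" if "j < n" "l < n" for j l
    using m1[of "\<one>\<^bsub>A\<^esub>" j l] that b_closed by (simp add: unit_const_def phi_b)
  show ?thesis unfolding alg_relations_def using comm assoc unit by auto
qed

lemma alg_disc_eq: "alg_disc n A \<phi> = disc n c"
proof -
  have "alg_trace n A \<phi> x = (\<Sum>l<n. \<phi> x $ l * (\<Sum>m<n. c l m m))" if "x \<in> carrier A" for x
  proof -
    have "alg_trace n A \<phi> x = (\<Sum>m<n. \<Sum>l<n. \<phi> x $ l * c l m m)"
      unfolding alg_trace_def using that
      by (simp add: phi_mult[OF _ b_closed] phi_b if_distrib if_distribR sum.delta cong: if_cong)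
    also have "\<dots> = (\<Sum>l<n. \<Sum>m<n. \<phi> x $ l * c l m m)" by (rule sum.swap)
    finally show ?thesis by (simp add: sum_distrib_left)
  qed
  thus ?thesis unfolding alg_disc_def disc_def
    using b_closed by (simp add: str_const_def)
qed

end

theorem based_iso_iff:
  fixes A :: "('r::comm_ring_1, 'a) module" and A' :: "('r, 'b) module"
  assumes A: "based_algebra n A \<phi>" and A': "based_algebra n A' \<phi>'"
  shows "based_iso A \<phi> A' \<phi>' \<longleftrightarrow>
    (\<forall>i<n. \<forall>j<n. \<forall>l<n. str_const n A \<phi> i j l = str_const n A' \<phi>' i j l)"
    (is "_ \<longleftrightarrow> ?R")
proof -
  interpret A: based_algebra n A \<phi> by (rule A)
  interpret A': based_algebra n A' \<phi>' by (rule A')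
  show ?thesis
  proof
    assume "based_iso A \<phi> A' \<phi>'"
    then obtain \<alpha> where \<alpha>: "\<alpha> \<in> ring_iso A A'" "\<And>x. x \<in> carrier A \<Longrightarrow> \<phi>' (\<alpha> x) = \<phi> x"
      unfolding based_iso_def by blast
    have cl: "\<alpha> x \<in> carrier A'" if "x \<in> carrier A" for x
      using \<alpha>(1) that by (auto simp: ring_iso_def Ring.ring_hom_def)
    have mul: "\<alpha> (x \<otimes>\<^bsub>A\<^esub> y) = \<alpha> x \<otimes>\<^bsub>A'\<^esub> \<alpha> y" if "x \<in> carrier A" "y \<in> carrier A" for x y
      using \<alpha>(1) that by (auto simp: ring_iso_def Ring.ring_hom_def)
    have b: "\<alpha> (A.b i) = A'.b i" for i
    proof (rule A'.phi_inj)
      show "\<phi>' (\<alpha> (A.b i)) = \<phi>' (A'.b i)"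
        using \<alpha>(2)[OF A.b_closed] by (simp add: basis_elem_def A.phi_inv A'.phi_inv)
    qed (simp_all add: cl A.b_closed A'.b_closed)
    show ?R
      unfolding str_const_def
      using \<alpha>(2) mul b by (metis A.b_closed A.A_closed)
  next
    assume R: ?R
    define \<alpha> where "\<alpha> x = inv_into (carrier A') \<phi>' (\<phi> x)" for x
    have phi: "\<phi>' (\<alpha> x) = \<phi> x" if "x \<in> carrier A" for x
      unfolding \<alpha>_def using that by (simp add: A'.phi_inv A.phi_closed)
    have cl: "\<alpha> x \<in> carrier A'" if "x \<in> carrier A" for x
      unfolding \<alpha>_def using that by (simp add: A'.inv_closed A.phi_closed)
    have mul: "\<alpha> (x \<otimes>\<^bsub>A\<^esub> y) = \<alpha> x \<otimes>\<^bsub>A'\<^esub> \<alpha> y" if xy: "x \<in> carrier A" "y \<in> carrier A" for x y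
    proof (rule A'.phi_inj)
      have "\<phi> (x \<otimes>\<^bsub>A\<^esub> y) = \<phi>' (\<alpha> x \<otimes>\<^bsub>A'\<^esub> \<alpha> y)"
      proof (rule eq_vecI)
        show "dim_vec (\<phi> (x \<otimes>\<^bsub>A\<^esub> y)) = dim_vec (\<phi>' (\<alpha> x \<otimes>\<^bsub>A'\<^esub> \<alpha> y))"
          using xy by (simp add: carrier_vecD[OF A.phi_closed] carrier_vecD[OF A'.phi_closed] cl)
        fix l assume "l < dim_vec (\<phi>' (\<alpha> x \<otimes>\<^bsub>A'\<^esub> \<alpha> y))"
        hence "l < n" using xy by (simp add: carrier_vecD[OF A'.phi_closed] cl)
        thus "\<phi> (x \<otimes>\<^bsub>A\<^esub> y) $ l = \<phi>' (\<alpha> x \<otimes>\<^bsub>A'\<^esub> \<alpha> y) $ l"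
          using xy R by (simp add: A.phi_mult A'.phi_mult cl phi)
      qed
      thus "\<phi>' (\<alpha> (x \<otimes>\<^bsub>A\<^esub> y)) = \<phi>' (\<alpha> x \<otimes>\<^bsub>A'\<^esub> \<alpha> y)" using xy by (simp add: phi)
    qed (use xy cl in auto)
    have add: "\<alpha> (x \<oplus>\<^bsub>A\<^esub> y) = \<alpha> x \<oplus>\<^bsub>A'\<^esub> \<alpha> y" if "x \<in> carrier A" "y \<in> carrier A" for x y
      by (rule A'.phi_inj) (use that in \<open>auto simp: phi cl A.phi_add A'.phi_add\<close>)
    have sm: "\<alpha> (r \<odot>\<^bsub>A\<^esub> x) = r \<odot>\<^bsub>A'\<^esub> \<alpha> x" if "x \<in> carrier A" for r x
      by (rule A'.phi_inj)
        (use that in \<open>auto simp: phi cl A.phi_smult A'.phi_smult A.A_smult_closed A'.A_smult_closed\<close>)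
    have bij: "bij_betw \<alpha> (carrier A) (carrier A')"
      unfolding \<alpha>_def
      using bij_betw_trans[OF A.bij bij_betw_inv_into[OF A'.bij]] by (simp add: comp_def)
    have one: "\<alpha> \<one>\<^bsub>A\<^esub> = \<one>\<^bsub>A'\<^esub>"
    proof -
      obtain x where x: "x \<in> carrier A" "\<alpha> x = \<one>\<^bsub>A'\<^esub>"
        using bij by (metis A'.A_one bij_betw_def imageE)
      have "\<alpha> \<one>\<^bsub>A\<^esub> = \<alpha> \<one>\<^bsub>A\<^esub> \<otimes>\<^bsub>A'\<^esub> \<alpha> x" using x cl by simp
      also have "\<dots> = \<alpha> x" using x mul[of "\<one>\<^bsub>A\<^esub>" x] by simp
      finally show ?thesis using x by simp
    qed
    have "\<alpha> \<in> ring_iso A A'"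
      by (rule ring_iso_memI) (use cl mul add one bij in auto)
    thus "based_iso A \<phi> A' \<phi>'" unfolding based_iso_def using sm phi by blast
  qed
qed

theorem based_algebra_exists:
  fixes c :: "nat \<Rightarrow> nat \<Rightarrow> nat \<Rightarrow> 'r::comm_ring_1"
  assumes rel: "alg_relations n c u \<subseteq> {0}"
  obtains A :: "('r, 'r vec) module" and \<phi> where "based_algebra n A \<phi>"
    and "\<And>i j l. \<lbrakk>i < n; j < n; l < n\<rbrakk> \<Longrightarrow> str_const n A \<phi> i j l = c i j l"
    and "\<And>i. i < n \<Longrightarrow> unit_const A \<phi> i = u i"
proof -
  have comm: "c i j l = c j i l" if "i < n" "j < n" "l < n" for i j l
  proof -
    have "c i j l - c j i l \<in> alg_relations n c u" unfolding alg_relations_def using that by blast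
    thus ?thesis using rel by auto
  qed
  have assoc: "(\<Sum>m<n. c i j m * c m k l) = (\<Sum>m<n. c j k m * c i m l)"
    if "i < n" "j < n" "k < n" "l < n" for i j k l
  proof -
    have "(\<Sum>m<n. c i j m * c m k l) - (\<Sum>m<n. c j k m * c i m l) \<in> alg_relations n c u"
      unfolding alg_relations_def using that by blast
    thus ?thesis using rel by auto
  qed
  have unit: "(\<Sum>i<n. u i * c i j l) = (if j = l then 1 else 0)" if "j < n" "l < n" for j l
  proof -
    have "(\<Sum>i<n. u i * c i j l) - (if j = l then 1 else 0) \<in> alg_relations n c u"
      unfolding alg_relations_def using that by blast
    hence "(\<Sum>i<n. u i * c i j l) - (if j = l then 1 else 0) = 0" using rel by blast
    thus ?thesis by (simp only: right_minus_eq)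
  qed
  define M where "M x y = vec n (\<lambda>l. \<Sum>i<n. \<Sum>j<n. x $ i * y $ j * c i j l)" for x y :: "'r vec"
  define A :: "('r, 'r vec) module" where
    "A = \<lparr>carrier = carrier_vec n, monoid.mult = M, one = vec n u, ring.zero = 0\<^sub>v n,
          add = (+), module.smult = (\<cdot>\<^sub>v)\<rparr>"
  have [simp]: "M x y \<in> carrier_vec n" "dim_vec (M x y) = n" for x y by (simp_all add: M_def)
  have Mi: "M x y $ l = (\<Sum>i<n. \<Sum>j<n. x $ i * y $ j * c i j l)" if "l < n" for x y l
    using that by (simp add: M_def)
  have Mcomm: "M x y = M y x" for x y
  proof (rule eq_vecI)
    fix l assume "l < dim_vec (M y x)"
    hence l: "l < n" by simp
    have "M x y $ l = (\<Sum>j<n. \<Sum>i<n. x $ i * y $ j * c i j l)"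
      unfolding Mi[OF l] by (rule sum.swap)
    also have "\<dots> = M y x $ l" unfolding Mi[OF l]
      by (intro sum.cong refl) (use l comm in \<open>auto simp: mult_ac\<close>)
    finally show "M x y $ l = M y x $ l" .
  qed simp
  have Massoc: "M (M x y) z = M x (M y z)" for x y z
  proof (rule eq_vecI)
    fix l assume "l < dim_vec (M x (M y z))"
    hence l: "l < n" by simp
    have "M (M x y) z $ l = (\<Sum>m<n. \<Sum>k<n. \<Sum>i<n. \<Sum>j<n. x$i * y$j * z$k * (c i j m * c m k l))"
      using l by (simp add: Mi sum_distrib_left sum_distrib_right mult_ac)
    also have "\<dots> = (\<Sum>k<n. \<Sum>m<n. \<Sum>i<n. \<Sum>j<n. x$i * y$j * z$k * (c i j m * c m k l))"
      by (rule sum.swap)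
    also have "\<dots> = (\<Sum>k<n. \<Sum>i<n. \<Sum>m<n. \<Sum>j<n. x$i * y$j * z$k * (c i j m * c m k l))"
      by (intro sum.cong refl sum.swap)
    also have "\<dots> = (\<Sum>k<n. \<Sum>i<n. \<Sum>j<n. \<Sum>m<n. x$i * y$j * z$k * (c i j m * c m k l))"
      by (intro sum.cong refl sum.swap)
    also have "\<dots> = (\<Sum>k<n. \<Sum>i<n. \<Sum>j<n. x$i * y$j * z$k * (\<Sum>m<n. c i j m * c m k l))"
      by (simp add: sum_distrib_left)
    also have "\<dots> = (\<Sum>k<n. \<Sum>i<n. \<Sum>j<n. x$i * y$j * z$k * (\<Sum>m<n. c j k m * c i m l))"
      by (intro sum.cong refl) (use l assoc in auto)
    also have "\<dots> = (\<Sum>i<n. \<Sum>k<n. \<Sum>j<n. x$i * y$j * z$k * (\<Sum>m<n. c j k m * c i m l))"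
      by (rule sum.swap)
    also have "\<dots> = (\<Sum>i<n. \<Sum>j<n. \<Sum>k<n. x$i * y$j * z$k * (\<Sum>m<n. c j k m * c i m l))"
      by (intro sum.cong refl sum.swap)
    also have "\<dots> = (\<Sum>i<n. \<Sum>j<n. \<Sum>k<n. \<Sum>m<n. x$i * y$j * z$k * (c j k m * c i m l))"
      by (simp add: sum_distrib_left)
    also have "\<dots> = (\<Sum>i<n. \<Sum>j<n. \<Sum>m<n. \<Sum>k<n. x$i * y$j * z$k * (c j k m * c i m l))"
      by (intro sum.cong refl sum.swap)
    also have "\<dots> = (\<Sum>i<n. \<Sum>m<n. \<Sum>j<n. \<Sum>k<n. x$i * y$j * z$k * (c j k m * c i m l))"
      by (intro sum.cong refl sum.swap)
    also have "\<dots> = M x (M y z) $ l"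
      using l by (simp add: Mi sum_distrib_left sum_distrib_right mult_ac)
    finally show "M (M x y) z $ l = M x (M y z) $ l" .
  qed simp
  have Mone: "M (vec n u) x = x" if x: "x \<in> carrier_vec n" for x
  proof (rule eq_vecI)
    fix l assume "l < dim_vec x"
    hence l: "l < n" using x by simp
    have "M (vec n u) x $ l = (\<Sum>i<n. \<Sum>j<n. x $ j * (u i * c i j l))"
      using l by (simp add: Mi mult_ac)
    also have "\<dots> = (\<Sum>j<n. \<Sum>i<n. x $ j * (u i * c i j l))" by (rule sum.swap)
    also have "\<dots> = (\<Sum>j<n. x $ j * (\<Sum>i<n. u i * c i j l))" by (simp add: sum_distrib_left)
    also have "\<dots> = (\<Sum>j<n. if j = l then x $ j else 0)"
      by (intro sum.cong refl) (use l unit in auto)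
    also have "\<dots> = x $ l" using l by simp
    finally show "M (vec n u) x $ l = x $ l" .
  qed (use x in simp)
  have Madd: "M (x + y) z = M x z + M y z"
    if "x \<in> carrier_vec n" "y \<in> carrier_vec n" for x y z
    by (rule eq_vecI)
      (use that in \<open>auto simp: Mi distrib_right sum.distrib[symmetric] intro!: sum.cong\<close>)
  have Msm: "M (r \<cdot>\<^sub>v x) y = r \<cdot>\<^sub>v M x y" if "x \<in> carrier_vec n" for r x y
    by (rule eq_vecI)
      (use that in \<open>auto simp: Mi sum_distrib_left mult.assoc intro!: sum.cong\<close>)
  have grp: "abelian_group A"
  proof (rule abelian_groupI)
    fix x assume "x \<in> carrier A"
    thus "\<exists>y\<in>carrier A. y \<oplus>\<^bsub>A\<^esub> x = \<zero>\<^bsub>A\<^esub>"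
      by (intro bexI[of _ "- x"]) (auto simp: A_def uminus_l_inv_vec)
  qed (auto simp: A_def comm_add_vec assoc_add_vec)
  have cr: "cring A"
  proof (rule cringI[OF grp])
    show "Group.comm_monoid A"
      by (rule comm_monoidI) (auto simp: A_def Massoc Mone intro: Mcomm)
  qed (auto simp: A_def Madd)
  have alg: "Module.algebra ring_of_type_algebra A"
  proof (rule algebraI)
    show "cring (ring_of_type_algebra :: 'r ring)" by (rule cring_from_type_algebra)
  qed (use cr in \<open>auto simp: A_def Msm add_smult_distrib_vec smult_add_distrib_vec smult_smult_assoc\<close>)
  have ba: "based_algebra n A id"
    by (intro based_algebra.intro alg based_algebra_axioms.intro) (auto simp: A_def)
  have be: "basis_elem n A id i = unit_vec n i" for i
    using based_algebra.phi_inv[OF ba, of "unit_vec n i"] by (simp add: basis_elem_def)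
  have sc: "str_const n A id i j l = c i j l" if "i < n" "j < n" "l < n" for i j l
  proof -
    have "str_const n A id i j l = M (unit_vec n i) (unit_vec n j) $ l"
      unfolding str_const_def be by (simp add: A_def)
    also have "\<dots> = (\<Sum>i'<n. \<Sum>j'<n. if i' = i then (if j' = j then c i' j' l else 0) else 0)"
      unfolding Mi[OF that(3)] by (intro sum.cong refl) (use that in auto)
    also have "\<dots> = (\<Sum>i'<n. if i' = i then (\<Sum>j'<n. if j' = j then c i' j' l else 0) else 0)"
      by (intro sum.cong refl) auto
    also have "\<dots> = c i j l" using that by simp
    finally show ?thesis .
  qed
  have "unit_const A id i = u i" if "i < n" for i
    using that by (simp add: unit_const_def A_def)
  thus ?thesis using that[OF ba] sc by blast
qed


section \<open>The rings \<open>B_ring n\<close> represent based algebras\<close>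

definition mon_eval :: "(coord \<Rightarrow> 'r::comm_ring_1) \<Rightarrow> (coord \<Rightarrow>\<^sub>0 nat) \<Rightarrow> 'r" where
  "mon_eval x m = (\<Prod>v\<in>Poly_Mapping.keys m. x v ^ Poly_Mapping.lookup m v)"

definition poly_eval ::
  "('k::comm_ring_1 \<Rightarrow> 'r::comm_ring_1) \<Rightarrow> (coord \<Rightarrow> 'r) \<Rightarrow> 'k coord_poly \<Rightarrow> 'r" where
  "poly_eval \<gamma> x p =
     (\<Sum>m\<in>Poly_Mapping.keys p. \<gamma> (Poly_Mapping.lookup p m) * mon_eval x m)"

lemma mon_eval_superset:
  assumes "finite S" "Poly_Mapping.keys m \<subseteq> S"
  shows "mon_eval x m = (\<Prod>v\<in>S. x v ^ Poly_Mapping.lookup m v)"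
  unfolding mon_eval_def
  by (rule prod.mono_neutral_left) (use assms in \<open>auto simp: in_keys_iff\<close>)

lemma mon_eval_add: "mon_eval x (m + m') = mon_eval x m * mon_eval x m'"
proof -
  let ?S = "Poly_Mapping.keys m \<union> Poly_Mapping.keys m'"
  have "Poly_Mapping.keys (m + m') \<subseteq> ?S" by (rule keys_add)
  thus ?thesis
    by (simp add: mon_eval_superset[of ?S] lookup_add power_add prod.distrib)
qed

lemma poly_expand:
  "p = (\<Sum>m\<in>Poly_Mapping.keys p. Poly_Mapping.single m (Poly_Mapping.lookup p m))"
proof (rule poly_mapping_eqI)
  fix k
  have "(\<Sum>m\<in>Poly_Mapping.keys p. Poly_Mapping.lookup (Poly_Mapping.single m (Poly_Mapping.lookup p m)) k)
      = (\<Sum>m\<in>Poly_Mapping.keys p. if m = k then Poly_Mapping.lookup p k else 0)"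
    by (intro sum.cong refl) (auto simp: lookup_single when_def)
  also have "\<dots> = Poly_Mapping.lookup p k" by (auto simp: in_keys_iff)
  finally show "Poly_Mapping.lookup p k = Poly_Mapping.lookup
     (\<Sum>m\<in>Poly_Mapping.keys p. Poly_Mapping.single m (Poly_Mapping.lookup p m)) k"
    by (simp add: lookup_sum)
qed

context
  fixes \<gamma> :: "'k::comm_ring_1 \<Rightarrow> 'r::comm_ring_1"
  assumes \<gamma>: "comm_ring_hom \<gamma>"
begin

interpretation \<gamma>: comm_ring_hom \<gamma> by (rule \<gamma>)

lemma poly_eval_superset:
  assumes "finite S" "Poly_Mapping.keys p \<subseteq> S"
  shows "poly_eval \<gamma> x p = (\<Sum>m\<in>S. \<gamma> (Poly_Mapping.lookup p m) * mon_eval x m)"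
  unfolding poly_eval_def
  by (rule sum.mono_neutral_left) (use assms in \<open>auto simp: in_keys_iff\<close>)

lemma poly_eval_add: "poly_eval \<gamma> x (p + q) = poly_eval \<gamma> x p + poly_eval \<gamma> x q"
proof -
  let ?S = "Poly_Mapping.keys p \<union> Poly_Mapping.keys q"
  have "Poly_Mapping.keys (p + q) \<subseteq> ?S" by (rule keys_add)
  thus ?thesis
    by (simp add: poly_eval_superset[of ?S] lookup_add \<gamma>.hom_add distrib_right sum.distrib)
qed

lemma poly_eval_single: "poly_eval \<gamma> x (Poly_Mapping.single m a) = \<gamma> a * mon_eval x m"
  by (subst poly_eval_superset[of "{m}"]) auto

lemma poly_eval_zero: "poly_eval \<gamma> x 0 = 0"
  by (simp add: poly_eval_def)

lemma poly_eval_sum: "poly_eval \<gamma> x (\<Sum>i\<in>S. f i) = (\<Sum>i\<in>S. poly_eval \<gamma> x (f i))"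
  by (induction S rule: infinite_finite_induct) (simp_all add: poly_eval_zero poly_eval_add)

lemma poly_eval_Const: "poly_eval \<gamma> x (Const a) = \<gamma> a"
  by (simp add: Const_def poly_eval_single mon_eval_def)

lemma poly_eval_Var: "poly_eval \<gamma> x (Var v) = x v"
  by (simp add: Var_def poly_eval_single mon_eval_def)

lemma poly_eval_mult: "poly_eval \<gamma> x (p * q) = poly_eval \<gamma> x p * poly_eval \<gamma> x q"
proof -
  let ?m = "\<lambda>p m. Poly_Mapping.single m (Poly_Mapping.lookup p m)"
  have "p * q = (\<Sum>m\<in>Poly_Mapping.keys p. ?m p m) * (\<Sum>m'\<in>Poly_Mapping.keys q. ?m q m')"
    by (simp only: poly_expand[symmetric])
  also have "\<dots> = (\<Sum>m\<in>Poly_Mapping.keys p. \<Sum>m'\<in>Poly_Mapping.keys q. ?m p m * ?m q m')"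
    by (rule sum_product)
  finally have "poly_eval \<gamma> x (p * q) =
      (\<Sum>m\<in>Poly_Mapping.keys p. \<Sum>m'\<in>Poly_Mapping.keys q.
         (\<gamma> (Poly_Mapping.lookup p m) * mon_eval x m) * (\<gamma> (Poly_Mapping.lookup q m') * mon_eval x m'))"
    by (simp only: poly_eval_sum mult_single poly_eval_single \<gamma>.hom_mult mon_eval_add mult_ac)
  also have "\<dots> = poly_eval \<gamma> x p * poly_eval \<gamma> x q"
    unfolding poly_eval_def by (rule sum_product[symmetric])
  finally show ?thesis .
qed

lemma poly_eval_hom: "comm_ring_hom (poly_eval \<gamma> x)"
proof
  show "poly_eval \<gamma> x 1 = 1" using poly_eval_Const[of x 1] by (simp add: Const_def)
qed (simp_all add: poly_eval_add poly_eval_mult poly_eval_zero)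

end

lemma alg_relations_comm:
  "\<lbrakk>i < n; j < n; l < n\<rbrakk> \<Longrightarrow> c i j l - c j i l \<in> alg_relations n c u"
  unfolding alg_relations_def by blast

lemma alg_relations_assoc:
  "\<lbrakk>i < n; j < n; k < n; l < n\<rbrakk> \<Longrightarrow>
     (\<Sum>m<n. c i j m * c m k l) - (\<Sum>m<n. c j k m * c i m l) \<in> alg_relations n c u"
  unfolding alg_relations_def by blast

lemma alg_relations_unit:
  "\<lbrakk>j < n; l < n\<rbrakk> \<Longrightarrow>
     (\<Sum>i<n. u i * c i j l) - (if j = l then 1 else 0) \<in> alg_relations n c u"
  unfolding alg_relations_def by blast

lemma alg_relations_cases [consumes 1, case_names comm assoc unit]:
  assumes "p \<in> alg_relations n c u"
  obtains (comm) i j l where "i < n" "j < n" "l < n" "p = c i j l - c j i l"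
    | (assoc) i j k l where "i < n" "j < n" "k < n" "l < n"
        "p = (\<Sum>m<n. c i j m * c m k l) - (\<Sum>m<n. c j k m * c i m l)"
    | (unit) j l where "j < n" "l < n" "p = (\<Sum>i<n. u i * c i j l) - (if j = l then 1 else 0)"
  using assms unfolding alg_relations_def by blast

lemma alg_relations_hom:
  assumes "comm_ring_hom f" "p \<in> alg_relations n c u"
  shows "f p \<in> alg_relations n (\<lambda>i j l. f (c i j l)) (\<lambda>i. f (u i))"
proof -
  interpret f: comm_ring_hom f by fact
  let ?c = "\<lambda>i j l. f (c i j l)" and ?u = "\<lambda>i. f (u i)"
  from assms(2) show ?thesis
  proof (cases rule: alg_relations_cases)
    case (comm i j l)
    have "f p = ?c i j l - ?c j i l" unfolding comm(4) by (simp add: f.hom_minus)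
    thus ?thesis using alg_relations_comm[OF comm(1-3), of ?c ?u] by simp
  next
    case (assoc i j k l)
    have "f p = (\<Sum>m<n. ?c i j m * ?c m k l) - (\<Sum>m<n. ?c j k m * ?c i m l)"
      unfolding assoc(5) by (simp add: f.hom_minus f.hom_sum f.hom_mult)
    thus ?thesis using alg_relations_assoc[OF assoc(1-4), of ?c ?u] by simp
  next
    case (unit j l)
    have "f p = (\<Sum>i<n. ?u i * ?c i j l) - (if j = l then 1 else 0)"
      unfolding unit(3) by (simp add: f.hom_minus f.hom_sum f.hom_mult)
    thus ?thesis using alg_relations_unit[OF unit(1-2), of ?u ?c] by simp
  qed
qed

lemma alg_relations_cong:
  assumes c: "\<And>i j l. \<lbrakk>i < n; j < n; l < n\<rbrakk> \<Longrightarrow> c i j l = c' i j l"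
    and u: "\<And>i. i < n \<Longrightarrow> u i = u' i"
  shows "alg_relations n c u \<subseteq> alg_relations n c' u'"
proof
  fix p assume "p \<in> alg_relations n c u"
  thus "p \<in> alg_relations n c' u'"
  proof (cases rule: alg_relations_cases)
    case (comm i j l)
    have "p = c' i j l - c' j i l" unfolding comm(4) using comm(1-3) by (simp add: c)
    thus ?thesis using alg_relations_comm[OF comm(1-3), of c' u'] by simp
  next
    case (assoc i j k l)
    have "p = (\<Sum>m<n. c' i j m * c' m k l) - (\<Sum>m<n. c' j k m * c' i m l)"
      unfolding assoc(5) using assoc(1-4) by (simp add: c)
    thus ?thesis using alg_relations_assoc[OF assoc(1-4), of c' u'] by simp
  next
    case (unit j l)
    have "p = (\<Sum>i<n. u' i * c' i j l) - (if j = l then 1 else 0)"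
      unfolding unit(3) using unit(1-2) by (simp add: c u)
    thus ?thesis using alg_relations_unit[OF unit(1-2), of u' c'] by simp
  qed
qed

lemma alg_relations_unit_unique:
  assumes u: "alg_relations n c u \<subseteq> {0}" and u': "alg_relations n c u' \<subseteq> {0}" and l: "l < n"
  shows "u l = u' l"
proof -
  have comm: "c i j l = c j i l" if "i < n" "j < n" "l < n" for i j l
  proof -
    have "c i j l - c j i l \<in> alg_relations n c u" unfolding alg_relations_def using that by blast
    thus ?thesis using u by auto
  qed
  have unit: "(\<Sum>i<n. w i * c i j l) = (if j = l then 1 else 0)"
    if w: "alg_relations n c w \<subseteq> {0}" and "j < n" for w j
  proof -
    have "(\<Sum>i<n. w i * c i j l) - (if j = l then 1 else 0) \<in> alg_relations n c w"
      unfolding alg_relations_def using that l by blast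
    hence "(\<Sum>i<n. w i * c i j l) - (if j = l then 1 else 0) = 0" using w by blast
    thus ?thesis by (simp only: right_minus_eq)
  qed
  have prod: "w l = (\<Sum>j<n. \<Sum>i<n. w j * (w' i * c i j l))"
    if "alg_relations n c w' \<subseteq> {0}" for w w'
  proof -
    have "w l = (\<Sum>j<n. if j = l then w j else 0)" using l by simp
    also have "\<dots> = (\<Sum>j<n. w j * (\<Sum>i<n. w' i * c i j l))"
      by (intro sum.cong refl) (use unit[OF that] in auto)
    finally show ?thesis by (simp add: sum_distrib_left)
  qed
  have "u l = (\<Sum>j<n. \<Sum>i<n. u j * (u' i * c i j l))" by (rule prod[OF u'])
  also have "\<dots> = (\<Sum>i<n. \<Sum>j<n. u j * (u' i * c i j l))" by (rule sum.swap)
  also have "\<dots> = (\<Sum>i<n. \<Sum>j<n. u' i * (u j * c j i l))"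
    by (intro sum.cong refl) (use l comm in \<open>auto simp: mult_ac\<close>)
  also have "\<dots> = u' l" by (rule prod[OF u, symmetric])
  finally show ?thesis .
qed

lemma disc_hom:
  assumes "comm_ring_hom f"
  shows "f (disc n c) = disc n (\<lambda>i j l. f (c i j l))"
proof -
  interpret f: comm_ring_hom f by fact
  have "map_mat f (mat n n (\<lambda>(i, j). \<Sum>l<n. c i j l * (\<Sum>m<n. c l m m)))
      = mat n n (\<lambda>(i, j). \<Sum>l<n. f (c i j l) * (\<Sum>m<n. f (c l m m)))"
    by (rule eq_matI) (auto simp: f.hom_sum f.hom_mult)
  thus ?thesis unfolding disc_def by (simp flip: f.hom_det)
qed

lemma disc_cong:
  assumes "\<And>i j l. \<lbrakk>i < n; j < n; l < n\<rbrakk> \<Longrightarrow> c i j l = c' i j l"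
  shows "disc n c = disc n c'"
  unfolding disc_def by (intro arg_cong[of _ _ det] eq_matI) (auto simp: assms)

lemma poly_ring_simps [simp]:
  "x \<otimes>\<^bsub>poly_ring V\<^esub> y = x * y"
  "x \<oplus>\<^bsub>poly_ring V\<^esub> y = x + y"
  "\<one>\<^bsub>poly_ring V\<^esub> = 1"
  "\<zero>\<^bsub>poly_ring V\<^esub> = 0"
  by (simp_all add: poly_ring_def ring_of_type_algebra_def)

lemma carrier_poly_ring:
  "p \<in> carrier (poly_ring V) \<longleftrightarrow> (\<forall>m \<in> Poly_Mapping.keys p. Poly_Mapping.keys m \<subseteq> V)"
  by (simp add: poly_ring_def)

lemma poly_ring_closed:
  shows poly_ring_0: "0 \<in> carrier (poly_ring V)"
    and poly_ring_1: "1 \<in> carrier (poly_ring V)"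
    and poly_ring_Const: "Const a \<in> carrier (poly_ring V)"
    and poly_ring_Var: "v \<in> V \<Longrightarrow> Var v \<in> carrier (poly_ring V)"
  by (auto simp: carrier_poly_ring Const_def Var_def)

lemma poly_ring_add:
  "\<lbrakk>p \<in> carrier (poly_ring V); q \<in> carrier (poly_ring V)\<rbrakk> \<Longrightarrow> p + q \<in> carrier (poly_ring V)"
  unfolding carrier_poly_ring using keys_add[of p q] by blast

lemma poly_ring_mult:
  assumes "p \<in> carrier (poly_ring V)" "q \<in> carrier (poly_ring V)"
  shows "p * q \<in> carrier (poly_ring V)"
  unfolding carrier_poly_ring
proof
  fix m assume "m \<in> Poly_Mapping.keys (p * q)"
  then obtain a b where ab: "m = a + b" "a \<in> Poly_Mapping.keys p" "b \<in> Poly_Mapping.keys q"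
    using keys_mult[of p q] by blast
  thus "Poly_Mapping.keys m \<subseteq> V"
    using assms keys_add[of a b] unfolding carrier_poly_ring by blast
qed

lemma poly_ring_uminus: "p \<in> carrier (poly_ring V) \<Longrightarrow> - p \<in> carrier (poly_ring V)"
  unfolding carrier_poly_ring by (simp add: in_keys_iff)

lemma poly_ring_minus:
  "\<lbrakk>p \<in> carrier (poly_ring V); q \<in> carrier (poly_ring V)\<rbrakk> \<Longrightarrow> p - q \<in> carrier (poly_ring V)"
  using poly_ring_add[of p V "- q"] poly_ring_uminus[of q V] by simp

lemma poly_ring_sum:
  "(\<And>i. i \<in> S \<Longrightarrow> f i \<in> carrier (poly_ring V)) \<Longrightarrow> sum f S \<in> carrier (poly_ring V)"
  by (induction S rule: infinite_finite_induct) (auto intro: poly_ring_0 poly_ring_add)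

lemma cring_poly_ring: "cring (poly_ring V)"
proof (rule cringI)
  show "abelian_group (poly_ring V)"
  proof (rule abelian_groupI)
    fix x assume "x \<in> carrier (poly_ring V)"
    thus "\<exists>y\<in>carrier (poly_ring V). y \<oplus>\<^bsub>poly_ring V\<^esub> x = \<zero>\<^bsub>poly_ring V\<^esub>"
      by (intro bexI[of _ "- x"]) (auto intro: poly_ring_uminus)
  qed (auto intro: poly_ring_0 poly_ring_add simp: add_ac)
  show "Group.comm_monoid (poly_ring V)"
    by (rule comm_monoidI) (auto intro: poly_ring_1 poly_ring_mult simp: mult_ac)
qed (auto simp: distrib_right)

lemma rel_subset:
  "alg_relations n (\<lambda>i j l. Var (SC i j l)) (\<lambda>i. Var (UC i)) \<subseteq> carrier (poly_ring (coords n))"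
  (is "alg_relations n ?c ?u \<subseteq> _")
proof -
  have c: "?c i j l \<in> carrier (poly_ring (coords n))" if "i < n" "j < n" "l < n" for i j l
    using that by (intro poly_ring_Var) (auto simp: coords_def)
  have u: "?u i \<in> carrier (poly_ring (coords n))" if "i < n" for i
    using that by (intro poly_ring_Var) (auto simp: coords_def)
  show ?thesis unfolding alg_relations_def
    by (auto intro!: poly_ring_minus poly_ring_sum poly_ring_mult c u poly_ring_0 poly_ring_1)
qed

lemma ideal_rel_ideal: "ideal (rel_ideal n) (poly_ring (coords n))"
  unfolding rel_ideal_def
  by (rule ring.genideal_ideal[OF cring.axioms(1)[OF cring_poly_ring] rel_subset])

lemma rel_in_rel_ideal:
  "alg_relations n (\<lambda>i j l. Var (SC i j l)) (\<lambda>i. Var (UC i)) \<subseteq> rel_ideal n"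
  unfolding rel_ideal_def
  by (rule ring.genideal_self[OF cring.axioms(1)[OF cring_poly_ring] rel_subset])

lemma cring_B_ring: "cring (B_ring n)"
  unfolding B_ring_def by (rule ideal.quotient_is_cring[OF ideal_rel_ideal cring_poly_ring])

lemma B_class_hom: "B_class n \<in> Ring.ring_hom (poly_ring (coords n)) (B_ring n)"
  using ideal.rcos_ring_hom[OF ideal_rel_ideal[of n]]
  unfolding B_ring_def B_class_def[abs_def] .

lemma B_class_surj:
  assumes "x \<in> carrier (B_ring n)"
  obtains p where "p \<in> carrier (poly_ring (coords n))" "x = B_class n p"
  using assms unfolding B_ring_def B_class_def FactRing_def A_RCOSETS_def'
  by auto

lemma B_class_closed: "p \<in> carrier (poly_ring (coords n)) \<Longrightarrow> B_class n p \<in> carrier (B_ring n)"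
  using B_class_hom by (rule Ring.ring_hom_closed)

lemma B_class_eqD:
  assumes "B_class n p = B_class n q" "p \<in> carrier (poly_ring (coords n))"
  shows "\<exists>i\<in>rel_ideal n. p = i + q"
proof -
  interpret ideal "rel_ideal n" "poly_ring (coords n)" by (rule ideal_rel_ideal)
  have "p \<in> B_class n p" unfolding B_class_def by (rule a_rcos_self[OF assms(2)])
  hence "p \<in> B_class n q" by (simp only: assms(1))
  thus ?thesis unfolding B_class_def a_r_coset_def' by auto
qed

lemma B_class_rel:
  assumes "p \<in> rel_ideal n"
  shows "B_class n p = \<zero>\<^bsub>B_ring n\<^esub>"
proof -
  interpret ideal "rel_ideal n" "poly_ring (coords n)" by (rule ideal_rel_ideal)
  show ?thesis unfolding B_class_def B_ring_def FactRing_def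
    using a_rcos_const[OF assms] by simp
qed

text \<open>The \<open>'k\<close>-algebra homomorphisms from \<^term>\<open>B_ring n\<close> to the \<open>'k\<close>-algebra \<open>\<gamma> : 'k \<rightarrow> 'r\<close>.\<close>

definition B_hom ::
  "nat \<Rightarrow> ('k::comm_ring_1 \<Rightarrow> 'r::comm_ring_1) \<Rightarrow> ('k coord_poly set \<Rightarrow> 'r) set" where
  "B_hom n \<gamma> = {h \<in> Ring.ring_hom (B_ring n) ring_of_type_algebra \<inter> extensional (carrier (B_ring n)).
     \<forall>a. h (B_class n (Const a)) = \<gamma> a}"

definition classifies ::
  "nat \<Rightarrow> ('k::comm_ring_1 coord_poly set \<Rightarrow> 'r::comm_ring_1) \<Rightarrow>
     ('r, 'a) module \<Rightarrow> ('a \<Rightarrow> 'r vec) \<Rightarrow> bool" where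
  "classifies n h A \<phi> \<longleftrightarrow> (\<forall>i<n. \<forall>j<n. \<forall>l<n.
     h (B_class n (Var (SC i j l))) = str_const n A \<phi> i j l)"

lemma hom_eq_poly_eval:
  fixes g :: "'k::comm_ring_1 coord_poly \<Rightarrow> 'r::comm_ring_1"
  assumes \<gamma>: "comm_ring_hom \<gamma>"
    and g: "g \<in> Ring.ring_hom (poly_ring V) ring_of_type_algebra"
    and gC: "\<And>a. g (Const a) = \<gamma> a"
    and p: "p \<in> carrier (poly_ring V)"
  shows "g p = poly_eval \<gamma> (\<lambda>v. g (Var v)) p"
proof -
  have add: "g (x + y) = g x + g y" if "x \<in> carrier (poly_ring V)" "y \<in> carrier (poly_ring V)" for x y
    using Ring.ring_hom_add[OF g that] by simp
  have mult: "g (x * y) = g x * g y" if "x \<in> carrier (poly_ring V)" "y \<in> carrier (poly_ring V)" for x y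
    using Ring.ring_hom_mult[OF g that] by simp
  have one: "g 1 = 1" using Ring.ring_hom_one[OF g] by simp
  have zero: "g 0 = 0" using add[OF poly_ring_0 poly_ring_0] by simp
  have pow: "(Var v :: 'k coord_poly) ^ k \<in> carrier (poly_ring V) \<and> g (Var v ^ k) = g (Var v) ^ k" if "v \<in> V" for v k
    by (induction k) (auto simp: one mult poly_ring_1 poly_ring_mult poly_ring_Var that)
  have Varpow: "(Var v :: 'k coord_poly) ^ k = Poly_Mapping.single (Poly_Mapping.single v k) 1" for v k
    by (induction k) (auto simp: Var_def mult_single simp flip: single_add)
  have prod: "(\<Prod>v\<in>S. Var v ^ f v :: 'k coord_poly) \<in> carrier (poly_ring V) \<and>
      g (\<Prod>v\<in>S. Var v ^ f v) = (\<Prod>v\<in>S. g (Var v) ^ f v)" if "S \<subseteq> V" for S f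
    using that by (induction S rule: infinite_finite_induct)
      (auto simp: one mult pow poly_ring_1 poly_ring_mult)
  have prod_single: "(\<Prod>v\<in>S. Var v ^ f v) =
      Poly_Mapping.single (\<Sum>v\<in>S. Poly_Mapping.single v (f v)) (1::'k)" for S f
    by (induction S rule: infinite_finite_induct) (auto simp: Varpow mult_single)
  have m_exp: "m = (\<Sum>v\<in>Poly_Mapping.keys m. Poly_Mapping.single v (Poly_Mapping.lookup m v))"
    for m :: "coord \<Rightarrow>\<^sub>0 nat"
  proof (rule poly_mapping_eqI)
    fix k
    have "(\<Sum>v\<in>Poly_Mapping.keys m. Poly_Mapping.lookup (Poly_Mapping.single v (Poly_Mapping.lookup m v)) k)
        = (\<Sum>v\<in>Poly_Mapping.keys m. if v = k then Poly_Mapping.lookup m k else 0)"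
      by (intro sum.cong refl) (auto simp: lookup_single when_def)
    also have "\<dots> = Poly_Mapping.lookup m k" by (auto simp: in_keys_iff)
    finally show "Poly_Mapping.lookup m k = Poly_Mapping.lookup
        (\<Sum>v\<in>Poly_Mapping.keys m. Poly_Mapping.single v (Poly_Mapping.lookup m v)) k"
      by (simp add: lookup_sum)
  qed
  have single: "(Poly_Mapping.single m a :: 'k coord_poly) \<in> carrier (poly_ring V) \<and>
      g (Poly_Mapping.single m a) = \<gamma> a * mon_eval (\<lambda>v. g (Var v)) m"
    if m: "Poly_Mapping.keys m \<subseteq> V" for m a
  proof -
    let ?q = "\<Prod>v\<in>Poly_Mapping.keys m. Var v ^ Poly_Mapping.lookup m v :: 'k coord_poly"
    have "Poly_Mapping.single m a = Const a * ?q"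
      unfolding prod_single m_exp[symmetric] by (simp add: Const_def mult_single)
    thus ?thesis
      using prod[OF m, of "Poly_Mapping.lookup m"]
      by (simp add: mult poly_ring_Const poly_ring_mult gC mon_eval_def)
  qed
  have sum: "g (sum f S) = (\<Sum>i\<in>S. g (f i))"
    if "\<And>i. i \<in> S \<Longrightarrow> f i \<in> carrier (poly_ring V)" for f and S :: "(coord \<Rightarrow>\<^sub>0 nat) set"
    using that by (induction S rule: infinite_finite_induct) (auto simp: zero add poly_ring_sum)
  have keys: "Poly_Mapping.keys m \<subseteq> V" if "m \<in> Poly_Mapping.keys p" for m
    using p that by (simp add: carrier_poly_ring)
  have "g p = g (\<Sum>m\<in>Poly_Mapping.keys p. Poly_Mapping.single m (Poly_Mapping.lookup p m))"
    by (subst poly_expand[of p]) (rule refl)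
  also have "\<dots> = (\<Sum>m\<in>Poly_Mapping.keys p. g (Poly_Mapping.single m (Poly_Mapping.lookup p m)))"
    by (rule sum) (simp add: single keys)
  also have "\<dots> = poly_eval \<gamma> (\<lambda>v. g (Var v)) p"
    unfolding poly_eval_def by (intro sum.cong refl) (simp add: single keys)
  finally show ?thesis .
qed

lemma poly_eval_cong:
  assumes "p \<in> carrier (poly_ring V)" "\<And>v. v \<in> V \<Longrightarrow> x v = y v"
  shows "poly_eval \<gamma> x p = poly_eval \<gamma> y p"
  unfolding poly_eval_def mon_eval_def
  using assms by (intro sum.cong prod.cong arg_cong2[of _ _ _ _ "(*)"] refl)
    (auto simp: carrier_poly_ring subset_iff)

lemma B_hom_eq:
  assumes \<gamma>: "comm_ring_hom \<gamma>" and h: "h \<in> B_hom n \<gamma>" and p: "p \<in> carrier (poly_ring (coords n))"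
  shows "h (B_class n p) = poly_eval \<gamma> (\<lambda>v. h (B_class n (Var v))) p"
proof -
  have "h \<circ> B_class n \<in> Ring.ring_hom (poly_ring (coords n)) ring_of_type_algebra"
    using ring_hom_trans[OF B_class_hom] h by (auto simp: B_hom_def)
  from hom_eq_poly_eval[OF \<gamma> this _ p] h show ?thesis by (simp add: B_hom_def)
qed

lemma B_hom_relations:
  fixes \<gamma> :: "'k::comm_ring_1 \<Rightarrow> 'r::comm_ring_1"
  assumes \<gamma>: "comm_ring_hom \<gamma>" and h: "h \<in> B_hom n \<gamma>"
  shows "alg_relations n (\<lambda>i j l. h (B_class n (Var (SC i j l)))) (\<lambda>i. h (B_class n (Var (UC i)))) \<subseteq> {0}"
proof
  let ?x = "\<lambda>v. h (B_class n (Var v))"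
  let ?c = "\<lambda>i j l. Var (SC i j l) :: 'k coord_poly" and ?u = "\<lambda>i. Var (UC i) :: 'k coord_poly"
  interpret e: comm_ring_hom "poly_eval \<gamma> ?x" by (rule poly_eval_hom[OF \<gamma>])
  have zero: "h \<zero>\<^bsub>B_ring n\<^esub> = 0"
  proof -
    interpret cring "B_ring n :: 'k coord_poly set ring" by (rule cring_B_ring)
    have "h \<in> Ring.ring_hom (B_ring n) ring_of_type_algebra" using h by (simp add: B_hom_def)
    from Ring.ring_hom_add[OF this zero_closed zero_closed] show ?thesis by simp
  qed
  have rel0: "poly_eval \<gamma> ?x p = 0" if p: "p \<in> alg_relations n ?c ?u" for p
  proof -
    have "poly_eval \<gamma> ?x p = h (B_class n p)"
      by (rule B_hom_eq[OF \<gamma> h, symmetric]) (use p rel_subset in blast)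
    also have "B_class n p = \<zero>\<^bsub>B_ring n\<^esub>"
      by (rule B_class_rel) (use p rel_in_rel_ideal in blast)
    finally show ?thesis by (simp add: zero)
  qed
  fix q assume "q \<in> alg_relations n (\<lambda>i j l. ?x (SC i j l)) (\<lambda>i. ?x (UC i))"
  thus "q \<in> {0}"
  proof (cases rule: alg_relations_cases)
    case (comm i j l)
    have "poly_eval \<gamma> ?x (?c i j l - ?c j i l) = 0"
      by (rule rel0, rule alg_relations_comm[OF comm(1-3), of ?c ?u])
    thus ?thesis unfolding comm(4) by (simp add: e.hom_minus poly_eval_Var[OF \<gamma>])
  next
    case (assoc i j k l)
    have "poly_eval \<gamma> ?x ((\<Sum>m<n. ?c i j m * ?c m k l) - (\<Sum>m<n. ?c j k m * ?c i m l)) = 0"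
      by (rule rel0, rule alg_relations_assoc[OF assoc(1-4), of ?c ?u])
    thus ?thesis unfolding assoc(5)
      by (simp add: e.hom_minus e.hom_sum e.hom_mult poly_eval_Var[OF \<gamma>])
  next
    case (unit j l)
    have "poly_eval \<gamma> ?x ((\<Sum>i<n. ?u i * ?c i j l) - (if j = l then 1 else 0)) = 0"
      by (rule rel0, rule alg_relations_unit[OF unit(1-2), of ?u ?c])
    thus ?thesis unfolding unit(3)
      by (simp add: e.hom_minus e.hom_sum e.hom_mult poly_eval_Var[OF \<gamma>] split: if_splits)
  qed
qed

lemma B_hom_exists:
  fixes \<gamma> :: "'k::comm_ring_1 \<Rightarrow> 'r::comm_ring_1"
  assumes \<gamma>: "comm_ring_hom \<gamma>" and rel: "alg_relations n c u \<subseteq> {0}"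
  obtains h where "h \<in> B_hom n \<gamma>"
    and "\<And>i j l. \<lbrakk>i < n; j < n; l < n\<rbrakk> \<Longrightarrow> h (B_class n (Var (SC i j l))) = c i j l"
    and "\<And>i. i < n \<Longrightarrow> h (B_class n (Var (UC i))) = u i"
proof -
  let ?P = "poly_ring (coords n) :: 'k coord_poly ring"
  define x where "x v = (case v of SC i j l \<Rightarrow> c i j l | UC i \<Rightarrow> u i)" for v
  let ?e = "poly_eval \<gamma> x"
  interpret e: comm_ring_hom ?e by (rule poly_eval_hom[OF \<gamma>])
  let ?K = "{p \<in> carrier ?P. ?e p = 0}"
  have "ideal ?K ?P"
  proof (rule idealI)
    show "ring ?P" by (rule cring.axioms(1)[OF cring_poly_ring])
    then interpret ring ?P .
    have inv: "inv\<^bsub>add_monoid ?P\<^esub> p = - p" if "p \<in> carrier ?P" for p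
      using that minus_equality[of "- p" p] poly_ring_uminus[OF that] by (simp add: a_inv_def)
    show "Group.subgroup ?K (add_monoid ?P)"
    proof (rule group.subgroupI[OF a_group])
      show "?K \<noteq> {}" using poly_ring_0 by auto
      fix p q assume p: "p \<in> ?K" and q: "q \<in> ?K"
      have "- p \<in> ?K" using p by (simp add: e.hom_uminus poly_ring_uminus)
      moreover have "inv\<^bsub>add_monoid ?P\<^esub> p = - p" by (rule inv) (use p in simp)
      ultimately show "inv\<^bsub>add_monoid ?P\<^esub> p \<in> ?K" by (simp only:)
      show "p \<otimes>\<^bsub>add_monoid ?P\<^esub> q \<in> ?K"
        using p q by (simp add: e.hom_add poly_ring_add)
    qed auto
  qed (auto simp: e.hom_mult intro: poly_ring_mult)
  moreover have "alg_relations n (\<lambda>i j l. Var (SC i j l)) (\<lambda>i. Var (UC i)) \<subseteq> ?K"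
  proof
    fix p :: "'k coord_poly"
    assume p: "p \<in> alg_relations n (\<lambda>i j l. Var (SC i j l)) (\<lambda>i. Var (UC i))"
    from alg_relations_hom[OF e.comm_ring_hom_axioms this] have "?e p \<in> alg_relations n c u"
      by (simp add: poly_eval_Var[OF \<gamma>] x_def)
    thus "p \<in> ?K" using rel rel_subset p by blast
  qed
  ultimately have K: "rel_ideal n \<subseteq> ?K"
    unfolding rel_ideal_def
    by (rule ring.genideal_minimal[OF cring.axioms(1)[OF cring_poly_ring]])
  define h where "h = restrict
    (\<lambda>C. ?e (SOME p. p \<in> carrier ?P \<and> B_class n p = C)) (carrier (B_ring n))"
  have h: "h (B_class n p) = ?e p" if p: "p \<in> carrier ?P" for p
  proof -
    let ?q = "SOME q. q \<in> carrier ?P \<and> B_class n q = B_class n p"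
    have "?q \<in> carrier ?P \<and> B_class n ?q = B_class n p" by (rule someI[of _ p]) (simp add: p)
    then obtain i where "i \<in> rel_ideal n" "?q = i + p" using B_class_eqD by blast
    hence "?e ?q = ?e p" using K by (auto simp: e.hom_add)
    thus ?thesis using B_class_closed[OF p] by (simp add: h_def)
  qed
  have hh: "h \<in> Ring.ring_hom (B_ring n) ring_of_type_algebra"
  proof (rule Ring.ring_hom_memI)
    fix y z :: "'k coord_poly set"
    assume y: "y \<in> carrier (B_ring n)" and z: "z \<in> carrier (B_ring n)"
    obtain p where p: "p \<in> carrier ?P" "y = B_class n p" using y by (rule B_class_surj)
    obtain q where q: "q \<in> carrier ?P" "z = B_class n q" using z by (rule B_class_surj)
    have "h (y \<otimes>\<^bsub>B_ring n\<^esub> z) = h (B_class n (p * q))"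
      using Ring.ring_hom_mult[OF B_class_hom p(1) q(1)] by (simp add: p(2) q(2))
    also have "\<dots> = h y * h z"
      by (simp add: h[OF poly_ring_mult[OF p(1) q(1)]] e.hom_mult p(2) q(2) h[OF p(1)] h[OF q(1)])
    finally show "h (y \<otimes>\<^bsub>B_ring n\<^esub> z) = h y \<otimes>\<^bsub>ring_of_type_algebra\<^esub> h z" by simp
    have "h (y \<oplus>\<^bsub>B_ring n\<^esub> z) = h (B_class n (p + q))"
      using Ring.ring_hom_add[OF B_class_hom p(1) q(1)] by (simp add: p(2) q(2))
    also have "\<dots> = h y + h z"
      by (simp add: h[OF poly_ring_add[OF p(1) q(1)]] e.hom_add p(2) q(2) h[OF p(1)] h[OF q(1)])
    finally show "h (y \<oplus>\<^bsub>B_ring n\<^esub> z) = h y \<oplus>\<^bsub>ring_of_type_algebra\<^esub> h z" by simp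
  next
    have "h (B_class n (1 :: 'k coord_poly)) = 1" by (simp add: h poly_ring_1)
    moreover have "B_class n (1 :: 'k coord_poly) = \<one>\<^bsub>B_ring n\<^esub>"
      by (rule Ring.ring_hom_one[OF B_class_hom, simplified])
    ultimately show "h \<one>\<^bsub>B_ring n\<^esub> = \<one>\<^bsub>ring_of_type_algebra\<^esub>" by simp
  qed simp
  have "h \<in> B_hom n \<gamma>"
    unfolding B_hom_def using hh
    by (auto simp: h poly_ring_Const poly_eval_Const[OF \<gamma>]) (simp add: h_def)
  moreover have "h (B_class n (Var v)) = x v" if "v \<in> coords n" for v
    using that by (simp add: h poly_ring_Var poly_eval_Var[OF \<gamma>])
  ultimately show ?thesis
    by (intro that[of h]) (auto simp: coords_def x_def)
qed

lemma B_hom_unique: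
  fixes \<gamma> :: "'k::comm_ring_1 \<Rightarrow> 'r::comm_ring_1"
  assumes \<gamma>: "comm_ring_hom \<gamma>" and h: "h \<in> B_hom n \<gamma>" and h': "h' \<in> B_hom n \<gamma>"
    and eq: "\<And>i j l. \<lbrakk>i < n; j < n; l < n\<rbrakk> \<Longrightarrow>
      h (B_class n (Var (SC i j l))) = h' (B_class n (Var (SC i j l)))"
  shows "h = h'"
proof -
  let ?c = "\<lambda>i j l. h (B_class n (Var (SC i j l)))"
  have "alg_relations n ?c (\<lambda>i. h' (B_class n (Var (UC i)))) \<subseteq>
      alg_relations n (\<lambda>i j l. h' (B_class n (Var (SC i j l)))) (\<lambda>i. h' (B_class n (Var (UC i))))"
    by (rule alg_relations_cong) (simp_all add: eq)
  hence r': "alg_relations n ?c (\<lambda>i. h' (B_class n (Var (UC i)))) \<subseteq> {0}"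
    using B_hom_relations[OF \<gamma> h'] by (rule order_trans)
  have "h (B_class n (Var (UC i))) = h' (B_class n (Var (UC i)))" if "i < n" for i
    by (rule alg_relations_unit_unique[OF B_hom_relations[OF \<gamma> h] r' that])
  hence v: "h (B_class n (Var v)) = h' (B_class n (Var v))" if "v \<in> coords n" for v
    using that eq by (auto simp: coords_def)
  show ?thesis
  proof (rule extensionalityI)
    show "h \<in> extensional (carrier (B_ring n))" "h' \<in> extensional (carrier (B_ring n))"
      using h h' by (auto simp: B_hom_def)
    fix y :: "'k coord_poly set"
    assume "y \<in> carrier (B_ring n)"
    then obtain p where p: "p \<in> carrier (poly_ring (coords n))" "y = B_class n p"
      by (rule B_class_surj)
    show "h y = h' y"
      unfolding p(2) B_hom_eq[OF \<gamma> h p(1)] B_hom_eq[OF \<gamma> h' p(1)]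
      by (rule poly_eval_cong[OF p(1)]) (rule v)
  qed
qed

text \<open>
  Together with \<open>based_iso_iff\<close>: the \<open>'k\<close>-algebra homomorphisms \<open>B_ring n \<rightarrow> 'r\<close> correspond
  to the isomorphism classes of based algebras over \<open>'r\<close>, and the image of \<^term>\<open>B_Delta n\<close>
  is the discriminant. The class \<^class>\<open>comm_ring_1\<close> excludes the zero ring, over which both
  sides have exactly one element.
\<close>

theorem represents:
  fixes \<gamma> :: "'k::comm_ring_1 \<Rightarrow> 'r::comm_ring_1"
  assumes \<gamma>: "comm_ring_hom \<gamma>"
  shows "based_algebra n A \<phi> \<Longrightarrow> \<exists>!h. h \<in> B_hom n \<gamma> \<and> classifies n h A \<phi>"
    and "h \<in> B_hom n \<gamma> \<Longrightarrow>
      \<exists>(A' :: ('r, 'r vec) module) \<phi>'. based_algebra n A' \<phi>' \<and> classifies n h A' \<phi>'"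
    and "\<lbrakk>based_algebra n A \<phi>; h \<in> B_hom n \<gamma>; classifies n h A \<phi>\<rbrakk> \<Longrightarrow>
      h (B_Delta n) = alg_disc n A \<phi>"
proof -
  assume A: "based_algebra n A \<phi>"
  obtain h where h1: "h \<in> B_hom n \<gamma>"
    and h2: "\<And>i j l. \<lbrakk>i < n; j < n; l < n\<rbrakk> \<Longrightarrow> h (B_class n (Var (SC i j l))) = str_const n A \<phi> i j l"
    and "\<And>i. i < n \<Longrightarrow> h (B_class n (Var (UC i))) = unit_const A \<phi> i"
    by (rule B_hom_exists[OF \<gamma> based_algebra.relations_hold[OF A]]) blast
  have h: "h \<in> B_hom n \<gamma>" "classifies n h A \<phi>" using h1 h2 by (simp_all add: classifies_def)
  show "\<exists>!h. h \<in> B_hom n \<gamma> \<and> classifies n h A \<phi>"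
  proof (rule ex1I[of _ h])
    fix h' assume h': "h' \<in> B_hom n \<gamma> \<and> classifies n h' A \<phi>"
    show "h' = h"
      by (rule B_hom_unique[OF \<gamma>]) (use h h' in \<open>auto simp: classifies_def\<close>)
  qed (use h in simp)
next
  assume h: "h \<in> B_hom n \<gamma>"
  obtain A :: "('r, 'r vec) module" and \<phi> where "based_algebra n A \<phi>"
    "\<And>i j l. \<lbrakk>i < n; j < n; l < n\<rbrakk> \<Longrightarrow> str_const n A \<phi> i j l = h (B_class n (Var (SC i j l)))"
    "\<And>i. i < n \<Longrightarrow> unit_const A \<phi> i = h (B_class n (Var (UC i)))"
    by (rule based_algebra_exists[OF B_hom_relations[OF \<gamma> h]]) blast
  hence "based_algebra n A \<phi> \<and> classifies n h A \<phi>" by (simp add: classifies_def)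
  thus "\<exists>(A' :: ('r, 'r vec) module) \<phi>'. based_algebra n A' \<phi>' \<and> classifies n h A' \<phi>'" by blast
next
  assume A: "based_algebra n A \<phi>" and h: "h \<in> B_hom n \<gamma>" and cl: "classifies n h A \<phi>"
  let ?c = "\<lambda>i j l. Var (SC i j l) :: 'k coord_poly"
  have c: "?c i j l \<in> carrier (poly_ring (coords n))" if "i < n" "j < n" "l < n" for i j l
    using that by (intro poly_ring_Var) (auto simp: coords_def)
  have prod: "prod f S \<in> carrier (poly_ring (coords n))"
    if "\<And>i. i \<in> S \<Longrightarrow> f i \<in> carrier (poly_ring (coords n))"
    for f :: "nat \<Rightarrow> 'k coord_poly" and S
    using that by (induction S rule: infinite_finite_induct) (auto intro: poly_ring_1 poly_ring_mult)
  let ?M = "mat n n (\<lambda>(i, j). \<Sum>l<n. ?c i j l * (\<Sum>m<n. ?c l m m))"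
  have entry: "?M $$ (i, j) \<in> carrier (poly_ring (coords n))" if "i < n" "j < n" for i j
  proof -
    have "(\<Sum>l<n. ?c i j l * (\<Sum>m<n. ?c l m m)) \<in> carrier (poly_ring (coords n))"
      by (intro poly_ring_sum poly_ring_mult c) (use that in simp_all)
    thus ?thesis using that by simp
  qed
  have "disc n ?c \<in> carrier (poly_ring (coords n))"
    unfolding disc_def det_def'[OF mat_carrier]
  proof (intro poly_ring_sum poly_ring_mult prod)
    fix p i assume "p \<in> {p. p permutes {0..<n}}" "i \<in> {0..<n}"
    hence "i < n" "p i < n" using permutes_in_image by fastforce+
    thus "?M $$ (i, p i) \<in> carrier (poly_ring (coords n))" by (rule entry)
  next
    fix p :: "nat \<Rightarrow> nat"
    show "signof p \<in> carrier (poly_ring (coords n) :: 'k coord_poly ring)"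
      by (auto simp: sign_def intro: poly_ring_1 poly_ring_uminus)
  qed
  hence "h (B_Delta n) = poly_eval \<gamma> (\<lambda>v. h (B_class n (Var v))) (disc n ?c)"
    unfolding B_Delta_def by (rule B_hom_eq[OF \<gamma> h])
  also have "\<dots> = disc n (\<lambda>i j l. h (B_class n (Var (SC i j l))))"
    by (subst disc_hom[OF poly_eval_hom[OF \<gamma>]]) (simp add: poly_eval_Var[OF \<gamma>])
  also have "\<dots> = disc n (str_const n A \<phi>)"
    by (rule disc_cong) (use cl in \<open>simp add: classifies_def\<close>)
  also have "\<dots> = alg_disc n A \<phi>" by (rule based_algebra.alg_disc_eq[OF A, symmetric])
  finally show "h (B_Delta n) = alg_disc n A \<phi>" .
qed

text \<open>
  The fibre product property of base change along \<open>\<delta> : 'k \<rightarrow> 'l\<close>, in particular along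
  \<^term>\<open>of_int :: int \<Rightarrow> 'l::comm_ring_1\<close>.
\<close>

definition same_constants ::
  "nat \<Rightarrow> ('k::comm_ring_1 coord_poly set \<Rightarrow> 'r) \<Rightarrow> ('l::comm_ring_1 coord_poly set \<Rightarrow> 'r) \<Rightarrow> bool" where
  "same_constants n g h \<longleftrightarrow> (\<forall>i<n. \<forall>j<n. \<forall>l<n.
     g (B_class n (Var (SC i j l))) = h (B_class n (Var (SC i j l))))"

theorem base_change:
  fixes \<delta> :: "'k::comm_ring_1 \<Rightarrow> 'l::comm_ring_1" and \<gamma> :: "'l \<Rightarrow> 'r::comm_ring_1"
  assumes \<delta>: "comm_ring_hom \<delta>" and \<gamma>: "comm_ring_hom \<gamma>"
  shows "g \<in> B_hom n (\<gamma> \<circ> \<delta>) \<Longrightarrow> \<exists>!h. h \<in> B_hom n \<gamma> \<and> same_constants n g h"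
    and "h \<in> B_hom n \<gamma> \<Longrightarrow> \<exists>!g. g \<in> B_hom n (\<gamma> \<circ> \<delta>) \<and> same_constants n g h"
proof -
  interpret \<delta>: comm_ring_hom \<delta> by fact
  interpret \<gamma>: comm_ring_hom \<gamma> by fact
  have gd: "comm_ring_hom (\<gamma> \<circ> \<delta>)"
    by unfold_locales (simp_all add: \<delta>.hom_add \<gamma>.hom_add \<delta>.hom_mult \<gamma>.hom_mult)
  {
    assume "g \<in> B_hom n (\<gamma> \<circ> \<delta>)"
    then obtain A :: "('r, 'r vec) module" and \<phi> where A: "based_algebra n A \<phi>" "classifies n g A \<phi>"
      using represents(2)[OF gd] by blast
    hence "same_constants n g h \<longleftrightarrow> classifies n h A \<phi>" for h :: "'l coord_poly set \<Rightarrow> 'r"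
      unfolding same_constants_def classifies_def by auto
    thus "\<exists>!h. h \<in> B_hom n \<gamma> \<and> same_constants n g h" using represents(1)[OF \<gamma> A(1)] by simp
  next
    assume "h \<in> B_hom n \<gamma>"
    then obtain A :: "('r, 'r vec) module" and \<phi> where A: "based_algebra n A \<phi>" "classifies n h A \<phi>"
      using represents(2)[OF \<gamma>] by blast
    hence "same_constants n g h \<longleftrightarrow> classifies n g A \<phi>" for g :: "'k coord_poly set \<Rightarrow> 'r"
      unfolding same_constants_def classifies_def by auto
    thus "\<exists>!g. g \<in> B_hom n (\<gamma> \<circ> \<delta>) \<and> same_constants n g h" using represents(1)[OF gd A(1)] by simp
  }
qed

end

theory Submission
  imports
    Defs
    "HOL-Computational_Algebra.Polynomial_Factorial"
    "Jordan_Normal_Form.Char_Poly"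
begin

text \<open>
  Over an algebraically closed field every etale algebra of rank \<open>n\<close> is a product of \<open>n\<close> copies of
  the field, so that a basis of it is given by an invertible matrix \<open>P\<close>, with structure constants
  \<open>c i j l = (\<Sum>m<n. P i m * P j m * Q m l)\<close>, where \<open>Q\<close> is the inverse of \<open>P\<close>, and with
  discriminant \<open>(det P)\<^sup>2\<close>. Therefore the kernel of the map from the coordinate ring to the
  function field of \<open>GL\<^sub>n\<close> lies in every prime ideal of the etale locus, which is thus
  irreducible. Comparing dimensions of spaces of polynomials of bounded degree, a chain of prime
  ideals cannot be longer than the number \<open>n\<^sup>2\<close> of entries of \<open>P\<close>. A chain of this length
  arises by specialising the entries of the generic matrix one by one to those of the identity
  matrix; its inclusions are strict because the entries are integral over the ring of structure
  constants.
\<close>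

section \<open>Etale algebras over algebraically closed fields\<close>

text \<open>Geometrically, the etale locus is the quotient of \<open>GL_n\<close> by the
  permutations of the columns of \<open>P\<close>, which permute the factors of the split algebra,
  and the quotient map is finite and surjective. Two shadows of this are used: surjectivity on
  geometric points, which makes the locus irreducible, and integrality, which keeps the contracted
  chain strict. An algebra over the given field need not split. Each prime is therefore tested in an
  algebraic closure of its residue field, where the algebra is described by an invertible matrix.
  Functions pulled back to \<open>GL_n\<close> have powers of \<open>det P\<close> as denominators;
  once these are cleared, vanishing at the generic matrix is an identity of polynomials, which may
  be evaluated at every matrix over every extension field. The specialisations end at the identity
  matrix because each prime of the chain must avoid the discriminant.\<close>

lemma homogeneous_system_nontrivial:
  fixes F :: "'t \<Rightarrow> 'i \<Rightarrow> 'a::field"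
  assumes "finite I" "finite T" "card I < card T"
  shows "\<exists>w. (\<exists>t\<in>T. w t \<noteq> 0) \<and> (\<forall>i\<in>I. (\<Sum>t\<in>T. w t * F t i) = 0)"
  using assms
proof (induction I arbitrary: T F rule: finite_induct)
  case empty
  then obtain t where "t \<in> T" by fastforce
  thus ?case by (intro exI[of _ "\<lambda>_. 1"]) auto
next
  case (insert i0 I)
  show ?case
  proof (cases "\<exists>t0\<in>T. F t0 i0 \<noteq> 0")
    case False
    have "card I < card T" using insert by simp
    from insert.IH[OF insert.prems(1) this] obtain w
      where w: "\<exists>t\<in>T. w t \<noteq> 0" "\<forall>i\<in>I. (\<Sum>t\<in>T. w t * F t i) = 0" by blast
    thus ?thesis using False by (intro exI[of _ w]) auto
  next
    case True
    then obtain t0 where t0: "t0 \<in> T" "F t0 i0 \<noteq> 0" by blast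
    define T' where "T' = T - {t0}"
    have T': "finite T'" "card I < card T'" "T = Set.insert t0 T'" "t0 \<notin> T'"
      using insert t0 by (auto simp: T'_def card_Diff_singleton)
    from insert.IH[OF T'(1,2), of "\<lambda>t i. F t i - F t i0 / F t0 i0 * F t0 i"] obtain w
      where w: "\<exists>t\<in>T'. w t \<noteq> 0"
        "\<And>i. i \<in> I \<Longrightarrow> (\<Sum>t\<in>T'. w t * (F t i - F t i0 / F t0 i0 * F t0 i)) = 0" by blast
    \<comment> \<open>Elimination: \<open>w\<close> solves the other equations after multiples of
      equation \<open>i0\<close> have been subtracted, and equation \<open>i0\<close> dictates the
      value at the pivot \<open>t0\<close>.\<close>
    define w' where "w' t = (if t = t0 then - (\<Sum>t\<in>T'. w t * F t i0) / F t0 i0 else w t)" for t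
    have eq: "(\<Sum>t\<in>T. w' t * F t i) =
        (\<Sum>t\<in>T'. w t * F t i) - (\<Sum>t\<in>T'. w t * F t i0) / F t0 i0 * F t0 i" for i
    proof -
      have "(\<Sum>t\<in>T'. w' t * F t i) = (\<Sum>t\<in>T'. w t * F t i)"
        using T'(4) by (intro sum.cong) (auto simp: w'_def)
      thus ?thesis using T' by (simp add: w'_def)
    qed
    have "(\<Sum>t\<in>T. w' t * F t i) = 0" if "i \<in> Set.insert i0 I" for i
    proof (cases "i = i0")
      case True
      thus ?thesis using t0 by (simp add: eq)
    next
      case False
      hence i: "i \<in> I" using that by blast
      have "(\<Sum>t\<in>T'. w t * F t i) - (\<Sum>t\<in>T'. w t * F t i0) / F t0 i0 * F t0 i
          = (\<Sum>t\<in>T'. w t * (F t i - F t i0 / F t0 i0 * F t0 i))"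
        by (simp add: right_diff_distrib sum_subtractf sum_divide_distrib sum_distrib_right mult.assoc)
      thus ?thesis unfolding eq w(2)[OF i] by simp
    qed
    moreover have "\<exists>t\<in>T. w' t \<noteq> 0" using w(1) T'(3,4) by (auto simp: w'_def)
    ultimately show ?thesis by blast
  qed
qed

text \<open>A root \<open>a\<close> of \<open>p\<close> splits off a factor: either
  \<open>f v - a v\<close> vanishes and \<open>v\<close> is an eigenvector, or it is a nonzero
  vector of \<open>W\<close> annihilated by a polynomial of smaller degree. The subspace is a
  predicate \<open>W\<close> on coordinate functions, so that it can be shrunk in later
  inductions.\<close>

lemma poly_operator_eigenvector:
  fixes f :: "(nat \<Rightarrow> 'a::alg_closed_field) \<Rightarrow> nat \<Rightarrow> 'a"
  assumes lin: "\<And>a b v w. f (\<lambda>l. a * v l + b * w l) = (\<lambda>l. a * f v l + b * f w l)"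
    and W: "\<And>v. W v \<Longrightarrow> W (f v)" "\<And>a b v w. W v \<Longrightarrow> W w \<Longrightarrow> W (\<lambda>l. a * v l + b * w l)"
    and p: "p \<noteq> 0" "degree p \<le> N" "\<And>l. (\<Sum>t\<le>N. coeff p t * (f ^^ t) v l) = 0"
    and v: "W v" "v \<noteq> (\<lambda>_. 0)"
  shows "\<exists>v a. W v \<and> v \<noteq> (\<lambda>_. 0) \<and> f v = (\<lambda>l. a * v l)"
  using p v
proof (induction N arbitrary: p v)
  case 0
  then obtain a where "p = [:a:]" by (metis degree_eq_zeroE le_zero_eq)
  with 0 have "v l = 0" for l by simp
  thus ?case using 0 by blast
next
  case (Suc N)
  show ?case
  proof (cases "degree p = 0")
    case True
    then obtain a where "p = [:a:]" by (metis degree_eq_zeroE)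
    hence "coeff p t * (f ^^ t) v l = (if t = 0 then a * v l else 0)" for t l
      by (cases t) auto
    hence "v l = 0" for l using Suc.prems \<open>p = [:a:]\<close> by simp
    thus ?thesis using Suc by blast
  next
    case False
    then obtain a where "poly p a = 0" using alg_closed_imp_poly_has_root[of p] by auto
    then obtain q where q: "p = [:-a, 1:] * q" by (metis dvdE poly_eq_0_iff_dvd)
    have q0: "q \<noteq> 0" using q Suc.prems(1) by auto
    have "degree p = Suc (degree q)" unfolding q by (subst degree_mult_eq) (use q0 in auto)
    hence dq: "degree q \<le> N" using Suc.prems by simp
    define v1 where "v1 = (\<lambda>l. f v l - a * v l)"
    have v1: "v1 = (\<lambda>l. 1 * f v l + (- a) * v l)" by (simp add: v1_def)
    have pow: "(f ^^ t) v1 = (\<lambda>l. (f ^^ Suc t) v l - a * (f ^^ t) v l)" for t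
    proof (induction t)
      case (Suc t)
      have "(f ^^ Suc t) v1 = f (\<lambda>l. 1 * (f ^^ Suc t) v l + (- a) * (f ^^ t) v l)"
        by (simp add: Suc)
      also have "\<dots> = (\<lambda>l. (f ^^ Suc (Suc t)) v l - a * (f ^^ Suc t) v l)"
        by (subst lin) simp
      finally show ?case .
    qed (simp add: v1_def)
    have c: "coeff p t = (case t of 0 \<Rightarrow> 0 | Suc t \<Rightarrow> coeff q t) - a * coeff q t" for t
      unfolding q by (simp add: coeff_pCons split: nat.split)
    have "(\<Sum>t\<le>N. coeff q t * (f ^^ t) v1 l) = (\<Sum>t\<le>Suc N. coeff p t * (f ^^ t) v l)" for l
    proof -
      have "(\<Sum>t\<le>Suc N. coeff p t * (f ^^ t) v l) =
          (\<Sum>t\<le>Suc N. (case t of 0 \<Rightarrow> 0 | Suc t \<Rightarrow> coeff q t) * (f ^^ t) v l)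
            - (\<Sum>t\<le>Suc N. a * coeff q t * (f ^^ t) v l)"
        by (simp only: c left_diff_distrib sum_subtractf)
      also have "(\<Sum>t\<le>Suc N. (case t of 0 \<Rightarrow> 0 | Suc t \<Rightarrow> coeff q t) * (f ^^ t) v l)
          = (\<Sum>t\<le>N. coeff q t * (f ^^ Suc t) v l)"
        by (subst sum.atMost_Suc_shift) simp
      also have "(\<Sum>t\<le>Suc N. a * coeff q t * (f ^^ t) v l) = (\<Sum>t\<le>N. a * coeff q t * (f ^^ t) v l)"
        using dq by (simp add: coeff_eq_0)
      finally show ?thesis by (simp add: pow right_diff_distrib sum_subtractf mult_ac)
    qed
    hence eq: "(\<Sum>t\<le>N. coeff q t * (f ^^ t) v1 l) = 0" for l using Suc.prems by simp
    show ?thesis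
    proof (cases "v1 = (\<lambda>_. 0)")
      case True
      hence "f v = (\<lambda>l. a * v l)" by (simp add: v1_def fun_eq_iff)
      thus ?thesis using Suc.prems by blast
    next
      case False
      have "W v1" unfolding v1 using Suc.prems W by blast
      from Suc.IH[OF q0 dq eq this False] show ?thesis .
    qed
  qed
qed

text \<open>The \<open>n + 1\<close> vectors \<open>v\<close>, \<open>f v\<close>, ...,
  \<open>(f ^^ n) v\<close> have only \<open>n\<close> coordinates, so a linear relation between
  them supplies the annihilating polynomial.\<close>

lemma invariant_subspace_eigenvector:
  fixes f :: "(nat \<Rightarrow> 'a::alg_closed_field) \<Rightarrow> nat \<Rightarrow> 'a"
  assumes lin: "\<And>a b v w. f (\<lambda>l. a * v l + b * w l) = (\<lambda>l. a * f v l + b * f w l)"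
    and W: "\<And>v. W v \<Longrightarrow> W (f v)" "\<And>a b v w. W v \<Longrightarrow> W w \<Longrightarrow> W (\<lambda>l. a * v l + b * w l)"
    and supp: "\<And>v l. W v \<Longrightarrow> l \<ge> n \<Longrightarrow> v l = 0"
    and v: "W v" "v \<noteq> (\<lambda>_. 0)"
  shows "\<exists>v a. W v \<and> v \<noteq> (\<lambda>_. 0) \<and> f v = (\<lambda>l. a * v l)"
proof -
  have Wt: "W ((f ^^ t) v)" for t by (induction t) (use W v in auto)
  obtain w where w: "\<exists>t\<in>{..n}. w t \<noteq> 0" "\<forall>i\<in>{..<n}. (\<Sum>t\<le>n. w t * (f ^^ t) v i) = 0"
    using homogeneous_system_nontrivial[of "{..<n}" "{..n}" "\<lambda>t. (f ^^ t) v"] by auto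
  define p where "p = (\<Sum>t\<le>n. monom (w t) t)"
  have c: "coeff p t = (if t \<le> n then w t else 0)" for t
    unfolding p_def by (simp add: coeff_sum)
  show ?thesis
  proof (rule poly_operator_eigenvector[where f = f and W = W and p = p and N = n and v = v])
    show "p \<noteq> 0" using w(1) c by (metis atMost_iff coeff_0)
    show "degree p \<le> n" by (rule degree_le) (simp add: c)
    show "(\<Sum>t\<le>n. coeff p t * (f ^^ t) v l) = 0" for l
      using w(2) supp[OF Wt] by (cases "l < n") (auto simp: c)
  qed (fact lin W v)+
qed

text \<open>Eigenspaces of operators that commute with \<open>f k\<close> are stable under
  \<open>f k\<close>. The joint eigenspace \<open>W'\<close> of the operators already treated can
  therefore replace \<open>W\<close> in the search for an eigenvector of the next one.\<close>

lemma common_eigenvector: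
  fixes f :: "nat \<Rightarrow> (nat \<Rightarrow> 'a::alg_closed_field) \<Rightarrow> nat \<Rightarrow> 'a"
  assumes lin: "\<And>i a b v w. f i (\<lambda>l. a * v l + b * w l) = (\<lambda>l. a * f i v l + b * f i w l)"
    and comm: "\<And>i k v. i < n \<Longrightarrow> k < n \<Longrightarrow> f i (f k v) = f k (f i v)"
    and W: "\<And>i v. i < n \<Longrightarrow> W v \<Longrightarrow> W (f i v)"
      "\<And>a b v w. W v \<Longrightarrow> W w \<Longrightarrow> W (\<lambda>l. a * v l + b * w l)"
    and supp: "\<And>v l. W v \<Longrightarrow> l \<ge> n \<Longrightarrow> v l = 0"
    and v: "W v" "v \<noteq> (\<lambda>_. 0)"
  shows "\<exists>v a. W v \<and> v \<noteq> (\<lambda>_. 0) \<and> (\<forall>i<n. f i v = (\<lambda>l. a i * v l))"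
proof -
  have "\<exists>v a. W v \<and> v \<noteq> (\<lambda>_. 0) \<and> (\<forall>i<k. f i v = (\<lambda>l. a i * v l))" if "k \<le> n" for k
    using that
  proof (induction k)
    case 0
    show ?case using v by auto
  next
    case (Suc k)
    then obtain v a where va: "W v" "v \<noteq> (\<lambda>_. 0)" "\<And>i. i < k \<Longrightarrow> f i v = (\<lambda>l. a i * v l)"
      by auto
    define W' where "W' v \<longleftrightarrow> W v \<and> (\<forall>i<k. f i v = (\<lambda>l. a i * v l))" for v
    have "\<exists>v b. W' v \<and> v \<noteq> (\<lambda>_. 0) \<and> f k v = (\<lambda>l. b * v l)"
    proof (rule invariant_subspace_eigenvector[where f = "f k" and W = W' and n = n and v = v])
      show "W' (f k w)" if w: "W' w" for w
      proof -
        have "f i (f k w) = (\<lambda>l. a i * f k w l)" if i: "i < k" for i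
        proof -
          have "f i (f k w) = f k (\<lambda>l. a i * w l + 0 * w l)"
            using comm[of i k w] w i Suc.prems by (simp add: W'_def)
          thus ?thesis unfolding lin by simp
        qed
        thus ?thesis using w W(1)[of k w] Suc.prems by (simp add: W'_def)
      qed
      show "W' (\<lambda>l. b * w l + b' * w' l)" if "W' w" "W' w'" for b b' w w'
        using that W(2) unfolding W'_def lin by (auto simp: fun_eq_iff algebra_simps)
    qed (use lin supp va in \<open>auto simp: W'_def\<close>)
    then obtain w b where w: "W' w" "w \<noteq> (\<lambda>_. 0)" "f k w = (\<lambda>l. b * w l)" by blast
    have "\<forall>i<Suc k. f i w = (\<lambda>l. (a(k := b)) i * w l)"
      using w by (auto simp: W'_def less_Suc_eq)
    thus ?case using w unfolding W'_def by blast
  qed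
  thus ?thesis by blast
qed

text \<open>The product of \<open>n\<close> copies of the ring in the basis formed by the rows of
  \<open>P\<close>: multiplication is componentwise in \<open>m\<close>, and \<open>Q\<close>
  converts components back to coefficients. The unit has all components 1, whence no
  \<open>P\<close> in the second equation. With \<open>coord\<close> as argument type this is a
  point at which polynomials can be evaluated.\<close>

primrec split_point ::
  "nat \<Rightarrow> (nat \<Rightarrow> nat \<Rightarrow> 'r) \<Rightarrow> (nat \<Rightarrow> nat \<Rightarrow> 'r) \<Rightarrow> coord \<Rightarrow> 'r::comm_ring_1" where
  "split_point n P Q (SC i j l) = (\<Sum>m<n. P i m * P j m * Q m l)"
| "split_point n P Q (UC l) = (\<Sum>m<n. Q m l)"

definition right_inverse ::
  "nat \<Rightarrow> (nat \<Rightarrow> nat \<Rightarrow> 'r) \<Rightarrow> (nat \<Rightarrow> nat \<Rightarrow> 'r::comm_ring_1) \<Rightarrow> bool" where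
  "right_inverse n P Q \<longleftrightarrow>
     (\<forall>i<n. \<forall>l<n. (\<Sum>m<n. P i m * Q m l) = (if i = l then 1 else 0))"

text \<open>Common eigenvectors of all multiplications, suitably rescaled, are the primitive
  idempotents. Nondegeneracy of the trace form permits the rescaling, orthogonality bounds their
  number by \<open>n\<close>, and anything outside their span would produce a further one. Column
  \<open>m\<close> of \<open>P\<close> is the character of the \<open>m\<close>-th idempotent and
  row \<open>m\<close> of \<open>Q\<close> holds its coordinates.\<close>

theorem etale_algebra_split:
  fixes c :: "nat \<Rightarrow> nat \<Rightarrow> nat \<Rightarrow> 'a::alg_closed_field"
  assumes rel: "alg_relations n c u \<subseteq> {0}" and disc: "disc n c \<noteq> 0"
  obtains P Q where "right_inverse n P Q"
    and "\<And>i j l. \<lbrakk>i < n; j < n; l < n\<rbrakk> \<Longrightarrow> split_point n P Q (SC i j l) = c i j l"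
    and "\<And>l. l < n \<Longrightarrow> split_point n P Q (UC l) = u l"
proof -
  have comm: "c i j l = c j i l" if "i < n" "j < n" "l < n" for i j l
    using subsetD[OF rel alg_relations_comm[OF that, of c u]] by simp
  have assoc: "(\<Sum>m<n. c i j m * c m k l) = (\<Sum>m<n. c j k m * c i m l)"
    if "i < n" "j < n" "k < n" "l < n" for i j k l
    using subsetD[OF rel alg_relations_assoc[OF that, of c u]] by simp
  have unit: "(\<Sum>i<n. u i * c i j l) = (if j = l then 1 else 0)" if "j < n" "l < n" for j l
    using subsetD[OF rel alg_relations_unit[OF that, of u c]] by (simp split: if_splits)
  \<comment> \<open>Multiplication by the \<open>i\<close>-th basis vector, with the result cut off
    to vanish from \<open>n\<close> on.\<close>
  define act where "act i v l = (if l < n then \<Sum>j<n. v j * c i j l else 0)"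
    for i and v :: "nat \<Rightarrow> 'a" and l
  have lin: "act i (\<lambda>l. a * v l + b * w l) = (\<lambda>l. a * act i v l + b * act i w l)" for i a b v w
    by (auto simp: act_def fun_eq_iff sum_distrib_left sum.distrib[symmetric] algebra_simps
        intro!: sum.cong)
  have act2: "act i (act k v) l = (\<Sum>j<n. v j * (\<Sum>m<n. c k j m * c i m l))"
    if "l < n" for i k v l
  proof -
    have "act i (act k v) l = (\<Sum>m<n. \<Sum>j<n. v j * (c k j m * c i m l))"
      using that by (simp add: act_def sum_distrib_right mult.assoc)
    also have "\<dots> = (\<Sum>j<n. \<Sum>m<n. v j * (c k j m * c i m l))" by (rule sum.swap)
    finally show ?thesis by (simp add: sum_distrib_left)
  qed
  have act_comm: "act i (act k v) = act k (act i v)" if ik: "i < n" "k < n" for i k v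
  proof
    fix l
    show "act i (act k v) l = act k (act i v) l"
    proof (cases "l < n")
      case True
      have "(\<Sum>m<n. c k j m * c i m l) = (\<Sum>m<n. c i j m * c k m l)" if j: "j < n" for j
      proof -
        have "(\<Sum>m<n. c k j m * c i m l) = (\<Sum>m<n. c j k m * c i m l)"
          by (intro sum.cong) (use comm ik j in auto)
        also have "\<dots> = (\<Sum>m<n. c i j m * c m k l)" using assoc ik j True by simp
        also have "\<dots> = (\<Sum>m<n. c i j m * c k m l)"
          by (intro sum.cong) (use comm ik j True in auto)
        finally show ?thesis .
      qed
      thus ?thesis using True by (simp add: act2)
    qed (simp add: act_def)
  qed
  have act_mult: "act i (act k v) l = (\<Sum>m<n. c i k m * act m v l)"
    if "i < n" "k < n" "l < n" for i k v l
  proof -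
    have "act i (act k v) l = (\<Sum>j<n. v j * (\<Sum>m<n. c i k m * c m j l))"
      unfolding act2[OF that(3)] by (intro sum.cong refl) (use assoc that in auto)
    also have "\<dots> = (\<Sum>j<n. \<Sum>m<n. v j * (c i k m * c m j l))" by (simp add: sum_distrib_left)
    also have "\<dots> = (\<Sum>m<n. \<Sum>j<n. v j * (c i k m * c m j l))" by (rule sum.swap)
    finally show ?thesis using that by (simp add: act_def sum_distrib_left mult_ac)
  qed
  define supp where "supp v \<longleftrightarrow> (\<forall>l\<ge>n. v l = 0)" for v :: "nat \<Rightarrow> 'a"
  have supp_act: "supp (act i v)" for i v by (simp add: supp_def act_def)
  \<comment> \<open>The linear functional with value \<open>\<chi> i\<close> on the
    \<open>i\<close>-th basis vector. It becomes multiplicative when \<open>\<chi>\<close> lists the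
    eigenvalues of a common eigenvector, by \<open>eig_mult\<close> and
    \<open>ev_act\<close>.\<close>
  define ev where "ev \<chi> v = (\<Sum>i<n. \<chi> i * v i)" for \<chi> v :: "nat \<Rightarrow> 'a"
  define eig where "eig \<chi> v \<longleftrightarrow> supp v \<and> (\<forall>i<n. act i v = (\<lambda>l. \<chi> i * v l))" for \<chi> v
  \<comment> \<open>Both sides are the eigenvalue at \<open>v\<close> of the product of the basis
    vectors \<open>i\<close> and \<open>k\<close>.\<close>
  have eig_mult: "\<chi> i * \<chi> k = (\<Sum>m<n. c i k m * \<chi> m)"
    if e: "eig \<chi> v" and v: "v \<noteq> (\<lambda>_. 0)" and ik: "i < n" "k < n" for \<chi> v i k
  proof -
    obtain l where l: "v l \<noteq> 0" using v by auto
    have ln: "l < n" by (rule ccontr) (use l e in \<open>simp add: eig_def supp_def\<close>)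
    have "act i (act k v) = act i (\<lambda>l. \<chi> k * v l + 0 * v l)" using e ik by (simp add: eig_def)
    also have "\<dots> = (\<lambda>l. \<chi> k * act i v l)" by (subst lin) simp
    finally have "act i (act k v) l = \<chi> i * \<chi> k * v l" using e ik by (simp add: eig_def)
    moreover have "act i (act k v) l = (\<Sum>m<n. c i k m * \<chi> m) * v l"
      unfolding act_mult[OF ik ln] sum_distrib_right
      by (intro sum.cong) (use e in \<open>auto simp: eig_def\<close>)
    ultimately show ?thesis using l by simp
  qed
  have ev_act: "ev \<chi> (act i w) = \<chi> i * ev \<chi> w"
    if e: "eig \<chi> v" and v: "v \<noteq> (\<lambda>_. 0)" and i: "i < n" for \<chi> v i w
  proof -
    have "ev \<chi> (act i w) = (\<Sum>l<n. \<Sum>j<n. w j * (c i j l * \<chi> l))"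
      by (simp add: ev_def act_def sum_distrib_left mult_ac)
    also have "\<dots> = (\<Sum>j<n. \<Sum>l<n. w j * (c i j l * \<chi> l))" by (rule sum.swap)
    also have "\<dots> = (\<Sum>j<n. w j * (\<chi> i * \<chi> j))"
      by (intro sum.cong) (use eig_mult[OF e v i] in \<open>auto simp: sum_distrib_left\<close>)
    finally show ?thesis by (simp add: ev_def sum_distrib_left mult_ac)
  qed
  text \<open>The trace form maps an eigenvector \<open>v\<close> to \<open>ev \<chi> v\<close> times its character \<open>\<chi>\<close>, because
    multiplication by \<open>v\<close> has rank one and trace \<open>ev \<chi> v\<close>.\<close>
  have ev_nz: "ev \<chi> v \<noteq> 0" if e: "eig \<chi> v" and v: "v \<noteq> (\<lambda>_. 0)" for \<chi> v
  proof
    assume z: "ev \<chi> v = 0"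
    define tr where "tr l = (\<Sum>m<n. c l m m)" for l
    define M where "M = mat n n (\<lambda>(i, j). \<Sum>l<n. c i j l * tr l)"
    have tr: "(\<Sum>l<n. v l * tr l) = 0"
    proof -
      have "(\<Sum>l<n. v l * tr l) = (\<Sum>l<n. \<Sum>m<n. v l * c l m m)"
        by (simp add: tr_def sum_distrib_left)
      also have "\<dots> = (\<Sum>m<n. \<Sum>l<n. v l * c l m m)" by (rule sum.swap)
      also have "\<dots> = (\<Sum>m<n. act m v m)"
        unfolding act_def by (intro sum.cong) (auto simp: comm intro!: sum.cong)
      also have "\<dots> = ev \<chi> v" unfolding ev_def by (intro sum.cong) (use e in \<open>auto simp: eig_def\<close>)
      finally show ?thesis using z by simp
    qed
    have "M *\<^sub>v vec n v = 0\<^sub>v n"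
    proof (rule eq_vecI)
      fix i assume "i < dim_vec (0\<^sub>v n :: 'a vec)"
      hence i: "i < n" by simp
      have "(M *\<^sub>v vec n v) $ i = (\<Sum>j<n. \<Sum>l<n. v j * c i j l * tr l)"
        using i by (simp add: M_def scalar_prod_def atLeast0LessThan sum_distrib_left mult_ac)
      also have "\<dots> = (\<Sum>l<n. \<Sum>j<n. v j * c i j l * tr l)" by (rule sum.swap)
      also have "\<dots> = (\<Sum>l<n. act i v l * tr l)" by (simp add: act_def sum_distrib_right)
      also have "\<dots> = \<chi> i * (\<Sum>l<n. v l * tr l)"
        using e i by (simp add: eig_def sum_distrib_left mult_ac)
      finally show "(M *\<^sub>v vec n v) $ i = 0\<^sub>v n $ i" using i tr by simp
    qed (simp add: M_def)
    moreover have "vec n v \<noteq> 0\<^sub>v n"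
    proof
      assume "vec n v = 0\<^sub>v n"
      hence "v l = 0" if "l < n" for l using that by (metis index_vec index_zero_vec(1))
      hence "v l = 0" for l using e by (cases "l < n") (auto simp: eig_def supp_def)
      thus False using v by auto
    qed
    ultimately have "det M = 0"
      by (subst det_0_iff_vec_prod_zero[of M n]) (auto simp: M_def intro!: exI[of _ "vec n v"])
    thus False using disc by (simp add: disc_def M_def tr_def)
  qed
  \<comment> \<open>An eigenvector \<open>v\<close> multiplied by itself is
    \<open>ev \<chi> v\<close> times \<open>v\<close>, so the normalisation singles out
    idempotents.\<close>
  define E where "E = {v. \<exists>\<chi>. eig \<chi> v \<and> ev \<chi> v = 1}"
  define ch where "ch v = (SOME \<chi>. eig \<chi> v \<and> ev \<chi> v = 1)" for v
  have ch: "eig (ch v) v" "ev (ch v) v = 1" if "v \<in> E" for v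
    using that someI_ex[of "\<lambda>\<chi>. eig \<chi> v \<and> ev \<chi> v = 1"] by (auto simp: E_def ch_def)
  have E_nz: "v \<noteq> (\<lambda>_. 0)" if "v \<in> E" for v using ch(2)[OF that] by (auto simp: ev_def)
  have ev_scale: "ev \<chi> (\<lambda>l. a * v l) = a * ev \<chi> v" for \<chi> a v
    by (simp add: ev_def sum_distrib_left mult_ac)
  \<comment> \<open>The product of \<open>v\<close> and \<open>w\<close> is a multiple of each of
    them.\<close>
  have swap: "ev (ch w) v * w l = ev (ch v) w * v l" if vw: "v \<in> E" "w \<in> E" and l: "l < n" for v w l
  proof -
    have L: "ev \<chi> v * w l = (\<Sum>i<n. \<Sum>j<n. v i * w j * c i j l)" if e: "eig \<chi> w" for \<chi> v w
    proof -
      have "ev \<chi> v * w l = (\<Sum>i<n. v i * act i w l)"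
        unfolding ev_def sum_distrib_right
        by (intro sum.cong) (use e in \<open>auto simp: eig_def mult_ac\<close>)
      thus ?thesis using l by (simp add: act_def sum_distrib_left mult_ac)
    qed
    have "(\<Sum>i<n. \<Sum>j<n. v i * w j * c i j l) = (\<Sum>j<n. \<Sum>i<n. v i * w j * c i j l)" by (rule sum.swap)
    also have "\<dots> = (\<Sum>j<n. \<Sum>i<n. w j * v i * c j i l)"
      by (intro sum.cong refl) (use comm l in auto)
    finally show ?thesis using L[OF ch(1)[OF vw(1)]] L[OF ch(1)[OF vw(2)]] by simp
  qed
  have orth: "ev (ch w) v = 0" if vw: "v \<in> E" "w \<in> E" and ne: "v \<noteq> w" for v w
  proof (rule ccontr)
    assume nz: "ev (ch w) v \<noteq> 0"
    have S: "ev \<psi> (\<lambda>l. ev (ch w) v * w l) = ev \<psi> (\<lambda>l. ev (ch v) w * v l)" for \<psi>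
      unfolding ev_def[of \<psi>] by (intro sum.cong refl) (use swap[OF vw] in simp)
    have "ev (ch w) v = ev (ch v) w * ev (ch w) v"
      using S[of "ch w"] ch(2)[OF vw(2)] by (simp add: ev_scale)
    hence 1: "ev (ch v) w = 1" using nz by simp
    have "ev (ch w) v * ev (ch v) w = ev (ch v) w"
      using S[of "ch v"] ch(2)[OF vw(1)] by (simp add: ev_scale)
    hence "ev (ch w) v = 1" using 1 by simp
    hence "v l = w l" for l
      using swap[OF vw, of l] 1 ch(1)[OF vw(1)] ch(1)[OF vw(2)]
      by (cases "l < n") (auto simp: eig_def supp_def)
    thus False using ne by auto
  qed
  have ev_sum: "ev \<chi> (\<lambda>l. \<Sum>v\<in>T. a v * v l) = (\<Sum>v\<in>T. a v * ev \<chi> v)" for \<chi> a T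
  proof -
    have "ev \<chi> (\<lambda>l. \<Sum>v\<in>T. a v * v l) = (\<Sum>l<n. \<Sum>v\<in>T. a v * (\<chi> l * v l))"
      by (simp add: ev_def sum_distrib_left mult_ac)
    also have "\<dots> = (\<Sum>v\<in>T. \<Sum>l<n. a v * (\<chi> l * v l))" by (rule sum.swap)
    finally show ?thesis by (simp add: ev_def sum_distrib_left)
  qed
  have ev_comb: "(\<Sum>v\<in>T. a v * ev (ch w) v) = a w" if "T \<subseteq> E" "finite T" "w \<in> T" for T a w
  proof -
    have "(\<Sum>v\<in>T. a v * ev (ch w) v) = (\<Sum>v\<in>T. if v = w then a w else 0)"
      by (intro sum.cong refl) (use that orth ch in \<open>auto simp: subset_iff\<close>)
    thus ?thesis using that by simp
  qed
  have small: "card T \<le> n" if T: "T \<subseteq> E" "finite T" for T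
  proof (rule ccontr)
    assume "\<not> card T \<le> n"
    then obtain a where a: "\<exists>v\<in>T. a v \<noteq> 0" "\<forall>l\<in>{..<n}. (\<Sum>v\<in>T. a v * v l) = 0"
      using homogeneous_system_nontrivial[of "{..<n}" T "\<lambda>v. v"] T by auto
    then obtain w where w: "w \<in> T" "a w \<noteq> 0" by blast
    have "ev (ch w) (\<lambda>l. \<Sum>v\<in>T. a v * v l) = 0"
      unfolding ev_def by (rule sum.neutral) (use a(2) in auto)
    thus False using w by (simp add: ev_sum ev_comb[OF T])
  qed
  have fin: "finite E" and cardE: "card E \<le> n"
  proof -
    show "finite E"
    proof (rule ccontr)
      assume "infinite E"
      then obtain T where "T \<subseteq> E" "finite T" "card T = Suc n"
        using infinite_arbitrarily_large by blast
      thus False using small[of T] by simp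
    qed
    thus "card E \<le> n" using small by blast
  qed
  \<comment> \<open>The error \<open>w'\<close> lies in the common kernel \<open>W\<close> of the
    characters of \<open>E\<close>, which is stable under all multiplications by
    \<open>ev_act\<close>. If \<open>w'\<close> were nonzero, \<open>W\<close> would contain a
    common eigenvector; normalised, it would be a member of \<open>E\<close> killed by its own
    character.\<close>
  have expand: "w = (\<lambda>l. \<Sum>v\<in>E. ev (ch v) w * v l)" if w: "supp w" for w
  proof (rule ccontr)
    assume ne: "w \<noteq> (\<lambda>l. \<Sum>v\<in>E. ev (ch v) w * v l)"
    define W where "W b \<longleftrightarrow> supp b \<and> (\<forall>v\<in>E. ev (ch v) b = 0)" for b
    define w' where "w' = (\<lambda>l. w l - (\<Sum>v\<in>E. ev (ch v) w * v l))"
    have ev_lin: "ev \<chi> (\<lambda>l. a * v l + b * x l) = a * ev \<chi> v + b * ev \<chi> x" for \<chi> a b v x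
      by (simp add: ev_def distrib_left sum.distrib sum_distrib_left mult_ac)
    have ev_diff: "ev \<chi> (\<lambda>l. v l - x l) = ev \<chi> v - ev \<chi> x" for \<chi> v x
      by (simp add: ev_def right_diff_distrib sum_subtractf)
    have W': "W w'"
      unfolding W_def
    proof (intro conjI ballI)
      have "v l = 0" if "v \<in> E" "l \<ge> n" for v l
        using ch(1)[OF that(1)] that(2) by (simp add: eig_def supp_def)
      thus "supp w'" using w by (auto simp: supp_def w'_def intro!: sum.neutral)
      show "ev (ch v) w' = 0" if "v \<in> E" for v
        unfolding w'_def ev_diff ev_sum using ev_comb[OF subset_refl fin that, of "\<lambda>v. ev (ch v) w"]
        by simp
    qed
    have "\<exists>v a. W v \<and> v \<noteq> (\<lambda>_. 0) \<and> (\<forall>i<n. act i v = (\<lambda>l. a i * v l))"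
    proof (rule common_eigenvector[where f = act and W = W and n = n and v = w'])
      show "W (act i v)" if i: "i < n" and v: "W v" for i v
        unfolding W_def using supp_act v ev_act[OF ch(1) E_nz i] by (simp add: W_def)
      show "W (\<lambda>l. a * v l + b * x l)" if "W v" "W x" for a b v x
        using that by (auto simp: W_def ev_lin supp_def)
      show "v l = 0" if "W v" "l \<ge> n" for v l using that by (simp add: W_def supp_def)
      show "W w'" by (rule W')
      show "w' \<noteq> (\<lambda>_. 0)" using ne by (auto simp: w'_def fun_eq_iff)
    qed (fact lin act_comm)+
    then obtain v \<chi> where v: "W v" "v \<noteq> (\<lambda>_. 0)" "eig \<chi> v" by (auto simp: eig_def W_def)
    define v' where "v' = (\<lambda>l. (1 / ev \<chi> v) * v l + 0 * v l)"
    have "W v'" unfolding W_def v'_def ev_lin using v(1) by (simp add: W_def supp_def)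
    have "eig \<chi> v'" unfolding eig_def
    proof (intro conjI allI impI)
      show "supp v'" using \<open>W v'\<close> by (simp add: W_def)
      show "act i v' = (\<lambda>l. \<chi> i * v' l)" if "i < n" for i
        using v(3) that unfolding v'_def lin by (simp add: eig_def fun_eq_iff)
    qed
    moreover have "ev \<chi> v' = 1" unfolding v'_def ev_lin using ev_nz[OF v(3,2)] by simp
    ultimately have "v' \<in> E" by (auto simp: E_def)
    thus False using \<open>W v'\<close> ch(2)[of v'] by (simp add: W_def)
  qed
  \<comment> \<open>Fewer than \<open>n\<close> characters would kill a nonzero vector in common,
    against \<open>expand\<close>.\<close>
  have "card E = n"
  proof (rule ccontr)
    assume "card E \<noteq> n"
    hence "card E < n" using cardE by simp
    then obtain a where a: "\<exists>i\<in>{..<n}. a i \<noteq> 0" "\<forall>v\<in>E. (\<Sum>i<n. a i * ch v i) = 0"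
      using homogeneous_system_nontrivial[of E "{..<n}" "\<lambda>i v. ch v i"] fin by auto
    define w where "w l = (if l < n then a l else 0)" for l
    have "ev (ch v) w = 0" if "v \<in> E" for v using a(2) that by (simp add: ev_def w_def mult.commute)
    moreover have "supp w" by (simp add: supp_def w_def)
    ultimately have "w = (\<lambda>_. 0)" using expand[of w] by simp
    thus False using a(1) by (metis lessThan_iff w_def)
  qed
  then obtain g where g: "bij_betw g {..<n} E" using fin by (metis ex_bij_betw_nat_finite lessThan_atLeast0)
  define P where "P i m = ch (g m) i" for i m
  define Q where "Q m l = g m l" for m l
  have expandn: "w l = (\<Sum>m<n. ev (ch (g m)) w * Q m l)" if "supp w" for w l
  proof -
    have "w l = (\<Sum>v\<in>E. ev (ch v) w * v l)" using expand[OF that] by (rule fun_cong)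
    also have "\<dots> = (\<Sum>m<n. ev (ch (g m)) w * g m l)"
      using sum.reindex_bij_betw[OF g, of "\<lambda>v. ev (ch v) w * v l"] by simp
    finally show ?thesis by (simp add: Q_def)
  qed
  have gE: "g m \<in> E" if "m < n" for m using g that by (auto dest: bij_betwE)
  show ?thesis
  proof (rule that)
    show "right_inverse n P Q" unfolding right_inverse_def
    proof (intro allI impI)
      fix i l assume il: "i < n" "l < n"
      define w where "w l = (if l = i then 1 else 0 :: 'a)" for l
      have "ev \<chi> w = \<chi> i" for \<chi>
      proof -
        have "ev \<chi> w = (\<Sum>l<n. if l = i then \<chi> i else 0)"
          unfolding ev_def w_def by (intro sum.cong) auto
        thus ?thesis using il by simp
      qed
      moreover have "supp w" using il by (auto simp: supp_def w_def)
      ultimately show "(\<Sum>m<n. P i m * Q m l) = (if i = l then 1 else 0)"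
        using expandn[of w l] by (auto simp: w_def P_def)
    qed
    show "split_point n P Q (SC i j l) = c i j l" if ijl: "i < n" "j < n" "l < n" for i j l
    proof -
      define w where "w l = (if l < n then c i j l else 0)" for l
      have "ev (ch (g m)) w = P i m * P j m" if m: "m < n" for m
        unfolding P_def eig_mult[OF ch(1) E_nz, OF gE gE, OF m m ijl(1,2)]
        by (simp add: ev_def w_def mult.commute)
      moreover have "supp w" by (simp add: supp_def w_def)
      ultimately show ?thesis using expandn[of w l] ijl by (simp add: w_def)
    qed
    show "split_point n P Q (UC l) = u l" if l: "l < n" for l
    proof -
      define w where "w l = (if l < n then u l else 0)" for l
      have "ev (ch v) w = 1" if v: "v \<in> E" for v
      proof -
        obtain l where l: "v l \<noteq> 0" using E_nz[OF v] by auto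
        have ln: "l < n" by (rule ccontr) (use l ch(1)[OF v] in \<open>simp add: eig_def supp_def\<close>)
        have "ev (ch v) w * v l = (\<Sum>i<n. u i * act i v l)"
          unfolding ev_def sum_distrib_right
          by (intro sum.cong) (use ch(1)[OF v] in \<open>auto simp: eig_def w_def\<close>)
        also have "\<dots> = (\<Sum>i<n. \<Sum>j<n. v j * (u i * c i j l))"
          using ln by (simp add: act_def sum_distrib_left mult_ac)
        also have "\<dots> = (\<Sum>j<n. \<Sum>i<n. v j * (u i * c i j l))" by (rule sum.swap)
        also have "\<dots> = (\<Sum>j<n. v j * (\<Sum>i<n. u i * c i j l))" by (simp add: sum_distrib_left)
        also have "\<dots> = (\<Sum>j<n. if j = l then v l else 0)"
          by (intro sum.cong refl) (use unit ln in auto)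
        also have "\<dots> = v l" using ln by simp
        finally show ?thesis using l by simp
      qed
      moreover have "supp w" by (simp add: supp_def w_def)
      ultimately show ?thesis using expandn[of w l] l gE by (simp add: w_def)
    qed
  qed
qed

section \<open>Structure constants of split algebras\<close>

lemma comm_ring_hom_comp:
  assumes "comm_ring_hom f" "comm_ring_hom g"
  shows "comm_ring_hom (f \<circ> g)"
proof -
  interpret f: comm_ring_hom f by fact
  interpret g: comm_ring_hom g by fact
  show ?thesis by unfold_locales (simp_all add: g.hom_add g.hom_mult f.hom_add f.hom_mult)
qed

lemma comm_ring_hom_Const: "comm_ring_hom Const"
  by unfold_locales (simp_all add: Const_def mult_single flip: single_add)

lemma mon_eval_hom:
  assumes "comm_ring_hom f"
  shows "f (mon_eval x m) = mon_eval (\<lambda>v. f (x v)) m"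
proof -
  interpret f: comm_ring_hom f by fact
  show ?thesis by (simp add: mon_eval_def f.hom_prod f.hom_power)
qed

lemma poly_eval_comp:
  assumes "comm_ring_hom f"
  shows "f (poly_eval \<gamma> x p) = poly_eval (f \<circ> \<gamma>) (\<lambda>v. f (x v)) p"
proof -
  interpret f: comm_ring_hom f by fact
  show ?thesis by (simp add: poly_eval_def f.hom_sum f.hom_mult mon_eval_hom[OF assms])
qed

lemma poly_eval_Const_comp:
  assumes "comm_ring_hom \<gamma>"
  shows "poly_eval \<gamma> x (poly_eval Const y p) = poly_eval \<gamma> (\<lambda>v. poly_eval \<gamma> x (y v)) p"
proof -
  have "poly_eval \<gamma> x \<circ> Const = \<gamma>" by (rule ext) (simp add: poly_eval_Const[OF assms])
  thus ?thesis using poly_eval_comp[OF poly_eval_hom[OF assms]] by metis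
qed

lemma poly_ring_power: "p \<in> carrier (poly_ring V) \<Longrightarrow> p ^ k \<in> carrier (poly_ring V)"
  by (induction k) (auto intro: poly_ring_1 poly_ring_mult)

lemma poly_ring_prod:
  "(\<And>i. i \<in> S \<Longrightarrow> f i \<in> carrier (poly_ring V)) \<Longrightarrow> prod f S \<in> carrier (poly_ring V)"
  by (induction S rule: infinite_finite_induct) (auto intro: poly_ring_1 poly_ring_mult)

lemma poly_eval_in_poly_ring:
  assumes "\<And>v. y v \<in> carrier (poly_ring V)"
  shows "poly_eval Const y p \<in> carrier (poly_ring V)"
  unfolding poly_eval_def mon_eval_def
  by (intro poly_ring_sum poly_ring_mult poly_ring_prod poly_ring_power poly_ring_Const assms)

section \<open>Matrices given by entry functions\<close>

definition entry_mat :: "nat \<Rightarrow> (nat \<Rightarrow> nat \<Rightarrow> 'r) \<Rightarrow> 'r mat" where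
  "entry_mat n P = mat n n (\<lambda>(i, j). P i j)"

lemma entry_mat_carrier [simp]: "entry_mat n P \<in> carrier_mat n n"
  by (simp add: entry_mat_def)

lemma entry_mat_mult:
  "entry_mat n P * entry_mat n Q = entry_mat n (\<lambda>i l. \<Sum>m<n. P i m * (Q m l :: 'r::comm_ring_1))"
  by (rule eq_matI) (auto simp: entry_mat_def scalar_prod_def atLeast0LessThan)

lemma entry_mat_eq_one:
  "entry_mat n P = 1\<^sub>m n \<longleftrightarrow> (\<forall>i<n. \<forall>l<n. P i l = (if i = l then 1 else 0 :: 'r::comm_ring_1))"
  by (auto simp: entry_mat_def mat_eq_iff)

lemma right_inverse_iff: "right_inverse n P Q \<longleftrightarrow> entry_mat n P * entry_mat n Q = 1\<^sub>m n"
  by (simp add: right_inverse_def entry_mat_mult entry_mat_eq_one)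

lemma right_inverse_sym:
  fixes P :: "nat \<Rightarrow> nat \<Rightarrow> 'a::field"
  assumes "right_inverse n P Q"
  shows "right_inverse n Q P"
  using assms mat_mult_left_right_inverse[of "entry_mat n P" n "entry_mat n Q"]
  by (simp add: right_inverse_iff)

lemma right_inverse_det_nonzero:
  fixes P :: "nat \<Rightarrow> nat \<Rightarrow> 'a::field"
  assumes "right_inverse n P Q"
  shows "det (entry_mat n P) \<noteq> 0"
proof
  assume "det (entry_mat n P) = 0"
  hence "det (entry_mat n P * entry_mat n Q) = 0" by (subst det_mult[of _ n]) auto
  thus False using assms by (simp add: right_inverse_iff)
qed

lemma right_inverse_exists:
  fixes P :: "nat \<Rightarrow> nat \<Rightarrow> 'a::field"
  assumes d: "det (entry_mat n P) \<noteq> 0"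
  shows "\<exists>Q. right_inverse n P Q"
proof -
  let ?A = "entry_mat n P"
  let ?B = "(1 / det ?A) \<cdot>\<^sub>m adj_mat ?A"
  note adj = adj_mat[OF entry_mat_carrier[of n P]]
  have B: "entry_mat n (\<lambda>i j. ?B $$ (i, j)) = ?B"
    by (rule eq_matI) (use adj(1) in \<open>auto simp: entry_mat_def\<close>)
  have "?A * ?B = (1 / det ?A) \<cdot>\<^sub>m (det ?A \<cdot>\<^sub>m 1\<^sub>m n)"
    using adj by (simp add: mult_smult_distrib[of _ n n _ n])
  also have "\<dots> = 1\<^sub>m n" by (rule eq_matI) (use d in auto)
  finally show ?thesis unfolding right_inverse_iff by (metis B)
qed

context
  fixes n :: nat and P Q :: "nat \<Rightarrow> nat \<Rightarrow> 'a::field"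
  assumes PQ: "right_inverse n P Q"
begin

text \<open>\<open>Q\<close> times \<open>P\<close> cancels between a factor \<open>f\<close> in the
  outer index and a constant \<open>g\<close>, the shape in which sums of products of structure
  constants appear below.\<close>

lemma contract_inverse:
  assumes "i < n"
  shows "(\<Sum>m<n. \<Sum>l<n. f m * Q m l * (P l i * g)) = f i * g" 
proof -
  have qp: "(\<Sum>l<n. Q m l * P l i) = (if m = i then 1 else 0)" if "m < n" for m
    using right_inverse_sym[OF PQ] that assms by (auto simp: right_inverse_def)
  have "(\<Sum>m<n. \<Sum>l<n. f m * Q m l * (P l i * g)) = (\<Sum>m<n. f m * g * (\<Sum>l<n. Q m l * P l i))"
    by (simp add: sum_distrib_left mult_ac)
  also have "\<dots> = (\<Sum>m<n. if m = i then f i * g else 0)"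
    by (intro sum.cong refl) (use qp in auto)
  finally show ?thesis using assms by simp
qed

text \<open>Column \<open>k\<close> of \<open>P\<close> is the \<open>k\<close>-th projection of the
  split algebra, a ring homomorphism; this is its multiplicativity on basis vectors.\<close>

lemma split_point_contract:
  assumes "j < n" "k < n"
  shows "(\<Sum>l<n. split_point n P Q (SC i j l) * P l k) = P i k * P j k"
proof -
  have "(\<Sum>l<n. split_point n P Q (SC i j l) * P l k)
      = (\<Sum>l<n. \<Sum>m<n. P i m * P j m * Q m l * (P l k * 1))"
    by (simp add: sum_distrib_right)
  also have "\<dots> = (\<Sum>m<n. \<Sum>l<n. P i m * P j m * Q m l * (P l k * 1))" by (rule sum.swap)
  also have "\<dots> = P i k * P j k" by (subst contract_inverse) (use assms in auto)
  finally show ?thesis .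
qed

text \<open>The right-hand side is symmetric in \<open>i\<close>, \<open>j\<close>,
  \<open>k\<close>, which yields the associativity relation.\<close>

lemma split_point_mult:
  assumes "i < n" "j < n" "k < n" "l < n"
  shows "(\<Sum>m<n. split_point n P Q (SC i j m) * split_point n P Q (SC m k l))
    = (\<Sum>p<n. P i p * P j p * P k p * Q p l)"
proof -
  have "(\<Sum>m<n. split_point n P Q (SC i j m) * split_point n P Q (SC m k l))
      = (\<Sum>m<n. \<Sum>p<n. split_point n P Q (SC i j m) * P m p * (P k p * Q p l))"
    unfolding split_point.simps(1)[of n P Q _ k l] by (simp only: sum_distrib_left mult.assoc)
  also have "\<dots> = (\<Sum>p<n. \<Sum>m<n. split_point n P Q (SC i j m) * P m p * (P k p * Q p l))"
    by (rule sum.swap)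
  also have "\<dots> = (\<Sum>p<n. (\<Sum>m<n. split_point n P Q (SC i j m) * P m p) * (P k p * Q p l))"
    by (simp only: sum_distrib_right)
  also have "\<dots> = (\<Sum>p<n. P i p * P j p * (P k p * Q p l))"
    by (intro sum.cong refl) (simp only: split_point_contract[OF assms(2)] lessThan_iff)
  finally show ?thesis by (simp only: mult.assoc)
qed

lemma split_point_relations:
  "alg_relations n (\<lambda>i j l. split_point n P Q (SC i j l)) (\<lambda>l. split_point n P Q (UC l)) \<subseteq> {0}"
proof
  have comm: "split_point n P Q (SC i j l) = split_point n P Q (SC j i l)" for i j l
    by (simp add: mult_ac)
  fix p
  assume "p \<in> alg_relations n (\<lambda>i j l. split_point n P Q (SC i j l)) (\<lambda>l. split_point n P Q (UC l))"
  thus "p \<in> {0}"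
  proof (cases rule: alg_relations_cases)
    case (comm i j l)
    thus ?thesis by (simp add: mult_ac)
  next
    case (assoc i j k l)
    have "(\<Sum>m<n. split_point n P Q (SC j k m) * split_point n P Q (SC i m l))
        = (\<Sum>m<n. split_point n P Q (SC j k m) * split_point n P Q (SC m i l))"
      by (simp only: comm)
    thus ?thesis unfolding assoc(5)
      using split_point_mult[OF assoc(1-4)] split_point_mult[OF assoc(2,3,1,4)]
      by (simp add: mult_ac)
  next
    case (unit j l)
    have "(\<Sum>i<n. split_point n P Q (UC i) * split_point n P Q (SC i j l))
        = (\<Sum>i<n. \<Sum>m<n. \<Sum>p<n. 1 * Q m i * (P i p * (P j p * Q p l)))"
      by (simp add: sum_product mult_ac)
    also have "\<dots> = (\<Sum>i<n. \<Sum>p<n. \<Sum>m<n. 1 * Q m i * (P i p * (P j p * Q p l)))"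
      by (intro sum.cong refl sum.swap)
    also have "\<dots> = (\<Sum>p<n. \<Sum>i<n. \<Sum>m<n. 1 * Q m i * (P i p * (P j p * Q p l)))"
      by (rule sum.swap)
    also have "\<dots> = (\<Sum>p<n. \<Sum>m<n. \<Sum>i<n. 1 * Q m i * (P i p * (P j p * Q p l)))"
      by (intro sum.cong refl sum.swap)
    also have "\<dots> = (\<Sum>p<n. P j p * Q p l)"
      by (intro sum.cong refl) (use contract_inverse[of _ "\<lambda>_. 1"] in simp)
    also have "\<dots> = (if j = l then 1 else 0)" using PQ unit by (simp add: right_inverse_def)
    finally show ?thesis unfolding unit(3) by simp
  qed
qed

text \<open>The trace of basis vector \<open>l\<close> is the sum of row \<open>l\<close> of
  \<open>P\<close>, so the trace form has the matrix \<open>P\<close> times its transpose.\<close>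

lemma split_point_disc: "disc n (\<lambda>i j l. split_point n P Q (SC i j l)) = det (entry_mat n P) ^ 2"
proof -
  have tr: "(\<Sum>m<n. split_point n P Q (SC l m m)) = (\<Sum>k<n. P l k)" if "l < n" for l
  proof -
    have "(\<Sum>m<n. split_point n P Q (SC l m m)) = (\<Sum>m<n. \<Sum>k<n. P l k * (Q k m * P m k))"
      by (simp add: mult_ac)
    also have "\<dots> = (\<Sum>k<n. \<Sum>m<n. P l k * (Q k m * P m k))" by (rule sum.swap)
    also have "\<dots> = (\<Sum>k<n. P l k * (\<Sum>m<n. Q k m * P m k))" by (simp add: sum_distrib_left)
    also have "\<dots> = (\<Sum>k<n. P l k)"
      by (intro sum.cong refl) (use right_inverse_sym[OF PQ] in \<open>auto simp: right_inverse_def\<close>)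
    finally show ?thesis .
  qed
  have "mat n n (\<lambda>(i, j). \<Sum>l<n. split_point n P Q (SC i j l) * (\<Sum>m<n. split_point n P Q (SC l m m)))
      = entry_mat n P * transpose_mat (entry_mat n P)"
  proof (rule eq_matI)
    fix i j assume "i < dim_row (entry_mat n P * transpose_mat (entry_mat n P))"
      "j < dim_col (entry_mat n P * transpose_mat (entry_mat n P))"
    hence ij: "i < n" "j < n" by (auto simp: entry_mat_def)
    have "(\<Sum>l<n. split_point n P Q (SC i j l) * (\<Sum>m<n. split_point n P Q (SC l m m)))
        = (\<Sum>l<n. \<Sum>k<n. split_point n P Q (SC i j l) * P l k)"
      by (intro sum.cong refl) (simp only: tr lessThan_iff sum_distrib_left)
    also have "\<dots> = (\<Sum>k<n. \<Sum>l<n. split_point n P Q (SC i j l) * P l k)" by (rule sum.swap)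
    also have "\<dots> = (\<Sum>k<n. P i k * P j k)"
      by (intro sum.cong refl) (simp only: split_point_contract[OF ij(2)] lessThan_iff)
    finally show "mat n n (\<lambda>(i, j). \<Sum>l<n. split_point n P Q (SC i j l) *
          (\<Sum>m<n. split_point n P Q (SC l m m))) $$ (i, j)
        = (entry_mat n P * transpose_mat (entry_mat n P)) $$ (i, j)"
      using ij by (simp add: entry_mat_def scalar_prod_def atLeast0LessThan del: split_point.simps)
  qed (auto simp: entry_mat_def)
  thus ?thesis unfolding disc_def
    by (simp add: det_mult[of _ n] det_transpose[of _ n] power2_eq_square del: split_point.simps)
qed

end

section \<open>Clearing denominators\<close>

instance coord :: countable
  by countable_datatype

text \<open>Comparing leading monomials shows that polynomials form an integral domain, which has a
  fraction field. This needs some linear order on the variables; the one of a numbering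
  serves.\<close>

instantiation coord :: linorder
begin

definition less_eq_coord :: "coord \<Rightarrow> coord \<Rightarrow> bool" where
  "less_eq_coord v w \<longleftrightarrow> to_nat v \<le> to_nat w"

definition less_coord :: "coord \<Rightarrow> coord \<Rightarrow> bool" where
  "less_coord v w \<longleftrightarrow> to_nat v < to_nat w"

instance
  by standard (auto simp: less_eq_coord_def less_coord_def)

end

lemma comm_ring_hom_to_fract: "comm_ring_hom (to_fract :: 'a::idom \<Rightarrow> 'a fract)"
  by unfold_locales simp_all

text \<open>The variables \<open>SC i j 0\<close> are reused for the entries of the generic matrix,
  so that one polynomial type serves both for structure constants and for
  \<open>GL_n\<close>.\<close>

definition entry_vars :: "nat \<Rightarrow> coord set" where
  "entry_vars n = {SC i j 0 | i j. i < n \<and> j < n}"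

primrec entry_point :: "nat \<Rightarrow> (nat \<Rightarrow> nat \<Rightarrow> 'r) \<Rightarrow> coord \<Rightarrow> 'r::comm_ring_1" where
  "entry_point n P (SC i j l) = (if i < n \<and> j < n \<and> l = 0 then P i j else 0)"
| "entry_point n P (UC i) = 0"

definition generic_entry :: "nat \<Rightarrow> nat \<Rightarrow> 'k::comm_ring_1 coord_poly" where
  "generic_entry i j = Var (SC i j 0)"

lemma entry_point_hom:
  assumes "comm_ring_hom f"
  shows "f (entry_point n P v) = entry_point n (\<lambda>i j. f (P i j)) v"
proof -
  interpret f: comm_ring_hom f by fact
  show ?thesis by (cases v) auto
qed

lemma map_entry_mat: "map_mat f (entry_mat n P) = entry_mat n (\<lambda>i j. f (P i j))"
  by (rule eq_matI) (auto simp: entry_mat_def)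

lemma det_entry_mat_hom:
  assumes "comm_ring_hom f"
  shows "f (det (entry_mat n P)) = det (entry_mat n (\<lambda>i j. f (P i j)))"
  using comm_ring_hom.hom_det[OF assms, of "entry_mat n P"] by (simp add: map_entry_mat)

abbreviation generic_mat :: "nat \<Rightarrow> 'k::comm_ring_1 coord_poly mat" where
  "generic_mat n \<equiv> entry_mat n generic_entry"

text \<open>The adjugate is the determinant times the inverse, so this is the determinant times the
  split point of the generic matrix, written without denominators.\<close>

primrec numerator :: "nat \<Rightarrow> coord \<Rightarrow> 'k::comm_ring_1 coord_poly" where
  "numerator n (SC i j l) =
     (\<Sum>m<n. generic_entry i m * generic_entry j m * adj_mat (generic_mat n) $$ (m, l))"
| "numerator n (UC l) = (\<Sum>m<n. adj_mat (generic_mat n) $$ (m, l))"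

definition mon_deg :: "(coord \<Rightarrow>\<^sub>0 nat) \<Rightarrow> nat" where
  "mon_deg m = (\<Sum>v\<in>Poly_Mapping.keys m. Poly_Mapping.lookup m v)"

definition total_deg :: "'k::comm_ring_1 coord_poly \<Rightarrow> nat" where
  "total_deg p = Max (insert 0 (mon_deg ` Poly_Mapping.keys p))"

lemma mon_deg_le: "m \<in> Poly_Mapping.keys p \<Longrightarrow> mon_deg m \<le> total_deg p"
  unfolding total_deg_def by (rule Max_ge) auto

text \<open>
  Multiplying by a power of the determinant turns a polynomial in the structure constants
  of a split algebra into one in the entries of \<open>P\<close>, see \<open>poly_eval_cleared\<close>. The outer
  \<^const>\<open>poly_eval\<close> does not change it; it makes visible that no other variables occur.
\<close>

definition cleared :: "nat \<Rightarrow> 'k::comm_ring_1 coord_poly \<Rightarrow> 'k coord_poly" where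
  "cleared n p = poly_eval Const (entry_point n generic_entry)
     (\<Sum>m\<in>Poly_Mapping.keys p. Const (Poly_Mapping.lookup p m) * mon_eval (numerator n) m
        * det (generic_mat n) ^ (total_deg p - mon_deg m))"

lemma entry_point_generic_closed:
  "entry_point n generic_entry v \<in> carrier (poly_ring (entry_vars n))"
  by (cases v) (auto simp: generic_entry_def entry_vars_def intro!: poly_ring_0 poly_ring_Var)

lemma cleared_in_poly_ring: "cleared n p \<in> carrier (poly_ring (entry_vars n))"
  unfolding cleared_def by (intro poly_eval_in_poly_ring entry_point_generic_closed)

lemma poly_eval_entry_point_comp:
  assumes \<gamma>: "comm_ring_hom \<gamma>"
  shows "poly_eval \<gamma> (entry_point n P) (poly_eval Const (entry_point n P') p)
    = poly_eval \<gamma> (entry_point n (\<lambda>i j. poly_eval \<gamma> (entry_point n P) (P' i j))) p"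
  unfolding poly_eval_Const_comp[OF \<gamma>] entry_point_hom[OF poly_eval_hom[OF \<gamma>]] ..

lemma poly_eval_generic_entry:
  assumes "comm_ring_hom \<gamma>" "i < n" "j < n"
  shows "poly_eval \<gamma> (entry_point n P) (generic_entry i j) = P i j"
  using assms by (simp add: generic_entry_def poly_eval_Var)

lemma entry_point_cong:
  "(\<And>i j. i < n \<Longrightarrow> j < n \<Longrightarrow> P i j = P' i j) \<Longrightarrow> entry_point n P v = entry_point n P' v"
  by (cases v) auto

lemma entry_mat_cong:
  "(\<And>i j. i < n \<Longrightarrow> j < n \<Longrightarrow> P i j = P' i j) \<Longrightarrow> entry_mat n P = entry_mat n P'"
  by (rule eq_matI) (auto simp: entry_mat_def)

text \<open>Each variable of a monomial \<open>m\<close> brings one factor \<open>det P\<close>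
  through its numerator; the extra power in \<open>cleared\<close> raises the exponent from
  \<open>mon_deg m\<close> to \<open>total_deg p\<close>, which is the same for all
  monomials.\<close>

lemma poly_eval_cleared:
  fixes \<gamma> :: "'k::comm_ring_1 \<Rightarrow> 'a::field" and P Q :: "nat \<Rightarrow> nat \<Rightarrow> 'a"
  assumes \<gamma>: "comm_ring_hom \<gamma>" and PQ: "right_inverse n P Q"
    and p: "p \<in> carrier (poly_ring (coords n))"
  shows "poly_eval \<gamma> (entry_point n P) (cleared n p)
    = det (entry_mat n P) ^ total_deg p * poly_eval \<gamma> (split_point n P Q) p"
proof -
  define \<eta> where "\<eta> = poly_eval \<gamma> (entry_point n P)"
  define d where "d = det (entry_mat n P)"
  have hom: "comm_ring_hom \<eta>" unfolding \<eta>_def by (rule poly_eval_hom[OF \<gamma>])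
  interpret \<eta>: comm_ring_hom \<eta> by (rule hom)
  have gen: "\<eta> (generic_entry i j) = P i j" if "i < n" "j < n" for i j
    unfolding \<eta>_def using poly_eval_generic_entry[OF \<gamma>] that by blast
  have mgen: "map_mat \<eta> (generic_mat n) = entry_mat n P"
    unfolding map_entry_mat by (rule entry_mat_cong) (rule gen)
  have dgen: "\<eta> (det (generic_mat n)) = d"
    unfolding d_def using \<eta>.hom_det[of "generic_mat n"] by (simp add: mgen)
  define A :: "'k coord_poly mat" where "A = adj_mat (generic_mat n)"
  note adj = adj_mat[of "generic_mat n :: 'k coord_poly mat" n, OF entry_mat_carrier, folded A_def]
  \<comment> \<open>The specialised adjugate times \<open>P\<close> from the left is
    \<open>d\<close> times the identity; multiplication by \<open>Q\<close> from the left then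
    determines it.\<close>
  have A: "\<eta> (A $$ (m, l)) = d * Q m l" if ml: "m < n" "l < n" for m l
  proof -
    let ?P = "entry_mat n P" and ?Q = "entry_mat n Q" and ?A = "map_mat \<eta> A"
    have Ac: "?A \<in> carrier_mat n n" using adj(1) by simp
    have "?P * ?A = map_mat \<eta> (generic_mat n * A)"
      unfolding mgen[symmetric] by (rule \<eta>.mat_hom_mult[OF entry_mat_carrier adj(1), symmetric])
    also have "\<dots> = d \<cdot>\<^sub>m 1\<^sub>m n"
      unfolding adj(2) by (rule eq_matI) (auto simp: dgen \<eta>.hom_mult)
    finally have PA: "?P * ?A = d \<cdot>\<^sub>m 1\<^sub>m n" .
    have QP: "?Q * ?P = 1\<^sub>m n" using right_inverse_sym[OF PQ] by (simp add: right_inverse_iff)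
    have "?A = (?Q * ?P) * ?A" using Ac by (simp add: QP)
    also have "\<dots> = ?Q * (?P * ?A)" by (rule assoc_mult_mat[OF entry_mat_carrier entry_mat_carrier Ac])
    also have "\<dots> = d \<cdot>\<^sub>m ?Q"
      unfolding PA by (simp add: mult_smult_distrib[of _ n n _ n] right_mult_one_mat[of _ n n])
    finally have "?A $$ (m, l) = (d \<cdot>\<^sub>m ?Q) $$ (m, l)" by simp
    thus ?thesis using ml Ac by (simp add: entry_mat_def)
  qed
  have num: "\<eta> (numerator n v) = d * split_point n P Q v" if "v \<in> coords n" for v
    using that
    by (auto simp: coords_def \<eta>.hom_sum \<eta>.hom_mult gen A[unfolded A_def] sum_distrib_left mult_ac
        intro!: sum.cong)
  have mon: "\<eta> (mon_eval (numerator n) m) = d ^ mon_deg m * mon_eval (split_point n P Q) m"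
    if "m \<in> Poly_Mapping.keys p" for m
  proof -
    have "Poly_Mapping.keys m \<subseteq> coords n" using p that by (simp add: carrier_poly_ring)
    hence "\<eta> (mon_eval (numerator n) m)
        = (\<Prod>v\<in>Poly_Mapping.keys m. (d * split_point n P Q v) ^ Poly_Mapping.lookup m v)"
      unfolding mon_eval_hom[OF hom] unfolding mon_eval_def
      by (intro prod.cong refl) (auto simp: num)
    thus ?thesis by (simp add: power_mult_distrib prod.distrib power_sum mon_deg_def mon_eval_def)
  qed
  have \<eta>C: "\<eta> (Const a) = \<gamma> a" for a unfolding \<eta>_def by (rule poly_eval_Const[OF \<gamma>])
  have pw: "d ^ mon_deg m * d ^ (total_deg p - mon_deg m) = d ^ total_deg p"
    if "m \<in> Poly_Mapping.keys p" for m
    using mon_deg_le[OF that] by (simp flip: power_add)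
  have "\<eta> (cleared n p) = \<eta> (\<Sum>m\<in>Poly_Mapping.keys p. Const (Poly_Mapping.lookup p m)
        * mon_eval (numerator n) m * det (generic_mat n) ^ (total_deg p - mon_deg m))"
  proof -
    have "(\<lambda>v. entry_point n (\<lambda>i j. \<eta> (generic_entry i j)) v) = entry_point n P"
      by (rule ext, rule entry_point_cong) (rule gen)
    thus ?thesis unfolding cleared_def \<eta>_def poly_eval_entry_point_comp[OF \<gamma>] by simp
  qed
  also have "\<dots> = (\<Sum>m\<in>Poly_Mapping.keys p. \<gamma> (Poly_Mapping.lookup p m)
        * (d ^ mon_deg m * mon_eval (split_point n P Q) m) * d ^ (total_deg p - mon_deg m))"
    by (simp add: \<eta>.hom_sum \<eta>.hom_mult \<eta>.hom_power \<eta>C mon dgen)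
  also have "\<dots> = (\<Sum>m\<in>Poly_Mapping.keys p. d ^ total_deg p *
        (\<gamma> (Poly_Mapping.lookup p m) * mon_eval (split_point n P Q) m))"
    by (intro sum.cong refl) (simp flip: pw)
  finally show ?thesis by (simp add: \<eta>_def d_def poly_eval_def sum_distrib_left)
qed

text \<open>In the basis of idempotents, multiplication by basis vector \<open>i\<close> is diagonal
  with row \<open>i\<close> of \<open>P\<close> on the diagonal, and \<open>P\<close> is the change
  of basis. Hence the entries of \<open>P\<close> are roots of monic polynomials over the structure
  constants.\<close>

lemma char_poly_split_mult:
  fixes P Q :: "nat \<Rightarrow> nat \<Rightarrow> 'a::field"
  assumes PQ: "right_inverse n P Q"
  shows "char_poly (mat n n (\<lambda>(a, b). split_point n P Q (SC i a b))) = (\<Prod>m<n. [:- P i m, 1:])"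
proof -
  let ?M = "mat n n (\<lambda>(a, b). split_point n P Q (SC i a b))"
  let ?P = "entry_mat n P" and ?Q = "entry_mat n Q"
  let ?D = "entry_mat n (\<lambda>a b. if a = b then P i a else 0)"
  have PD: "?P * ?D = entry_mat n (\<lambda>a b. P a b * P i b)"
    unfolding entry_mat_mult
    by (rule entry_mat_cong) (simp add: if_distrib cong: if_cong)
  have "?M = ?P * ?D * ?Q"
    unfolding PD unfolding entry_mat_mult by (rule eq_matI) (auto simp: entry_mat_def mult_ac)
  hence "similar_mat ?M ?D"
    using PQ right_inverse_sym[OF PQ]
    by (intro similar_matI[of _ _ ?P ?Q n])
      (auto simp: right_inverse_iff intro!: mult_carrier_mat[of _ n n])
  hence "char_poly ?M = char_poly ?D" by (rule char_poly_similar)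
  also have "\<dots> = (\<Prod>a\<leftarrow>diag_mat ?D. [:- a, 1:])"
    by (rule char_poly_upper_triangular[of _ n]) (auto simp: entry_mat_def)
  also have "\<dots> = (\<Prod>m\<leftarrow>[0..<n]. [:- P i m, 1:])"
    unfolding diag_mat_def by (auto simp: entry_mat_def comp_def intro!: arg_cong[of _ _ prod_list])
  also have "\<dots> = (\<Prod>m<n. [:- P i m, 1:])"
    by (subst prod.distinct_set_conv_list[symmetric]) (auto simp: atLeast0LessThan)
  finally show ?thesis .
qed

text \<open>A factor with \<open>d m = 0\<close> is the indeterminate itself, the others have
  nonzero constant term: the order of vanishing at the origin is the number of zeros among the
  \<open>d m\<close>.\<close>

lemma coeff_prod_linear:
  fixes d :: "'b \<Rightarrow> 'a::idom"
  assumes S: "finite S" and q: "q \<le> card {m \<in> S. d m = 0}"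
  shows "coeff (\<Prod>m\<in>S. [:d m, 1:]) q =
    (if q = card {m \<in> S. d m = 0} then \<Prod>m\<in>{m \<in> S. d m \<noteq> 0}. d m else 0)"
proof -
  let ?Z = "{m \<in> S. d m = 0}" and ?N = "{m \<in> S. d m \<noteq> 0}"
  have "S = ?Z \<union> ?N" by blast
  hence "(\<Prod>m\<in>S. [:d m, 1:]) = (\<Prod>m\<in>?Z \<union> ?N. [:d m, 1:])" by simp
  also have "\<dots> = (\<Prod>m\<in>?Z. [:d m, 1:]) * (\<Prod>m\<in>?N. [:d m, 1:])"
    by (rule prod.union_disjoint) (use S in auto)
  also have "(\<Prod>m\<in>?Z. [:d m, 1:]) = monom 1 (card ?Z)"
    by (simp add: monom_altdef)
  finally have "coeff (\<Prod>m\<in>S. [:d m, 1:]) q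
      = (if q = card ?Z then coeff (\<Prod>m\<in>?N. [:d m, 1:]) 0 else 0)"
    using q by (auto simp: coeff_monom_mult)
  moreover have "coeff (\<Prod>m\<in>?N. [:d m, 1:]) 0 = (\<Prod>m\<in>?N. d m)"
    by (simp add: poly_prod flip: poly_0_coeff_0)
  ultimately show ?thesis by simp
qed

section \<open>A chain of specialisations\<close>

text \<open>Positions are numbered row by row as \<open>i * n + j\<close>. The matrix is generic for
  \<open>s = 0\<close> and the identity for \<open>s = n^2\<close>; at every stage the remaining
  variables can still be specialised to the identity matrix, so the determinant is never
  zero.\<close>

definition step_entry :: "nat \<Rightarrow> nat \<Rightarrow> nat \<Rightarrow> nat \<Rightarrow> 'k::comm_ring_1 coord_poly" where
  "step_entry n s i j = (if i * n + j < s then if i = j then 1 else 0 else generic_entry i j)"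

definition step_frac :: "nat \<Rightarrow> nat \<Rightarrow> nat \<Rightarrow> nat \<Rightarrow> 'k::field coord_poly fract" where
  "step_frac n s i j = to_fract (step_entry n s i j)"

definition step_inv :: "nat \<Rightarrow> nat \<Rightarrow> nat \<Rightarrow> nat \<Rightarrow> 'k::field coord_poly fract" where
  "step_inv n s = (SOME Q. right_inverse n (step_frac n s) Q)"

text \<open>Pulls functions back along the matrix of step \<open>s\<close>. The values lie in a
  field, so the kernel is prime; these kernels form the chain.\<close>

definition step_eval :: "nat \<Rightarrow> nat \<Rightarrow> 'k::field coord_poly \<Rightarrow> 'k coord_poly fract" where
  "step_eval n s = poly_eval (to_fract \<circ> Const) (split_point n (step_frac n s) (step_inv n s))"

lemma comm_ring_hom_fract_Const: "comm_ring_hom (to_fract \<circ> Const :: 'k::field \<Rightarrow> 'k coord_poly fract)"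
  by (rule comm_ring_hom_comp[OF comm_ring_hom_to_fract comm_ring_hom_Const])

lemma comm_ring_hom_step_eval: "comm_ring_hom (step_eval n s)"
  unfolding step_eval_def by (rule poly_eval_hom[OF comm_ring_hom_fract_Const])

lemma generic_entry_neq:
  "generic_entry i j \<noteq> (0 :: 'k::comm_ring_1 coord_poly)"
  "generic_entry i j \<noteq> (1 :: 'k::comm_ring_1 coord_poly)"
proof -
  let ?m = "Poly_Mapping.single (SC i j 0) 1 :: coord \<Rightarrow>\<^sub>0 nat"
  have "Poly_Mapping.lookup ?m (SC i j 0) \<noteq> 0" by simp
  hence "?m \<noteq> 0" by (metis lookup_zero)
  hence "Poly_Mapping.lookup (generic_entry i j :: 'k coord_poly) ?m = 1"
    "Poly_Mapping.lookup (1 :: 'k coord_poly) ?m = 0"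
    by (auto simp: generic_entry_def Var_def lookup_one)
  thus "generic_entry i j \<noteq> (0 :: 'k coord_poly)" "generic_entry i j \<noteq> (1 :: 'k coord_poly)" by auto
qed

lemmas [simp] = generic_entry_neq generic_entry_neq[symmetric]

lemma det_step_entry: "det (entry_mat n (step_entry n s)) \<noteq> (0 :: 'k::comm_ring_1 coord_poly)"
proof
  let ?I = "\<lambda>i j. if i = j then 1 else 0 :: 'k"
  let ?e = "poly_eval (\<lambda>a. a) (entry_point n ?I)"
  have id: "comm_ring_hom (\<lambda>a :: 'k. a)" by unfold_locales simp_all
  have hom: "comm_ring_hom ?e" by (rule poly_eval_hom[OF id])
  interpret e: comm_ring_hom ?e by (rule hom)
  have "?e (step_entry n s i j) = ?I i j" if "i < n" "j < n" for i j
    using that by (auto simp: step_entry_def poly_eval_generic_entry[OF id])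
  hence "entry_mat n (\<lambda>i j. ?e (step_entry n s i j)) = 1\<^sub>m n" by (simp add: entry_mat_eq_one)
  hence "?e (det (entry_mat n (step_entry n s))) = 1" by (simp add: det_entry_mat_hom[OF hom])
  moreover assume "det (entry_mat n (step_entry n s)) = (0 :: 'k coord_poly)"
  ultimately show False by simp
qed

lemma det_step_frac: "det (entry_mat n (step_frac n s)) = to_fract (det (entry_mat n (step_entry n s)))"
  unfolding det_entry_mat_hom[OF comm_ring_hom_to_fract] step_frac_def ..

lemma det_step_frac_nonzero: "det (entry_mat n (step_frac n s)) \<noteq> 0"
  by (simp add: det_step_frac det_step_entry)

lemma step_inv: "right_inverse n (step_frac n s) (step_inv n s)"
  unfolding step_inv_def by (rule someI_ex[OF right_inverse_exists[OF det_step_frac_nonzero]])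

lemma step_eval_cleared:
  assumes "p \<in> carrier (poly_ring (coords n))"
  shows "to_fract (poly_eval Const (entry_point n (step_entry n s)) (cleared n p))
    = to_fract (det (entry_mat n (step_entry n s))) ^ total_deg p * step_eval n s p"
proof -
  have "to_fract (poly_eval Const (entry_point n (step_entry n s)) (cleared n p))
      = poly_eval (to_fract \<circ> Const) (entry_point n (step_frac n s)) (cleared n p)"
    unfolding poly_eval_comp[OF comm_ring_hom_to_fract] entry_point_hom[OF comm_ring_hom_to_fract]
      step_frac_def ..
  also have "\<dots> = to_fract (det (entry_mat n (step_entry n s))) ^ total_deg p * step_eval n s p"
    unfolding step_eval_def det_step_frac[symmetric]
    by (rule poly_eval_cleared[OF comm_ring_hom_fract_Const step_inv assms])
  finally show ?thesis .
qed

lemma step_eval_eq_0_iff: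
  assumes "p \<in> carrier (poly_ring (coords n))"
  shows "step_eval n s p = 0 \<longleftrightarrow> poly_eval Const (entry_point n (step_entry n s)) (cleared n p) = 0"
  using step_eval_cleared[OF assms, of s] det_step_entry[of n s]
  by (metis mult_eq_0_iff power_not_zero to_fract_eq_0_iff)

lemma step_entry_0: "step_entry n 0 = generic_entry"
  by (intro ext) (simp add: step_entry_def)

lemma poly_eval_generic_cleared:
  "poly_eval Const (entry_point n generic_entry) (cleared n p) = cleared n p"
proof -
  have "(\<lambda>v. entry_point n (\<lambda>i j. poly_eval Const (entry_point n generic_entry)
      (generic_entry i j)) v) = (entry_point n generic_entry :: coord \<Rightarrow> 'a coord_poly)"
    by (rule ext, rule entry_point_cong) (rule poly_eval_generic_entry[OF comm_ring_hom_Const])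
  thus ?thesis unfolding cleared_def poly_eval_entry_point_comp[OF comm_ring_hom_Const] by simp
qed

lemma step_eval_0_eq_0_iff:
  assumes "p \<in> carrier (poly_ring (coords n))"
  shows "step_eval n 0 p = 0 \<longleftrightarrow> cleared n p = 0"
  by (simp add: step_eval_eq_0_iff[OF assms] step_entry_0 poly_eval_generic_cleared)

text \<open>The matrix of step \<open>t\<close> arises from that of step \<open>s\<close> by a
  substitution. Fractions cannot be substituted into freely, hence the detour through
  \<open>cleared n p\<close>.\<close>

lemma step_eval_mono:
  assumes st: "s \<le> t" and p: "p \<in> carrier (poly_ring (coords n))" and z: "step_eval n s p = 0"
  shows "step_eval n t p = 0"
proof -
  let ?e = "\<lambda>s. poly_eval Const (entry_point n (step_entry n s)) :: 'a coord_poly \<Rightarrow> 'a coord_poly"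
  interpret e: comm_ring_hom "?e t" by (rule poly_eval_hom[OF comm_ring_hom_Const])
  have "?e t (step_entry n s i j) = step_entry n t i j" if ij: "i < n" "j < n" for i j
  proof (cases "i * n + j < s")
    case True
    thus ?thesis using st by (simp add: step_entry_def)
  next
    case False
    thus ?thesis using poly_eval_generic_entry[OF comm_ring_hom_Const ij]
      by (simp add: step_entry_def[of n s])
  qed
  hence "entry_point n (\<lambda>i j. ?e t (step_entry n s i j)) = entry_point n (step_entry n t)"
    by (intro ext entry_point_cong)
  hence "?e t (cleared n p) = ?e t (?e s (cleared n p))"
    unfolding poly_eval_entry_point_comp[OF comm_ring_hom_Const] by simp
  also have "?e s (cleared n p) = 0" using z step_eval_eq_0_iff[OF p] by simp
  finally show ?thesis unfolding step_eval_eq_0_iff[OF p] by simp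
qed

lemma pcompose_prod: "pcompose (\<Prod>m\<in>S. f m) p = (\<Prod>m\<in>S. pcompose (f m) (p :: 'a::comm_ring_1 poly))"
  by (induction S rule: infinite_finite_induct) (simp_all add: pcompose_mult pcompose_1)

lemma char_poly_entry_hom:
  assumes "comm_ring_hom h"
  shows "h (coeff (pcompose (char_poly (mat n n f)) [:a, 1:]) q)
    = coeff (pcompose (char_poly (mat n n (\<lambda>z. h (f z)))) [:h a, 1:]) q"
proof -
  interpret h: comm_ring_hom h by fact
  interpret mh: map_poly_comm_ring_hom h ..
  have "map_mat h (mat n n f) = mat n n (\<lambda>z. h (f z))" by (rule eq_matI) auto
  hence "map_poly h (char_poly (mat n n f)) = char_poly (mat n n (\<lambda>z. h (f z)))"
    using h.char_poly_hom[of "mat n n f" n] by simp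
  moreover have "h (coeff (pcompose (char_poly (mat n n f)) [:a, 1:]) q)
      = coeff (map_poly h (pcompose (char_poly (mat n n f)) [:a, 1:])) q" by simp
  ultimately show ?thesis by (simp add: h.map_poly_pcompose)
qed

text \<open>Being the identity on polynomials in \<open>coords n\<close>, it places determinants and
  coefficients of characteristic polynomials in the carrier without closure arguments, and it
  spreads ideals of the carrier over the whole type.\<close>

definition coord_retract :: "nat \<Rightarrow> 'k::comm_ring_1 coord_poly \<Rightarrow> 'k coord_poly" where
  "coord_retract n = poly_eval Const (\<lambda>v. if v \<in> coords n then Var v else 0)"

lemma comm_ring_hom_coord_retract: "comm_ring_hom (coord_retract n)"
  unfolding coord_retract_def by (rule poly_eval_hom[OF comm_ring_hom_Const])

lemma coord_retract_closed: "coord_retract n p \<in> carrier (poly_ring (coords n))"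
  unfolding coord_retract_def
  by (rule poly_eval_in_poly_ring) (auto intro: poly_ring_Var poly_ring_0)

text \<open>
  The entry \<open>x\<close> that is specialised in step \<open>s\<close> is integral over the ring of structure constants:
  it is a root of the characteristic polynomial of the multiplication by a basis vector. Moving
  the value that \<open>x\<close> gets to the origin, that polynomial vanishes there to strictly higher order
  after the step.
\<close>

lemma step_eval_strict:
  assumes s: "s < n ^ 2"
  shows "\<exists>p\<in>carrier (poly_ring (coords n) :: 'k::field coord_poly ring).
    step_eval n s p \<noteq> 0 \<and> step_eval n (Suc s) p = 0"
proof -
  define i j where "i = s div n" and "j = s mod n"
  have n: "n > 0" using s by (cases n) auto
  have i: "i < n" unfolding i_def using s n
    by (simp add: less_mult_imp_div_less power2_eq_square)
  have j: "j < n" unfolding j_def using n by simp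
  have ij: "s = i * n + j" by (simp add: i_def j_def)
  \<comment> \<open>The value that the entry in row \<open>i\<close> and column \<open>j\<close>
    receives in step \<open>s\<close>.\<close>
  define \<delta> :: "'k coord_poly" where "\<delta> = (if i = j then 1 else 0)"
  define F :: "'k coord_poly poly"
    where "F = pcompose (char_poly (mat n n (\<lambda>(a, b). Var (SC i a b)))) [:\<delta>, 1:]"
  define d where "d t m = to_fract \<delta> - step_frac n t i m" for t m
  define cut :: "coord \<Rightarrow> 'k coord_poly" where "cut v = (if v \<in> coords n then Var v else 0)" for v
  have cut: "coord_retract n = poly_eval Const cut"
    by (simp add: coord_retract_def cut_def[abs_def])
  have ev: "step_eval n t (coord_retract n (coeff F q)) = coeff (\<Prod>m<n. [:d t m, 1:]) q" for t q
  proof -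
    let ?x = "split_point n (step_frac n t) (step_inv n t)"
    let ?h = "poly_eval (to_fract \<circ> Const) (\<lambda>v. step_eval n t (cut v))"
    interpret st: comm_ring_hom "step_eval n t" by (rule comm_ring_hom_step_eval)
    have h: "comm_ring_hom ?h" by (rule poly_eval_hom[OF comm_ring_hom_fract_Const])
    interpret h: comm_ring_hom ?h by (rule h)
    have "step_eval n t (coord_retract n (coeff F q)) = ?h (coeff F q)"
      unfolding cut step_eval_def poly_eval_Const_comp[OF comm_ring_hom_fract_Const] ..
    also have "\<dots> = coeff (pcompose (char_poly (mat n n (\<lambda>z. ?h (case z of (a, b) \<Rightarrow> Var (SC i a b)))))
        [:?h \<delta>, 1:]) q"
      unfolding F_def by (rule char_poly_entry_hom[OF h])
    also have "mat n n (\<lambda>z. ?h (case z of (a, b) \<Rightarrow> Var (SC i a b)))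
        = mat n n (\<lambda>(a, b). ?x (SC i a b))"
    proof (rule eq_matI, goal_cases)
      case (1 a b)
      hence "SC i a b \<in> coords n" using i by (auto simp: coords_def)
      hence "step_eval n t (cut (SC i a b)) = ?x (SC i a b)"
        by (simp add: cut_def step_eval_def poly_eval_Var[OF comm_ring_hom_fract_Const]
            del: split_point.simps)
      thus ?case using 1 by (simp add: poly_eval_Var[OF comm_ring_hom_fract_Const])
    qed auto
    also have "char_poly (mat n n (\<lambda>(a, b). ?x (SC i a b))) = (\<Prod>m<n. [:- step_frac n t i m, 1:])"
      by (rule char_poly_split_mult[OF step_inv])
    also have "?h \<delta> = to_fract \<delta>" by (simp add: \<delta>_def)
    finally show ?thesis by (simp add: pcompose_prod pcompose_pCons d_def)
  qed
  define Z where "Z t = {m \<in> {..<n}. d t m = 0}" for t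
  define q where "q = card (Z s)"
  \<comment> \<open>Within row \<open>i\<close>, only the entry in column \<open>j\<close> changes
    between the two steps; it was a variable and hence different from
    \<open>\<delta>\<close>.\<close>
  have lt: "i * n + m < Suc s \<longleftrightarrow> i * n + m < s \<or> m = j" for m unfolding ij by auto
  have "d (Suc s) m = (if m = j then 0 else d s m)" for m
    using lt[of m] by (simp add: d_def step_frac_def step_entry_def \<delta>_def)
  moreover have "d s j \<noteq> 0"
    by (simp add: d_def step_frac_def step_entry_def \<delta>_def ij)
  ultimately have "Z (Suc s) = insert j (Z s)" "j \<notin> Z s" using j by (auto simp: Z_def split: if_splits)
  hence card: "card (Z (Suc s)) = Suc q" by (simp add: q_def Z_def)
  \<comment> \<open>The order of vanishing is \<open>q\<close> before the step and
    \<open>q + 1\<close> after it, so coefficient number \<open>q\<close> separates the two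
    kernels.\<close>
  let ?p = "coord_retract n (coeff F q)"
  have "step_eval n s ?p \<noteq> 0"
    unfolding ev by (subst coeff_prod_linear) (auto simp: q_def Z_def)
  moreover have "step_eval n (Suc s) ?p = 0"
    unfolding ev using card by (subst coeff_prod_linear) (auto simp: Z_def)
  moreover have "?p \<in> carrier (poly_ring (coords n))"
    by (rule coord_retract_closed)
  ultimately show ?thesis by blast
qed

section \<open>The generic point\<close>

text \<open>Prime ideals of a whole type rather than of a carrier set, as suits a quotient type of
  class \<open>idom\<close>.\<close>

definition prime_set :: "'r::comm_ring_1 set \<Rightarrow> bool" where
  "prime_set I \<longleftrightarrow> 0 \<in> I \<and> (\<forall>a\<in>I. \<forall>b\<in>I. a + b \<in> I) \<and> (\<forall>a\<in>I. \<forall>b. a * b \<in> I) \<and> 1 \<notin> I \<and>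
     (\<forall>a b. a * b \<in> I \<longrightarrow> a \<in> I \<or> b \<in> I)"

lemma prime_setD:
  assumes "prime_set I"
  shows "0 \<in> I" "a \<in> I \<Longrightarrow> b \<in> I \<Longrightarrow> a + b \<in> I" "a \<in> I \<Longrightarrow> a * b \<in> I" "a \<in> I \<Longrightarrow> b * a \<in> I"
    "1 \<notin> I" "a * b \<in> I \<Longrightarrow> a \<in> I \<or> b \<in> I" "a \<in> I \<Longrightarrow> - a \<in> I"
    "a \<in> I \<Longrightarrow> b \<in> I \<Longrightarrow> a - b \<in> I"
proof -
  show m: "a * b \<in> I" if "a \<in> I" for a b using assms that by (simp add: prime_set_def)
  show a: "a + b \<in> I" if "a \<in> I" "b \<in> I" for a b using assms that by (simp add: prime_set_def)
  show u: "- a \<in> I" if "a \<in> I" for a using m[OF that, of "- 1"] by simp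
  show "a - b \<in> I" if "a \<in> I" "b \<in> I" using a[OF that(1) u[OF that(2)]] by simp
  show "b * a \<in> I" if "a \<in> I" using m[OF that, of b] by (simp add: mult.commute)
qed (use assms in \<open>auto simp: prime_set_def\<close>)

abbreviation B_relations :: "nat \<Rightarrow> 'k::comm_ring_1 coord_poly set" where
  "B_relations n \<equiv> alg_relations n (\<lambda>i j l. Var (SC i j l)) (\<lambda>i. Var (UC i))"

abbreviation B_disc :: "nat \<Rightarrow> 'k::comm_ring_1 coord_poly" where
  "B_disc n \<equiv> disc n (\<lambda>i j l. Var (SC i j l))"

text \<open>
  That every prime ideal in the etale locus contains the polynomials \<open>a\<close> with \<open>cleared n a = 0\<close>
  is seen at geometric points: one needs the residue class ring as a type, to which
  \<open>fract\<close> and \<open>alg_closure\<close> can be applied. A type cannot depend on a prime ideal that is fixed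
  within a proof, but it can be formed for one hypothetical counterexample, chosen once and for all.
\<close>

definition bad_prime :: "nat \<Rightarrow> 'k::field coord_poly set \<Rightarrow> bool" where
  "bad_prime n I \<longleftrightarrow> prime_set I \<and> B_relations n \<subseteq> I \<and> B_disc n \<notin> I \<and>
     (\<exists>a\<in>carrier (poly_ring (coords n)). cleared n a = 0 \<and> a \<notin> I)"

text \<open>The default \<open>{0}\<close> is prime as well, so the quotient type is an integral
  domain whether or not a counterexample exists.\<close>

definition chosen_prime :: "'k::field coord_poly set" where
  "chosen_prime = (if \<exists>n I. bad_prime n (I :: 'k coord_poly set) then SOME I. \<exists>n. bad_prime n I else {0})"

lemma bad_chosen_prime:
  "bad_prime n (I :: 'k::field coord_poly set) \<Longrightarrow> \<exists>n. bad_prime n (chosen_prime :: 'k coord_poly set)"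
proof -
  assume "bad_prime n I"
  hence ex: "\<exists>I n. bad_prime n (I :: 'k coord_poly set)" by blast
  from someI_ex[OF ex] show ?thesis using ex unfolding chosen_prime_def by (subst if_P) blast+
qed

lemma prime_set_chosen_prime: "prime_set (chosen_prime :: 'k::field coord_poly set)"
proof (cases "\<exists>n I. bad_prime n (I :: 'k coord_poly set)")
  case True
  then obtain n where "bad_prime n (chosen_prime :: 'k coord_poly set)" using bad_chosen_prime by blast
  thus ?thesis by (simp add: bad_prime_def)
next
  case False
  thus ?thesis by (auto simp: chosen_prime_def prime_set_def)
qed

lemmas chosen_prime = prime_setD[OF prime_set_chosen_prime]

section \<open>The residue ring at the chosen prime\<close>

definition residue_rel :: "'k::field coord_poly \<Rightarrow> 'k coord_poly \<Rightarrow> bool" where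
  "residue_rel a b \<longleftrightarrow> a - b \<in> chosen_prime"

quotient_type (overloaded) 'k residue = "'k::field coord_poly" / residue_rel
proof (rule equivpI)
  show "reflp (residue_rel :: 'k coord_poly \<Rightarrow> _)"
    by (rule reflpI) (simp add: residue_rel_def chosen_prime(1))
  show "symp (residue_rel :: 'k coord_poly \<Rightarrow> _)"
  proof (rule sympI)
    fix a b :: "'k coord_poly"
    assume "residue_rel a b"
    hence "- (a - b) \<in> chosen_prime" unfolding residue_rel_def by (rule chosen_prime)
    thus "residue_rel b a" by (simp add: residue_rel_def)
  qed
  show "transp (residue_rel :: 'k coord_poly \<Rightarrow> _)"
  proof (rule transpI)
    fix a b c :: "'k coord_poly"
    assume "residue_rel a b" "residue_rel b c"
    hence "(a - b) + (b - c) \<in> chosen_prime" unfolding residue_rel_def by (rule chosen_prime)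
    thus "residue_rel a c" by (simp add: residue_rel_def)
  qed
qed

instantiation residue :: (field) idom
begin

lift_definition zero_residue :: "'a residue" is 0 .
lift_definition one_residue :: "'a residue" is 1 .

lift_definition plus_residue :: "'a residue \<Rightarrow> 'a residue \<Rightarrow> 'a residue" is "(+)"
proof -
  fix a a' b b' :: "'a coord_poly"
  assume "residue_rel a a'" "residue_rel b b'"
  hence "(a - a') + (b - b') \<in> chosen_prime" unfolding residue_rel_def by (rule chosen_prime)
  thus "residue_rel (a + b) (a' + b')" by (simp add: residue_rel_def algebra_simps)
qed

lift_definition minus_residue :: "'a residue \<Rightarrow> 'a residue \<Rightarrow> 'a residue" is "(-)"
proof -
  fix a a' b b' :: "'a coord_poly"
  assume "residue_rel a a'" "residue_rel b b'"
  hence "(a - a') - (b - b') \<in> chosen_prime" unfolding residue_rel_def by (rule chosen_prime)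
  thus "residue_rel (a - b) (a' - b')" by (simp add: residue_rel_def algebra_simps)
qed

lift_definition uminus_residue :: "'a residue \<Rightarrow> 'a residue" is uminus
proof -
  fix a a' :: "'a coord_poly"
  assume "residue_rel a a'"
  hence "- (a - a') \<in> chosen_prime" unfolding residue_rel_def by (rule chosen_prime)
  thus "residue_rel (- a) (- a')" by (simp add: residue_rel_def)
qed

lift_definition times_residue :: "'a residue \<Rightarrow> 'a residue \<Rightarrow> 'a residue" is "(*)"
proof -
  fix a a' b b' :: "'a coord_poly"
  assume "residue_rel a a'" "residue_rel b b'"
  hence "(a - a') * b + a' * (b - b') \<in> chosen_prime"
    unfolding residue_rel_def by (intro chosen_prime(2-4))
  thus "residue_rel (a * b) (a' * b')" by (simp add: residue_rel_def algebra_simps)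
qed

instance
proof
  fix a b c :: "'a residue"
  show "a * b * c = a * (b * c)"
    by transfer (simp add: residue_rel_def mult.assoc chosen_prime(1))
  show "a * b = b * a" by transfer (simp add: residue_rel_def mult.commute chosen_prime(1))
  show "1 * a = a" by transfer (simp add: residue_rel_def chosen_prime(1))
  show "a + b + c = a + (b + c)"
    by transfer (simp add: residue_rel_def add.assoc chosen_prime(1))
  show "a + b = b + a" by transfer (simp add: residue_rel_def add.commute chosen_prime(1))
  show "0 + a = a" by transfer (simp add: residue_rel_def chosen_prime(1))
  show "- a + a = 0" by transfer (simp add: residue_rel_def chosen_prime(1))
  show "a - b = a + - b" by transfer (simp add: residue_rel_def chosen_prime(1))
  show "(a + b) * c = a * c + b * c"
    by transfer (simp add: residue_rel_def distrib_right chosen_prime(1))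
  show "a * (b + c) = a * b + a * c"
    by transfer (simp add: residue_rel_def distrib_left chosen_prime(1))
  show "0 * a = 0" "a * 0 = 0" by (transfer; simp add: residue_rel_def chosen_prime(1))+
  have "- 1 \<notin> (chosen_prime :: 'a coord_poly set)"
    using chosen_prime(5) chosen_prime(7)[of "- 1 :: 'a coord_poly"] by auto
  thus "(0 :: 'a residue) \<noteq> 1" by transfer (simp add: residue_rel_def)
  show "a \<noteq> 0 \<Longrightarrow> b \<noteq> 0 \<Longrightarrow> a * b \<noteq> 0"
    by transfer (auto simp: residue_rel_def dest: chosen_prime(6))
qed

end

lemma comm_ring_hom_abs_residue: "comm_ring_hom abs_residue"
  by unfold_locales
    (simp_all only: plus_residue.abs_eq times_residue.abs_eq zero_residue_def one_residue_def)

lemma abs_residue_eq_0_iff: "abs_residue a = 0 \<longleftrightarrow> a \<in> chosen_prime"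
  by (simp add: zero_residue_def residue.abs_eq_iff residue_rel_def)

lemma comm_ring_hom_to_ac: "comm_ring_hom (to_ac :: 'a::field \<Rightarrow> 'a alg_closure)"
  by unfold_locales simp_all

lemma poly_eval_Const_Var: "poly_eval Const Var p = (p :: 'k::comm_ring_1 coord_poly)"
proof -
  have "(\<lambda>p :: 'k coord_poly. p) \<in> Ring.ring_hom (poly_ring UNIV) ring_of_type_algebra"
    by (rule Ring.ring_hom_memI) auto
  from hom_eq_poly_eval[OF comm_ring_hom_Const this, of p] show ?thesis
    by (simp add: carrier_poly_ring)
qed

lemma alg_relations_hom_zero:
  assumes "comm_ring_hom f" and z: "\<And>p. p \<in> alg_relations n c u \<Longrightarrow> f p = 0"
  shows "alg_relations n (\<lambda>i j l. f (c i j l)) (\<lambda>i. f (u i)) \<subseteq> {0}"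
proof
  interpret f: comm_ring_hom f by fact
  fix q assume "q \<in> alg_relations n (\<lambda>i j l. f (c i j l)) (\<lambda>i. f (u i))"
  thus "q \<in> {0}"
  proof (cases rule: alg_relations_cases)
    case (comm i j l)
    thus ?thesis using z[OF alg_relations_comm[of i n j l c u]] by (simp add: f.hom_minus)
  next
    case (assoc i j k l)
    thus ?thesis using z[OF alg_relations_assoc[of i n j k l c u]]
      by (simp add: f.hom_minus f.hom_sum f.hom_mult)
  next
    case (unit j l)
    thus ?thesis using z[OF alg_relations_unit[of j n l u c]]
      by (simp add: f.hom_minus f.hom_sum f.hom_mult split: if_splits)
  qed
qed

text \<open>Modulo the prime, the structure constants define an algebra of nonzero discriminant over
  the algebraically closed field that \<open>\<psi>\<close> maps to, so they come from an invertible
  \<open>P\<close>. Evaluating \<open>cleared n a = 0\<close> at \<open>P\<close> gives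
  \<open>\<psi> a = 0\<close> up to a power of the determinant.\<close>

lemma not_bad_prime: "\<not> bad_prime n (I :: 'k::field coord_poly set)"
proof
  assume "bad_prime n I"
  \<comment> \<open>The given counterexample is exchanged for the chosen one, possibly with another
    \<open>n\<close>, because only the latter has its residue ring as a type.\<close>
  then obtain n where "bad_prime n (chosen_prime :: 'k coord_poly set)" using bad_chosen_prime by blast
  then obtain a :: "'k coord_poly" where rel: "B_relations n \<subseteq> (chosen_prime :: 'k coord_poly set)"
    and disc: "B_disc n \<notin> (chosen_prime :: 'k coord_poly set)"
    and a: "a \<in> carrier (poly_ring (coords n))" "cleared n a = 0" "a \<notin> chosen_prime"
    by (auto simp: bad_prime_def)
  define \<psi> where "\<psi> = to_ac \<circ> (to_fract \<circ> (abs_residue :: 'k coord_poly \<Rightarrow> _))"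
  have hom: "comm_ring_hom \<psi>"
    unfolding \<psi>_def
    by (intro comm_ring_hom_comp comm_ring_hom_to_ac comm_ring_hom_to_fract comm_ring_hom_abs_residue)
  have zero: "\<psi> p = 0 \<longleftrightarrow> p \<in> chosen_prime" for p by (simp add: \<psi>_def abs_residue_eq_0_iff)
  let ?x = "\<lambda>v. \<psi> (Var v)"
  have "alg_relations n (\<lambda>i j l. ?x (SC i j l)) (\<lambda>i. ?x (UC i)) \<subseteq> {0}"
    by (rule alg_relations_hom_zero[OF hom]) (use rel zero in blast)
  moreover have "disc n (\<lambda>i j l. ?x (SC i j l)) \<noteq> 0"
    using disc by (simp add: zero flip: disc_hom[OF hom])
  ultimately obtain P Q where PQ: "right_inverse n P Q"
    and pt: "\<And>i j l. \<lbrakk>i < n; j < n; l < n\<rbrakk> \<Longrightarrow> split_point n P Q (SC i j l) = ?x (SC i j l)"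
      "\<And>l. l < n \<Longrightarrow> split_point n P Q (UC l) = ?x (UC l)"
    by (rule etale_algebra_split) blast
  have g: "comm_ring_hom (\<psi> \<circ> Const)" by (rule comm_ring_hom_comp[OF hom comm_ring_hom_Const])
  interpret e: comm_ring_hom "poly_eval (\<psi> \<circ> Const) (entry_point n P)" by (rule poly_eval_hom[OF g])
  have "\<psi> a = poly_eval (\<psi> \<circ> Const) ?x a"
    using poly_eval_comp[OF hom, of Const Var a] by (simp add: poly_eval_Const_Var)
  also have "\<dots> = poly_eval (\<psi> \<circ> Const) (split_point n P Q) a"
    by (rule poly_eval_cong[OF a(1)]) (auto simp: coords_def pt simp del: split_point.simps)
  finally have "det (entry_mat n P) ^ total_deg a * \<psi> a = 0"
    using poly_eval_cleared[OF g PQ a(1)] a(2) by simp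
  thus False using right_inverse_det_nonzero[OF PQ] zero a(3) by simp
qed

text \<open>Step 0 is evaluation at the generic matrix, so its kernel is the generic point of the
  etale locus.\<close>

theorem etale_prime_contains_generic:
  fixes I :: "'k::field coord_poly set"
  assumes "prime_set I" "B_relations n \<subseteq> I" "B_disc n \<notin> I"
    and "a \<in> carrier (poly_ring (coords n))" "step_eval n 0 a = 0"
  shows "a \<in> I"
  using not_bad_prime[of n I] assms by (auto simp: bad_prime_def step_eval_0_eq_0_iff)

section \<open>Bounding chains of prime ideals\<close>

lemma Const_notin_prime_set:
  assumes "prime_set I" "c \<noteq> (0 :: 'k::field)"
  shows "Const c \<notin> I"
proof
  interpret C: comm_ring_hom "Const :: 'k \<Rightarrow> 'k coord_poly" by (rule comm_ring_hom_Const)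
  assume "Const c \<in> I"
  hence "Const c * Const (1 / c) \<in> I" by (rule prime_setD[OF assms(1)])
  thus False using assms by (simp add: prime_setD flip: C.hom_mult)
qed

lemma prime_set_power:
  assumes "prime_set I" "a ^ k \<in> I"
  shows "a \<in> I"
  using assms(2) by (induction k) (auto simp: prime_setD(5)[OF assms(1)] dest: prime_setD(6)[OF assms(1)])

definition exponents :: "nat \<Rightarrow> nat \<Rightarrow> nat list set" where
  "exponents D m = {e. set e \<subseteq> {..<D} \<and> length e = m}"

lemma finite_exponents [simp]: "finite (exponents D m)"
  unfolding exponents_def by (rule finite_lists_length_eq) simp

lemma sum_exponents_Suc:
  "(\<Sum>e\<in>exponents D (Suc m). f e) = (\<Sum>x<D. \<Sum>e\<in>exponents D m. f (x # e))"
proof -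
  have "exponents D (Suc m) = (\<lambda>(e, x). x # e) ` (exponents D m \<times> {..<D})"
    unfolding exponents_def by (rule lists_length_Suc_eq)
  hence "(\<Sum>e\<in>exponents D (Suc m). f e) = (\<Sum>(e, x)\<in>exponents D m \<times> {..<D}. f (x # e))"
    using sum.reindex[OF inj_split_Cons, of f "exponents D m \<times> {..<D}"]
    by (simp add: case_prod_unfold)
  also have "\<dots> = (\<Sum>e\<in>exponents D m. \<Sum>x<D. f (x # e))"
    by (rule sum.cartesian_product[symmetric])
  also have "\<dots> = (\<Sum>x<D. \<Sum>e\<in>exponents D m. f (x # e))" by (rule sum.swap)
  finally show ?thesis .
qed

text \<open>
  Elements \<open>a i \<in> I (i + 1) - I i\<close> along a chain of prime ideals are algebraically independent
  modulo \<open>I 0\<close>: after dividing by a power of \<open>a 0\<close>, a relation modulo \<open>I 0\<close> leaves modulo \<open>I 1\<close>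
  a relation between the others.
\<close>

lemma prime_chain_independent:
  fixes I :: "nat \<Rightarrow> 'k::field coord_poly set"
  assumes "\<And>i. i \<le> m \<Longrightarrow> prime_set (I i)"
    and "\<And>i. i < m \<Longrightarrow> I i \<subseteq> I (Suc i)" "\<And>i. i < m \<Longrightarrow> a i \<in> I (Suc i) - I i"
    and "e \<in> exponents D m" "w e \<noteq> 0"
  shows "(\<Sum>e\<in>exponents D m. Const (w e) * (\<Prod>i<m. a i ^ (e ! i))) \<notin> I 0"
  using assms
proof (induction m arbitrary: I a w e)
  case 0
  have "exponents D 0 = {[]}" by (auto simp: exponents_def)
  thus ?case using 0 Const_notin_prime_set[of "I 0"] by simp
next
  case (Suc m)
  define S where "S x = (\<Sum>e\<in>exponents D m. Const (w (x # e)) * (\<Prod>i<m. a (Suc i) ^ (e ! i)))" for x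
  have eq: "(\<Sum>e\<in>exponents D (Suc m). Const (w e) * (\<Prod>i<Suc m. a i ^ (e ! i))) = (\<Sum>x<D. a 0 ^ x * S x)"
    unfolding sum_exponents_Suc S_def sum_distrib_left
    by (intro sum.cong refl) (simp add: prod.lessThan_Suc_shift mult_ac del: prod.lessThan_Suc)
  define ok where "ok x \<longleftrightarrow> (\<exists>e\<in>exponents D m. w (x # e) \<noteq> 0)" for x
  \<comment> \<open>The lowest power of \<open>a 0\<close> whose coefficient \<open>S x\<close> is a
    nontrivial combination; the induction hypothesis for the chain starting at \<open>I 1\<close>
    keeps \<open>S x\<close> out of \<open>I 1\<close>.\<close>
  define x where "x = (LEAST x. ok x)"
  obtain y e' where y: "e = y # e'" using Suc.prems(4) by (cases e) (auto simp: exponents_def)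
  have oky: "ok y" and yD: "y < D" using Suc.prems(4,5) unfolding y by (auto simp: ok_def exponents_def)
  have okx: "ok x" and xy: "x \<le> y" using oky unfolding x_def by (auto intro: LeastI Least_le)
  hence xD: "x < D" using yD by simp
  interpret C: comm_ring_hom "Const :: 'k \<Rightarrow> 'k coord_poly" by (rule comm_ring_hom_Const)
  have S0: "S z = 0" if "z < x" for z
    using not_less_Least[OF that[unfolded x_def]] by (auto simp: S_def ok_def intro!: sum.neutral)
  obtain e0 where e0: "e0 \<in> exponents D m" "w (x # e0) \<noteq> 0" using okx by (auto simp: ok_def)
  have Sx: "S x \<notin> I 1"
    unfolding S_def
    using Suc.IH[of "\<lambda>i. I (Suc i)" "\<lambda>i. a (Suc i)" e0 "\<lambda>e. w (x # e)"] Suc.prems(1-3) e0 by simp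
  define R where "R = (\<Sum>z\<in>{x<..<D}. a 0 ^ (z - Suc x) * S z)"
  have "(\<Sum>z<D. a 0 ^ z * S z) = (\<Sum>z\<in>{x..<D}. a 0 ^ z * S z)"
    by (rule sum.mono_neutral_right) (auto simp: S0)
  also have "{x..<D} = insert x {x<..<D}" using xD by auto
  also have "(\<Sum>z\<in>insert x {x<..<D}. a 0 ^ z * S z) = a 0 ^ x * S x + (\<Sum>z\<in>{x<..<D}. a 0 ^ z * S z)"
    by simp
  also have "(\<Sum>z\<in>{x<..<D}. a 0 ^ z * S z) = a 0 ^ x * (a 0 * R)"
    unfolding R_def sum_distrib_left
  proof (intro sum.cong refl)
    fix z assume "z \<in> {x<..<D}"
    hence "z = x + Suc (z - Suc x)" by simp
    hence "a 0 ^ z = a 0 ^ x * (a 0 * a 0 ^ (z - Suc x))" by (metis power_Suc power_add)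
    thus "a 0 ^ z * S z = a 0 ^ x * (a 0 * (a 0 ^ (z - Suc x) * S z))" by (simp add: mult_ac)
  qed
  finally have T: "(\<Sum>z<D. a 0 ^ z * S z) = a 0 ^ x * (S x + a 0 * R)" by (simp add: distrib_left)
  have a0: "a 0 \<in> I 1" "a 0 \<notin> I 0" and I01: "I 0 \<subseteq> I 1" using Suc.prems(2,3)[of 0] by auto
  have "prime_set (I 0)" "prime_set (I 1)" using Suc.prems(1)[of 0] Suc.prems(1)[of 1] by simp_all
  note I0 = prime_setD[OF this(1)] and I1 = prime_setD[OF this(2)]
  show ?case
  proof
    assume "(\<Sum>e\<in>exponents D (Suc m). Const (w e) * (\<Prod>i<Suc m. a i ^ (e ! i))) \<in> I 0"
    hence "a 0 ^ x * (S x + a 0 * R) \<in> I 0" unfolding eq T .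
    hence "a 0 ^ x \<in> I 0 \<or> S x + a 0 * R \<in> I 0" by (rule I0)
    hence "S x + a 0 * R \<in> I 0" using prime_set_power[of "I 0" "a 0" x] a0 Suc.prems(1)[of 0] by auto
    hence "S x + a 0 * R \<in> I 1" using I01 by blast
    hence "(S x + a 0 * R) - a 0 * R \<in> I 1" using I1(3)[OF a0(1)] by (rule I1(8))
    thus False using Sx by simp
  qed
qed

text \<open>The degree is bounded in each variable separately, so that the admissible monomials fill
  a box whose size is a power.\<close>

definition deg_le :: "nat \<Rightarrow> 'k::comm_ring_1 coord_poly \<Rightarrow> bool" where
  "deg_le B p \<longleftrightarrow> (\<forall>m\<in>Poly_Mapping.keys p. \<forall>v. Poly_Mapping.lookup m v \<le> B)"

lemma deg_le_total_deg: "deg_le (total_deg p) p"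
  unfolding deg_le_def
proof (intro ballI allI)
  fix m v assume m: "m \<in> Poly_Mapping.keys p"
  show "Poly_Mapping.lookup m v \<le> total_deg p"
  proof (cases "v \<in> Poly_Mapping.keys m")
    case True
    hence "Poly_Mapping.lookup m v \<le> mon_deg m" unfolding mon_deg_def by (intro member_le_sum) auto
    thus ?thesis using mon_deg_le[OF m] by simp
  qed (simp add: in_keys_iff)
qed

lemma deg_le_mono: "deg_le A p \<Longrightarrow> A \<le> B \<Longrightarrow> deg_le B p"
  unfolding deg_le_def by (meson order_trans)

lemma deg_le_one: "deg_le B 1"
  by (auto simp: deg_le_def)

lemma deg_le_mult: "deg_le A p \<Longrightarrow> deg_le B q \<Longrightarrow> deg_le (A + B) (p * q)"
  unfolding deg_le_def
proof (intro ballI allI)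
  fix m v
  assume p: "\<forall>m\<in>Poly_Mapping.keys p. \<forall>v. Poly_Mapping.lookup m v \<le> A"
    and q: "\<forall>m\<in>Poly_Mapping.keys q. \<forall>v. Poly_Mapping.lookup m v \<le> B"
    and "m \<in> Poly_Mapping.keys (p * q)"
  then obtain a b where "m = a + b" "a \<in> Poly_Mapping.keys p" "b \<in> Poly_Mapping.keys q"
    using keys_mult[of p q] by blast
  thus "Poly_Mapping.lookup m v \<le> A + B" using p q by (simp add: lookup_add add_mono)
qed

lemma deg_le_power: "deg_le A p \<Longrightarrow> deg_le (k * A) (p ^ k)"
  by (induction k) (auto intro: deg_le_one deg_le_mult)

lemma deg_le_prod:
  "(\<And>i. i \<in> S \<Longrightarrow> deg_le (A i) (f i)) \<Longrightarrow> deg_le (\<Sum>i\<in>S. A i) (\<Prod>i\<in>S. f i)"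
  by (induction S rule: infinite_finite_induct) (auto intro: deg_le_one deg_le_mult)

definition bounded_monomials :: "coord set \<Rightarrow> nat \<Rightarrow> (coord \<Rightarrow>\<^sub>0 nat) set" where
  "bounded_monomials V B = {m. Poly_Mapping.keys m \<subseteq> V \<and> (\<forall>v. Poly_Mapping.lookup m v \<le> B)}"

lemma bounded_monomials:
  assumes V: "finite V"
  shows "finite (bounded_monomials V B)" "card (bounded_monomials V B) \<le> Suc B ^ card V"
proof -
  let ?f = "\<lambda>m. restrict (Poly_Mapping.lookup m) V"
  have inj: "inj_on ?f (bounded_monomials V B)"
  proof (rule inj_onI, rule poly_mapping_eqI)
    fix m m' v
    assume m: "m \<in> bounded_monomials V B" "m' \<in> bounded_monomials V B" and eq: "?f m = ?f m'"
    show "Poly_Mapping.lookup m v = Poly_Mapping.lookup m' v"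
    proof (cases "v \<in> V")
      case True
      thus ?thesis using fun_cong[OF eq, of v] by simp
    next
      case False
      hence "v \<notin> Poly_Mapping.keys m" "v \<notin> Poly_Mapping.keys m'"
        using m by (auto simp: bounded_monomials_def)
      thus ?thesis by (simp add: in_keys_iff)
    qed
  qed
  have sub: "?f ` bounded_monomials V B \<subseteq> V \<rightarrow>\<^sub>E {..B}" by (auto simp: bounded_monomials_def)
  have fin: "finite (V \<rightarrow>\<^sub>E {..B})" by (rule finite_PiE) (use V in auto)
  show "finite (bounded_monomials V B)" by (rule inj_on_finite[OF inj sub fin])
  have "card (bounded_monomials V B) \<le> card (V \<rightarrow>\<^sub>E {..B})" by (rule card_inj_on_le[OF inj sub fin])
  thus "card (bounded_monomials V B) \<le> Suc B ^ card V" by (simp add: card_PiE V)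
qed

lemma card_entry_vars: "finite (entry_vars n)" "card (entry_vars n) = n ^ 2"
proof -
  have eq: "entry_vars n = (\<lambda>(i, j). SC i j 0) ` ({..<n} \<times> {..<n})" by (auto simp: entry_vars_def)
  show "finite (entry_vars n)" unfolding eq by simp
  have "inj_on (\<lambda>(i, j). SC i j 0) ({..<n} \<times> {..<n})" by (auto simp: inj_on_def)
  thus "card (entry_vars n) = n ^ 2" unfolding eq by (simp add: card_image power2_eq_square)
qed

lemma lookup_Const_mult: "Poly_Mapping.lookup (Const c * p) m = c * Poly_Mapping.lookup p m"
  unfolding Const_def mult_map_scale_conv_mult[symmetric] by (simp add: Poly_Mapping.map.rep_eq when_def)

text \<open>
  \<open>D ^ m\<close> monomials in \<open>m\<close> elements would have to be independent in a space of polynomials in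
  \<open>n\<^sup>2\<close> variables whose dimension grows like \<open>D ^ n\<^sup>2\<close>.
\<close>

lemma step_eval_algebraic_relation:
  fixes a :: "nat \<Rightarrow> 'k::field coord_poly"
  assumes m: "m = Suc (n ^ 2)" and a: "\<And>i. i < m \<Longrightarrow> a i \<in> carrier (poly_ring (coords n))"
  obtains D w e where "e \<in> exponents D m" "w e \<noteq> 0"
    "step_eval n 0 (\<Sum>e\<in>exponents D m. Const (w e) * (\<Prod>i<m. a i ^ (e ! i))) = 0"
proof -
  define G where "G i = cleared n (a i)" for i
  define N where "N i = total_deg (a i)" for i
  \<comment> \<open>The outer substitution changes nothing, by \<open>d_eq\<close>; it shows which
    variables occur.\<close>
  define d :: "'k coord_poly" where
    "d = poly_eval Const (entry_point n generic_entry) (det (generic_mat n))"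
  have dV: "d \<in> carrier (poly_ring (entry_vars n))"
    unfolding d_def by (intro poly_eval_in_poly_ring entry_point_generic_closed)
  have d_eq: "d = det (generic_mat n)"
  proof -
    have "d = det (entry_mat n (\<lambda>i j. poly_eval Const (entry_point n generic_entry) (generic_entry i j)))"
      unfolding d_def by (rule det_entry_mat_hom[OF poly_eval_hom[OF comm_ring_hom_Const]])
    also have "\<dots> = det (generic_mat n)"
      by (intro arg_cong[of _ _ det] entry_mat_cong poly_eval_generic_entry[OF comm_ring_hom_Const])
    finally show ?thesis .
  qed
  have d0: "d \<noteq> 0" using det_step_entry[of n 0, where ?'k = 'k] by (simp add: d_eq step_entry_0)
  interpret st: comm_ring_hom "step_eval n 0 :: 'k coord_poly \<Rightarrow> _" by (rule comm_ring_hom_step_eval)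
  interpret tf: comm_ring_hom "to_fract :: 'k coord_poly \<Rightarrow> _" by (rule comm_ring_hom_to_fract)
  have Ga: "to_fract (G i) = to_fract d ^ N i * step_eval n 0 (a i)" if "i < m" for i
    using step_eval_cleared[OF a[OF that], of 0] poly_eval_generic_cleared[of n "a i"]
    by (simp add: G_def N_def d_eq step_entry_0)
  define E where "E = (\<Sum>i<m. total_deg (G i) + total_deg (d ^ N i))"
  have E: "deg_le E (G i)" "deg_le E (d ^ N i)" if "i < m" for i
  proof -
    have "total_deg (G i) + total_deg (d ^ N i) \<le> E"
      unfolding E_def by (rule member_le_sum) (use that in auto)
    thus "deg_le E (G i)" "deg_le E (d ^ N i)" by (auto intro: deg_le_mono[OF deg_le_total_deg])
  qed
  \<comment> \<open>The products \<open>H e\<close> involve at most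
    \<open>(D * Suc (m * E)) ^ (n ^ 2)\<close> monomials. As \<open>D\<close> exceeds
    \<open>Suc (m * E) ^ (n ^ 2)\<close>, this is less than \<open>D ^ Suc (n ^ 2)\<close>, the
    number of exponent vectors.\<close>
  define D where "D = Suc (Suc (m * E) ^ (n ^ 2))"
  \<comment> \<open>Padding the powers of \<open>d ^ N i\<close> up to exponent \<open>D\<close>
    gives all products the same factor \<open>c\<close>, so a linear relation between the
    \<open>H e\<close> passes to the power products of the \<open>a i\<close>.\<close>
  define H where "H e = (\<Prod>i<m. G i ^ (e ! i) * (d ^ N i) ^ (D - e ! i))" for e
  have HV: "H e \<in> carrier (poly_ring (entry_vars n))" for e
    unfolding H_def G_def
    by (intro poly_ring_prod poly_ring_mult poly_ring_power dV cleared_in_poly_ring)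
  have nth: "e ! i < D" if "e \<in> exponents D m" "i < m" for e i
    using that nth_mem[of i e] by (auto simp: exponents_def simp del: nth_mem)
  have Hdeg: "deg_le (m * (D * E)) (H e)" if e: "e \<in> exponents D m" for e
  proof -
    have "deg_le (\<Sum>i<m. (e ! i) * E + (D - e ! i) * E) (H e)"
      unfolding H_def by (intro deg_le_prod deg_le_mult deg_le_power E) auto
    moreover have "(\<Sum>i<m. (e ! i) * E + (D - e ! i) * E) = (\<Sum>i<m. D * E)"
      by (intro sum.cong refl) (use nth[OF e] in \<open>simp flip: add_mult_distrib add: less_imp_le\<close>)
    ultimately show ?thesis by simp
  qed
  let ?I = "bounded_monomials (entry_vars n) (m * (D * E))"
  have "card ?I \<le> Suc (m * (D * E)) ^ (n ^ 2)"
    using bounded_monomials(2)[OF card_entry_vars(1)] by (simp add: card_entry_vars(2))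
  also have "\<dots> \<le> (D * Suc (m * E)) ^ (n ^ 2)"
  proof (rule power_mono)
    have "D > 0" by (simp add: D_def)
    thus "Suc (m * (D * E)) \<le> D * Suc (m * E)" by (simp add: algebra_simps)
  qed simp
  also have "\<dots> = D ^ (n ^ 2) * Suc (m * E) ^ (n ^ 2)" by (rule power_mult_distrib)
  also have "\<dots> < D ^ (n ^ 2) * D"
    by (rule mult_strict_left_mono) (simp_all add: D_def)
  also have "\<dots> = D ^ m" unfolding m by simp
  also have "D ^ m = card (exponents D m)" by (simp add: exponents_def card_lists_length_eq)
  finally have "card ?I < card (exponents D m)" .
  then obtain w :: "nat list \<Rightarrow> 'k" where w: "\<exists>e\<in>exponents D m. w e \<noteq> 0"
      "\<forall>x\<in>?I. (\<Sum>e\<in>exponents D m. w e * Poly_Mapping.lookup (H e) x) = 0"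
    using homogeneous_system_nontrivial[of ?I "exponents D m" "\<lambda>e. Poly_Mapping.lookup (H e)"]
      bounded_monomials(1)[OF card_entry_vars(1)] by auto
  have rel: "(\<Sum>e\<in>exponents D m. Const (w e) * H e) = 0"
  proof (rule poly_mapping_eqI)
    fix x
    have "(\<Sum>e\<in>exponents D m. w e * Poly_Mapping.lookup (H e) x) = 0"
    proof (cases "x \<in> ?I")
      case False
      have "Poly_Mapping.lookup (H e) x = 0" if e: "e \<in> exponents D m" for e
      proof (rule ccontr)
        assume "Poly_Mapping.lookup (H e) x \<noteq> 0"
        hence "x \<in> Poly_Mapping.keys (H e)" by (simp add: in_keys_iff)
        thus False using False HV[of e] Hdeg[OF e]
          by (auto simp: bounded_monomials_def carrier_poly_ring deg_le_def)
      qed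
      thus ?thesis by simp
    qed (use w(2) in blast)
    thus "Poly_Mapping.lookup (\<Sum>e\<in>exponents D m. Const (w e) * H e) x = Poly_Mapping.lookup 0 x"
      by (simp add: lookup_sum lookup_Const_mult)
  qed
  define c where "c = (\<Prod>i<m. (to_fract d ^ N i) ^ D)"
  have "c \<noteq> 0" using d0 by (simp add: c_def)
  have Hc: "to_fract (H e) = c * step_eval n 0 (\<Prod>i<m. a i ^ (e ! i))" if e: "e \<in> exponents D m" for e
  proof -
    have "to_fract (H e)
        = (\<Prod>i<m. (to_fract d ^ N i * step_eval n 0 (a i)) ^ (e ! i) * (to_fract d ^ N i) ^ (D - e ! i))"
      by (simp add: H_def tf.hom_prod tf.hom_mult tf.hom_power Ga)
    also have "\<dots> = (\<Prod>i<m. (to_fract d ^ N i) ^ D * step_eval n 0 (a i) ^ (e ! i))"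
    proof (intro prod.cong refl)
      fix i assume "i \<in> {..<m}"
      hence "(to_fract d ^ N i) ^ D = (to_fract d ^ N i) ^ (e ! i) * (to_fract d ^ N i) ^ (D - e ! i)"
        using nth[OF e, of i] by (simp flip: power_add)
      thus "(to_fract d ^ N i * step_eval n 0 (a i)) ^ (e ! i) * (to_fract d ^ N i) ^ (D - e ! i)
          = (to_fract d ^ N i) ^ D * step_eval n 0 (a i) ^ (e ! i)"
        by (simp only: power_mult_distrib mult_ac)
    qed
    finally show ?thesis by (simp add: c_def prod.distrib st.hom_prod st.hom_power)
  qed
  have stC: "step_eval n 0 (Const x) = to_fract (Const x)" for x :: 'k
    unfolding step_eval_def by (simp add: poly_eval_Const[OF comm_ring_hom_fract_Const])
  have "0 = to_fract (\<Sum>e\<in>exponents D m. Const (w e) * H e)" by (simp add: rel)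
  also have "\<dots> = c * step_eval n 0 (\<Sum>e\<in>exponents D m. Const (w e) * (\<Prod>i<m. a i ^ (e ! i)))"
    unfolding tf.hom_sum tf.hom_mult st.hom_sum st.hom_mult sum_distrib_left stC
    by (intro sum.cong refl) (simp add: Hc)
  finally have "step_eval n 0 (\<Sum>e\<in>exponents D m. Const (w e) * (\<Prod>i<m. a i ^ (e ! i))) = 0"
    using \<open>c \<noteq> 0\<close> by simp
  thus ?thesis using that w(1) by blast
qed

text \<open>A longer chain would supply \<open>n^2 + 1\<close> elements independent modulo
  \<open>I 0\<close>, but they satisfy a relation at the generic matrix, and \<open>I 0\<close>
  contains everything that vanishes there.\<close>

theorem etale_prime_chain_le:
  fixes I :: "nat \<Rightarrow> 'k::field coord_poly set"
  assumes I: "\<And>i. i \<le> m \<Longrightarrow> prime_set (I i)" "\<And>i. i \<le> m \<Longrightarrow> B_relations n \<subseteq> I i"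
      "\<And>i. i \<le> m \<Longrightarrow> B_disc n \<notin> I i"
    and sub: "\<And>i. i < m \<Longrightarrow> I i \<subseteq> I (Suc i)"
    and ne: "\<And>i. i < m \<Longrightarrow> \<exists>a\<in>carrier (poly_ring (coords n)). a \<in> I (Suc i) - I i"
  shows "m \<le> n ^ 2"
proof (rule ccontr)
  define r where "r = Suc (n ^ 2)"
  assume "\<not> m \<le> n ^ 2"
  hence r: "r \<le> m" by (simp add: r_def)
  have "\<forall>i. \<exists>a. i < m \<longrightarrow> a \<in> carrier (poly_ring (coords n)) \<and> a \<in> I (Suc i) - I i" using ne by blast
  then obtain a where a: "\<And>i. i < m \<Longrightarrow> a i \<in> carrier (poly_ring (coords n))"
      "\<And>i. i < m \<Longrightarrow> a i \<in> I (Suc i) - I i"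
    by metis
  obtain D w e where w: "e \<in> exponents D r" "w e \<noteq> 0"
    "step_eval n 0 (\<Sum>e\<in>exponents D r. Const (w e) * (\<Prod>i<r. a i ^ (e ! i))) = 0"
    by (rule step_eval_algebraic_relation[OF r_def, of a]) (use a r in auto)
  let ?s = "\<Sum>e\<in>exponents D r. Const (w e) * (\<Prod>i<r. a i ^ (e ! i))"
  have "?s \<in> carrier (poly_ring (coords n))"
    by (intro poly_ring_sum poly_ring_mult poly_ring_prod poly_ring_power poly_ring_Const a)
      (use r in auto)
  hence "?s \<in> I 0" using etale_prime_contains_generic[OF I[of 0]] w(3) by simp
  moreover have "?s \<notin> I 0"
    by (rule prime_chain_independent[where I = I]) (use I sub a w r in auto)
  ultimately show False by blast
qed

section \<open>Irreducibility and dimension\<close>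

abbreviation basic_open :: "('a, 'b) ring_scheme \<Rightarrow> 'a \<Rightarrow> 'a set topology" where
  "basic_open R d \<equiv> subtopology (zariski R) {p. d \<notin> p}"

lemma topspace_basic_open: "topspace (basic_open R d) = {p \<in> spectrum R. d \<notin> p}"
  by (auto simp: topspace_zariski)

lemma closedin_basic_open:
  "closedin (basic_open R d) C \<longleftrightarrow> (\<exists>E. E \<subseteq> carrier R \<and> C = {p \<in> spectrum R. d \<notin> p \<and> E \<subseteq> p})"
proof -
  have "{p \<in> spectrum R. E \<subseteq> p} \<inter> {p. d \<notin> p} = {p \<in> spectrum R. d \<notin> p \<and> E \<subseteq> p}" for E by auto
  thus ?thesis unfolding closedin_subtopology closedin_zariski by metis
qed

lemma primeideal_subset: "primeideal p R \<Longrightarrow> p \<subseteq> carrier R"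
  using additive_subgroup.a_subset ideal.axioms(1) primeideal.axioms(1) by blast

text \<open>The set is the closure of the point \<open>p\<close>: a closed subset through
  \<open>p\<close> contains all its primes, so of two closed sets covering it the one through
  \<open>p\<close> is everything.\<close>

lemma point_closure:
  assumes p: "p \<in> spectrum R" "d \<notin> p"
  shows "closedin (basic_open R d) {q \<in> spectrum R. d \<notin> q \<and> p \<subseteq> q}"
    and "irreducible_space (subtopology (basic_open R d) {q \<in> spectrum R. d \<notin> q \<and> p \<subseteq> q})"
proof -
  let ?V = "{q \<in> spectrum R. d \<notin> q \<and> p \<subseteq> q}"
  show cl: "closedin (basic_open R d) ?V"
    unfolding closedin_basic_open
    using primeideal_subset[of p R] p by (intro exI[of _ p]) (auto simp: spectrum_def)
  have top: "topspace (subtopology (basic_open R d) ?V) = ?V"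
    unfolding topspace_subtopology[of "basic_open R d"] topspace_basic_open by blast
  have *: "C = ?V" if C: "closedin (subtopology (basic_open R d) ?V) C" and pC: "p \<in> C" for C
  proof -
    from C have "closedin (basic_open R d) C" "C \<subseteq> ?V"
      unfolding closedin_closed_subtopology[OF cl] by auto
    then obtain E where "C = {q \<in> spectrum R. d \<notin> q \<and> E \<subseteq> q}" unfolding closedin_basic_open by blast
    thus ?thesis using pC \<open>C \<subseteq> ?V\<close> by blast
  qed
  show "irreducible_space (subtopology (basic_open R d) ?V)"
    unfolding irreducible_space_def top
  proof (intro conjI allI impI)
    show "?V \<noteq> {}" using p by blast
    fix C D
    assume CD: "closedin (subtopology (basic_open R d) ?V) C \<and>
      closedin (subtopology (basic_open R d) ?V) D \<and> C \<union> D = ?V"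
    moreover have "p \<in> ?V" using p by blast
    ultimately have "p \<in> C \<or> p \<in> D" by blast
    thus "C = ?V \<or> D = ?V" using * CD by blast
  qed
qed

text \<open>Sobriety: if the intersection contains a product, every point of \<open>Z\<close>
  contains one of the two factors, which covers \<open>Z\<close> by two closed subsets;
  irreducibility makes one of them all of \<open>Z\<close>.\<close>

lemma irreducible_closed_generic_point:
  assumes R: "cring R" and Z: "closedin (basic_open R d) Z"
    and irr: "irreducible_space (subtopology (basic_open R d) Z)"
  shows "\<Inter>Z \<in> spectrum R" "d \<notin> \<Inter>Z" "Z = {q \<in> spectrum R. d \<notin> q \<and> \<Inter>Z \<subseteq> q}"
proof -
  interpret cring R by (rule R)
  obtain E where E: "E \<subseteq> carrier R" "Z = {q \<in> spectrum R. d \<notin> q \<and> E \<subseteq> q}"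
    using Z unfolding closedin_basic_open by blast
  have top: "topspace (subtopology (basic_open R d) Z) = Z"
    unfolding topspace_subtopology[of "basic_open R d"] topspace_basic_open using E(2) by blast
  have ne: "Z \<noteq> {}" using irr unfolding irreducible_space_def top by blast
  then obtain q0 where q0: "q0 \<in> Z" by blast
  have prime: "primeideal q R" "d \<notin> q" if "q \<in> Z" for q using that E(2) by (auto simp: spectrum_def)
  show d: "d \<notin> \<Inter>Z" using q0 prime(2) by blast
  have "primeideal (\<Inter>Z) R"
  proof (rule primeidealI)
    show "ideal (\<Inter>Z) R" by (rule i_Intersect[OF _ ne]) (use prime(1) primeideal.axioms(1) in blast)
    show "carrier R \<noteq> \<Inter>Z"
      using primeideal.I_notcarr[OF prime(1)[OF q0]] primeideal_subset[OF prime(1)[OF q0]] q0 by blast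
    fix a b assume ab: "a \<in> carrier R" "b \<in> carrier R" "a \<otimes>\<^bsub>R\<^esub> b \<in> \<Inter>Z"
    define V where "V x = {q \<in> spectrum R. d \<notin> q \<and> insert x E \<subseteq> q}" for x
    have "closedin (subtopology (basic_open R d) Z) (V x)" if "x \<in> carrier R" for x
    proof -
      have "closedin (basic_open R d) (V x)"
        unfolding closedin_basic_open V_def using that E(1) by blast
      moreover have "V x \<subseteq> Z" by (auto simp: V_def E(2))
      ultimately show ?thesis unfolding closedin_closed_subtopology[OF Z] by blast
    qed
    moreover have "V a \<union> V b = Z"
    proof
      show "V a \<union> V b \<subseteq> Z" by (auto simp: V_def E(2))
      show "Z \<subseteq> V a \<union> V b"
      proof
        fix q assume q: "q \<in> Z"
        hence "a \<otimes>\<^bsub>R\<^esub> b \<in> q" using ab(3) by blast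
        hence "a \<in> q \<or> b \<in> q" using primeideal.I_prime[OF prime(1)[OF q]] ab(1,2) by blast
        thus "q \<in> V a \<union> V b" using q by (auto simp: V_def E(2))
      qed
    qed
    ultimately have "V a = Z \<or> V b = Z"
      using irr ab(1,2) unfolding irreducible_space_def top by blast
    thus "a \<in> \<Inter>Z \<or> b \<in> \<Inter>Z" by (auto simp: V_def)
  qed (rule R)
  thus "\<Inter>Z \<in> spectrum R" by (simp add: spectrum_def)
  show "Z = {q \<in> spectrum R. d \<notin> q \<and> \<Inter>Z \<subseteq> q}"
  proof
    show "Z \<subseteq> {q \<in> spectrum R. d \<notin> q \<and> \<Inter>Z \<subseteq> q}" using E(2) by auto
    have "E \<subseteq> \<Inter>Z" using E(2) by auto
    hence "{q \<in> spectrum R. d \<notin> q \<and> \<Inter>Z \<subseteq> q} \<subseteq> {q \<in> spectrum R. d \<notin> q \<and> E \<subseteq> q}" by blast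
    thus "{q \<in> spectrum R. d \<notin> q \<and> \<Inter>Z \<subseteq> q} \<subseteq> Z" by (simp only: E(2)[symmetric])
  qed
qed

text \<open>A smallest prime is a dense point.\<close>

lemma irreducible_basic_open:
  assumes p: "p \<in> spectrum R" "d \<notin> p" and least: "\<And>q. q \<in> spectrum R \<Longrightarrow> d \<notin> q \<Longrightarrow> p \<subseteq> q"
  shows "irreducible_space (basic_open R d)"
proof -
  have "{q \<in> spectrum R. d \<notin> q \<and> p \<subseteq> q} = topspace (basic_open R d)"
    unfolding topspace_basic_open using least by blast
  thus ?thesis using point_closure(2)[OF p] by (simp only: subtopology_topspace)
qed

text \<open>Primes correspond to irreducible closed subsets with inclusions reversed, so chains are
  read backwards; hence the indices \<open>N - i\<close> and \<open>m - i\<close>.\<close>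

lemma krull_dim_basic_open:
  assumes R: "cring R"
    and p: "\<And>i. i \<le> N \<Longrightarrow> p i \<in> spectrum R \<and> d \<notin> p i" "\<And>i. i < N \<Longrightarrow> p i \<subset> p (Suc i)"
    and bound: "\<And>m q. \<lbrakk>\<And>i. i \<le> m \<Longrightarrow> q i \<in> spectrum R \<and> d \<notin> q i; \<And>i. i < m \<Longrightarrow> q i \<subset> q (Suc i)\<rbrakk>
      \<Longrightarrow> m \<le> N"
  shows "krull_dim (basic_open R d) = ereal (real N)"
proof -
  define V where "V p = {q \<in> spectrum R. d \<notin> q \<and> p \<subseteq> q}" for p
  define chain where "chain m Z \<longleftrightarrow> (\<forall>i\<le>m. closedin (basic_open R d) (Z i) \<and>
    irreducible_space (subtopology (basic_open R d) (Z i))) \<and> (\<forall>i<m. Z i \<subset> Z (Suc i))" for m Z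
  have dim: "krull_dim (basic_open R d) = Sup {ereal (real m) | m. \<exists>Z. chain m Z}"
    unfolding krull_dim_def chain_def ..
  have "chain N (\<lambda>i. V (p (N - i)))"
    unfolding chain_def
  proof (intro conjI allI impI)
    fix i assume "i < N"
    hence "p (N - Suc i) \<subset> p (N - i)" "N - Suc i \<le> N"
      using p(2)[of "N - Suc i"] by (simp_all add: Suc_diff_Suc)
    moreover from this have "p (N - Suc i) \<in> V (p (N - Suc i)) - V (p (N - i))"
      using p(1)[of "N - Suc i"] by (auto simp: V_def)
    ultimately show "V (p (N - i)) \<subset> V (p (N - Suc i))" by (auto simp: V_def)
  qed (use p(1) point_closure[of _ R d] in \<open>simp_all add: V_def\<close>)
  hence "ereal (real N) \<in> {ereal (real m) | m. \<exists>Z. chain m Z}" by blast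
  moreover have "x \<le> ereal (real N)" if "x \<in> {ereal (real m) | m. \<exists>Z. chain m Z}" for x
  proof -
    from that obtain m Z where x: "x = ereal (real m)" and Z: "chain m Z" by blast
    have gen: "\<Inter>(Z i) \<in> spectrum R" "d \<notin> \<Inter>(Z i)" "Z i = V (\<Inter>(Z i))" if "i \<le> m" for i
      using irreducible_closed_generic_point[OF R, of d "Z i"] Z that by (simp_all add: V_def chain_def)
    have "m \<le> N"
    proof (rule bound[where q = "\<lambda>i. \<Inter>(Z (m - i))"])
      show "\<Inter>(Z (m - i)) \<in> spectrum R \<and> d \<notin> \<Inter>(Z (m - i))" if "i \<le> m" for i using gen[of "m - i"] by simp
      fix i assume i: "i < m"
      have sub: "Z (m - Suc i) \<subset> Z (m - i)"
      proof -
        have "m - Suc i < m" "Suc (m - Suc i) = m - i" using i by simp_all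
        thus ?thesis using Z unfolding chain_def by metis
      qed
      hence "\<Inter>(Z (m - i)) \<subseteq> \<Inter>(Z (m - Suc i))" by blast
      moreover have "\<Inter>(Z (m - i)) \<noteq> \<Inter>(Z (m - Suc i))"
        using sub gen(3)[of "m - i"] gen(3)[of "m - Suc i"] by auto
      ultimately show "\<Inter>(Z (m - i)) \<subset> \<Inter>(Z (m - Suc i))" by blast
    qed
    thus ?thesis by (simp add: x)
  qed
  ultimately show ?thesis unfolding dim by (intro antisym Sup_least Sup_upper)
qed

section \<open>Prime ideals of the coordinate ring\<close>

lemma coord_retract_id:
  assumes "p \<in> carrier (poly_ring (coords n))"
  shows "coord_retract n p = p"
proof -
  have "coord_retract n p = poly_eval Const Var p"
    unfolding coord_retract_def by (rule poly_eval_cong[OF assms]) simp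
  thus ?thesis by (simp add: poly_eval_Const_Var)
qed

lemma B_disc_closed: "B_disc n \<in> carrier (poly_ring (coords n))"
proof -
  have "coord_retract n (B_disc n) = B_disc n"
    unfolding disc_hom[OF comm_ring_hom_coord_retract]
    by (rule disc_cong) (auto simp: coords_def intro!: coord_retract_id poly_ring_Var)
  thus ?thesis using coord_retract_closed by metis
qed

lemma B_class_add: "\<lbrakk>p \<in> carrier (poly_ring (coords n)); q \<in> carrier (poly_ring (coords n))\<rbrakk> \<Longrightarrow>
    B_class n (p + q) = B_class n p \<oplus>\<^bsub>B_ring n\<^esub> B_class n q"
  and B_class_mult: "\<lbrakk>p \<in> carrier (poly_ring (coords n)); q \<in> carrier (poly_ring (coords n))\<rbrakk> \<Longrightarrow>
    B_class n (p * q) = B_class n p \<otimes>\<^bsub>B_ring n\<^esub> B_class n q"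
  and B_class_1: "B_class n 1 = \<one>\<^bsub>B_ring n\<^esub>"
  using Ring.ring_hom_add[OF B_class_hom] Ring.ring_hom_mult[OF B_class_hom]
    Ring.ring_hom_one[OF B_class_hom] by simp_all

lemma B_class_0: "B_class n 0 = \<zero>\<^bsub>B_ring n\<^esub>"
  using additive_subgroup.zero_closed[OF ideal.axioms(1)[OF ideal_rel_ideal[of n]]]
  by (intro B_class_rel) simp

text \<open>The preimage of \<open>q\<close> among polynomials, taken along
  \<open>coord_retract\<close> so that it is a \<open>prime_set\<close> of the whole type.\<close>

definition prime_lift :: "nat \<Rightarrow> 'k::comm_ring_1 coord_poly set set \<Rightarrow> 'k coord_poly set" where
  "prime_lift n q = {p. B_class n (coord_retract n p) \<in> q}"

lemma prime_lift_iff: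
  "p \<in> carrier (poly_ring (coords n)) \<Longrightarrow> p \<in> prime_lift n q \<longleftrightarrow> B_class n p \<in> q"
  by (simp add: prime_lift_def coord_retract_id)

lemma prime_lift:
  assumes q: "q \<in> spectrum (B_ring n)"
  shows "prime_set (prime_lift n q)" "B_relations n \<subseteq> prime_lift n q"
    and "B_Delta n \<notin> q \<Longrightarrow> B_disc n \<notin> prime_lift n q"
proof -
  interpret q: primeideal q "B_ring n" using q by (simp add: spectrum_def)
  interpret r: comm_ring_hom "coord_retract n" by (rule comm_ring_hom_coord_retract)
  note cl = coord_retract_closed
  have one: "\<one>\<^bsub>B_ring n\<^esub> \<notin> q" using q.one_imp_carrier q.I_notcarr by blast
  show "prime_set (prime_lift n q)"
    unfolding prime_set_def prime_lift_def mem_Collect_eq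
  proof (intro conjI ballI allI impI)
    show "B_class n (coord_retract n 0) \<in> q" using q.zero_closed by (simp add: B_class_0)
    show "B_class n (coord_retract n 1) \<notin> q" using one by (simp add: B_class_1)
  next
    fix a b
    assume "a \<in> {p. B_class n (coord_retract n p) \<in> q}" "b \<in> {p. B_class n (coord_retract n p) \<in> q}"
    thus "B_class n (coord_retract n (a + b)) \<in> q" by (simp add: r.hom_add B_class_add cl q.a_closed)
  next
    fix a b
    assume "a \<in> {p. B_class n (coord_retract n p) \<in> q}"
    thus "B_class n (coord_retract n (a * b)) \<in> q"
      by (simp add: r.hom_mult B_class_mult cl q.I_r_closed B_class_closed)
  next
    fix a b
    assume "B_class n (coord_retract n (a * b)) \<in> q"
    thus "B_class n (coord_retract n a) \<in> q \<or> B_class n (coord_retract n b) \<in> q"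
      by (simp add: r.hom_mult B_class_mult cl q.I_prime B_class_closed)
  qed
  show "B_relations n \<subseteq> prime_lift n q"
  proof
    fix p :: "'a coord_poly" assume p: "p \<in> B_relations n"
    hence "B_class n p = \<zero>\<^bsub>B_ring n\<^esub>" using rel_in_rel_ideal by (intro B_class_rel) blast
    thus "p \<in> prime_lift n q" using p rel_subset q.zero_closed by (subst prime_lift_iff) auto
  qed
  show "B_Delta n \<notin> q \<Longrightarrow> B_disc n \<notin> prime_lift n q"
    by (simp add: prime_lift_iff B_disc_closed B_Delta_def)
qed

definition step_prime :: "nat \<Rightarrow> nat \<Rightarrow> 'k::field coord_poly set set" where
  "step_prime n s = B_class n ` {p \<in> carrier (poly_ring (coords n)). step_eval n s p = 0}"

text \<open>The split point of step \<open>s\<close> satisfies the relations, so it induces a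
  homomorphism from \<open>B_ring n\<close> to a field; \<open>step_prime n s\<close> is its
  kernel.\<close>

lemma step_prime:
  shows step_prime_spectrum: "(step_prime n s :: 'k::field coord_poly set set) \<in> spectrum (B_ring n)"
    and B_class_step_prime_iff: "p \<in> carrier (poly_ring (coords n)) \<Longrightarrow>
      B_class n p \<in> step_prime n s \<longleftrightarrow> step_eval n s (p :: 'k coord_poly) = 0"
proof -
  let ?R = "B_ring n :: 'k coord_poly set ring" and ?x = "split_point n (step_frac n s) (step_inv n s)"
  let ?S = "ring_of_type_algebra :: 'k coord_poly fract ring"
  obtain h where h: "h \<in> B_hom n (to_fract \<circ> Const :: 'k \<Rightarrow> _)"
    and hSC: "\<And>i j l. \<lbrakk>i < n; j < n; l < n\<rbrakk> \<Longrightarrow> h (B_class n (Var (SC i j l))) = ?x (SC i j l)"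
    and hUC: "\<And>i. i < n \<Longrightarrow> h (B_class n (Var (UC i))) = ?x (UC i)"
    by (rule B_hom_exists[OF comm_ring_hom_fract_Const split_point_relations[OF step_inv]]) blast
  have ev: "h (B_class n p) = step_eval n s p" if p: "p \<in> carrier (poly_ring (coords n))" for p
    unfolding B_hom_eq[OF comm_ring_hom_fract_Const h p] step_eval_def
    by (rule poly_eval_cong[OF p]) (auto simp: coords_def hSC hUC simp del: split_point.simps)
  have hh: "h \<in> Ring.ring_hom ?R ?S" using h by (simp add: B_hom_def)
  interpret R: cring ?R by (rule cring_B_ring)
  have rh: "ring_hom_ring ?R ?S h"
    by (rule ring_hom_ringI2[OF R.ring_axioms cring.axioms(1)[OF cring_from_type_algebra] hh])
  have ker: "step_prime n s = a_kernel ?R ?S h"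
  proof
    show "step_prime n s \<subseteq> a_kernel ?R ?S h"
      unfolding step_prime_def a_kernel_def' by (auto simp: ev B_class_closed)
    show "a_kernel ?R ?S h \<subseteq> step_prime n s"
    proof
      fix x assume "x \<in> a_kernel ?R ?S h"
      hence x: "x \<in> carrier ?R" "h x = 0" by (auto simp: a_kernel_def')
      obtain p where "p \<in> carrier (poly_ring (coords n))" "x = B_class n p" using x(1) by (rule B_class_surj)
      thus "x \<in> step_prime n s" using x(2) by (auto simp: step_prime_def ev)
    qed
  qed
  have "primeideal (step_prime n s) ?R"
  proof (rule primeidealI)
    show "ideal (step_prime n s) ?R" unfolding ker by (rule ring_hom_ring.kernel_is_ideal[OF rh])
    show "carrier ?R \<noteq> step_prime n s"
    proof
      assume "carrier ?R = step_prime n s"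
      hence "\<one>\<^bsub>?R\<^esub> \<in> a_kernel ?R ?S h" using ker R.one_closed by blast
      thus False using Ring.ring_hom_one[OF hh] by (simp add: a_kernel_def')
    qed
    fix a b
    assume ab: "a \<in> carrier ?R" "b \<in> carrier ?R" "a \<otimes>\<^bsub>?R\<^esub> b \<in> step_prime n s"
    hence "h a * h b = 0" using Ring.ring_hom_mult[OF hh ab(1,2)] unfolding ker by (simp add: a_kernel_def')
    thus "a \<in> step_prime n s \<or> b \<in> step_prime n s"
      unfolding ker using ab(1,2) by (auto simp: a_kernel_def')
  qed (rule R.is_cring)
  thus "step_prime n s \<in> spectrum ?R" by (simp add: spectrum_def)
  show "B_class n p \<in> step_prime n s \<longleftrightarrow> step_eval n s p = 0"
    if p: "p \<in> carrier (poly_ring (coords n))" for p :: "'k coord_poly"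
    unfolding ker using ev[OF p] B_class_closed[OF p] by (simp add: a_kernel_def')
qed

lemma B_Delta_step_prime: "B_Delta n \<notin> (step_prime n s :: 'k::field coord_poly set set)"
proof -
  have "step_eval n s (B_disc n :: 'k coord_poly) = disc n (\<lambda>i j l. step_eval n s (Var (SC i j l)))"
    by (rule disc_hom[OF comm_ring_hom_step_eval])
  also have "\<dots> = disc n (\<lambda>i j l. split_point n (step_frac n s) (step_inv n s) (SC i j l))"
    by (simp add: step_eval_def poly_eval_Var[OF comm_ring_hom_fract_Const] del: split_point.simps)
  also have "\<dots> = det (entry_mat n (step_frac n s)) ^ 2" by (rule split_point_disc[OF step_inv])
  finally have "step_eval n s (B_disc n) \<noteq> (0 :: 'k coord_poly fract)"
    by (simp add: det_step_frac_nonzero)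
  thus ?thesis unfolding B_Delta_def B_class_step_prime_iff[OF B_disc_closed] .
qed

lemma step_prime_strict:
  assumes "s < n ^ 2"
  shows "(step_prime n s :: 'k::field coord_poly set set) \<subset> step_prime n (Suc s)"
proof
  show "(step_prime n s :: 'k coord_poly set set) \<subseteq> step_prime n (Suc s)"
    unfolding step_prime_def using step_eval_mono[of s "Suc s"] by auto
  obtain p :: "'k coord_poly" where p: "p \<in> carrier (poly_ring (coords n))"
    "step_eval n s p \<noteq> 0" "step_eval n (Suc s) p = 0"
    using step_eval_strict[OF assms] by blast
  thus "(step_prime n s :: 'k coord_poly set set) \<noteq> step_prime n (Suc s)"
    using B_class_step_prime_iff[OF p(1)] by blast
qed

theorem corollary6p6:
  fixes n :: nat
  shows "irreducible_space (B_et_space TYPE('k::field) n)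
       \<and> krull_dim (B_et_space TYPE('k) n) = ereal (real (n ^ 2))"
proof
  let ?R = "B_ring n :: 'k coord_poly set ring" and ?d = "B_Delta n :: 'k coord_poly set"
  have space: "B_et_space TYPE('k) n = basic_open ?R ?d" by (simp add: B_et_space_def B_space_def)
  show "irreducible_space (B_et_space TYPE('k) n)"
    unfolding space
  \<comment> \<open>The kernel at the generic matrix is the smallest prime of the etale
    locus.\<close>
  proof (rule irreducible_basic_open[OF step_prime_spectrum B_Delta_step_prime])
    fix q assume q: "q \<in> spectrum ?R" "?d \<notin> q"
    show "step_prime n 0 \<subseteq> q"
    proof
      fix x :: "'k coord_poly set" assume "x \<in> step_prime n 0"
      then obtain p where p: "p \<in> carrier (poly_ring (coords n))" "step_eval n 0 p = 0" "x = B_class n p"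
        by (auto simp: step_prime_def)
      have "p \<in> prime_lift n q"
        by (rule etale_prime_contains_generic[OF prime_lift[OF q(1)] p(1,2)]) (rule q(2))
      thus "x \<in> q" using p(1,3) by (simp add: prime_lift_iff)
    qed
  qed
  show "krull_dim (B_et_space TYPE('k) n) = ereal (real (n ^ 2))"
    unfolding space
  proof (rule krull_dim_basic_open[OF cring_B_ring, where p = "step_prime n"])
    fix m and q :: "nat \<Rightarrow> 'k coord_poly set set"
    assume q: "\<And>i. i \<le> m \<Longrightarrow> q i \<in> spectrum ?R \<and> ?d \<notin> q i" "\<And>i. i < m \<Longrightarrow> q i \<subset> q (Suc i)"
    show "m \<le> n ^ 2"
    proof (rule etale_prime_chain_le[where I = "\<lambda>i. prime_lift n (q i)"])
      fix i assume i: "i < m"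
      show "prime_lift n (q i) \<subseteq> prime_lift n (q (Suc i))"
        using q(2)[OF i] by (auto simp: prime_lift_def)
      obtain x where x: "x \<in> q (Suc i)" "x \<notin> q i" using q(2)[OF i] by blast
      have "x \<in> carrier ?R"
        using x(1) q(1)[of "Suc i"] i primeideal_subset[of "q (Suc i)" ?R] by (auto simp: spectrum_def)
      then obtain p where "p \<in> carrier (poly_ring (coords n))" "x = B_class n p" by (rule B_class_surj)
      thus "\<exists>a\<in>carrier (poly_ring (coords n)). a \<in> prime_lift n (q (Suc i)) - prime_lift n (q i)"
        using x by (auto simp: prime_lift_iff)
    qed (use q(1) prime_lift in blast)+
  qed (use step_prime_spectrum B_Delta_step_prime step_prime_strict in blast)+
qed

end
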